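(* For a finite graph $G$ with edge set $E$ let $q_G(x)=\mathbb E_\sigma\det(xI-A_\sigma^2)$, the average over uniformly random signings $\sigma\in\{\pm1\}^E$. Then $q_G$ is not real-rooted in general. For $G=C_4$ the two switching classes have $A_\sigma^2$-spectra $\{4,4,0,0\}$ and $\{2,2,2,2\}$, so $$q_{C_4}(x)=\tfrac12\bigl[x^2(x-4)^2+(x-2)^4\bigr]=x^4-8x^3+20x^2-16x+8=(x^2-4x+2)^2+4,$$ which has no real roots at all. Exhaustive computation over all connected regular graphs on at most $7$ vertices, plus the Petersen graph, the cube $Q_3$ and $K_{3,3}$, shows that real-rootedness of $q_G$ fails for every instance except the odd cycles (where $A_\sigma^2$ is signing-independent) and $K_4$: $q_{K_4}=x^4-12x^3+42x^2-52x+21$ is real-rooted despite the three quadrilaterals of $K_4$, so containing an even cycle is not the criterion, and characterizing the graphs with real-rooted $q_G$ is open. In all computed cases every complex root of $q_G$ satisfied $\operatorname{Re}\le4(d-1)$, where $d$ is the degree of $G$.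
   Context: $A_\sigma$ is the signed adjacency matrix of $G$, with $uv$ entry $\sigma_{uv}$ if $uv\in E$ and $0$ otherwise. Two signings are in the same switching class if one is obtained from the other by repeatedly negating all edges at a vertex. A polynomial is real-rooted if all its complex roots are real. $C_4$ is the $4$-cycle; a quadrilateral is a $4$-cycle subgraph.
   Formalization: Connected regular graphs are taken with degree d at least 2, since K_1 and K_2 violate both claims; for odd cycles, "signing-independent" means A_σ^2 is the same up to conjugation by a ±1 diagonal matrix; the remark that a characterization is open is omitted. *)

theory Defs
  imports
    "HOL-Analysis.Analysis"
    "HOL-Computational_Algebra.Computational_Algebra"
begin

text \<open>
  A finite graph has a finite type \<open>'a\<close> as vertex set and is given by its set of edges, each
  edge being a two-element set of vertices.
\<close>

definition simple_graph :: "'a set set \<Rightarrow> bool" where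
  "simple_graph E \<longleftrightarrow> (\<forall>e\<in>E. card e = 2)"

definition regular_graph :: "'a set set \<Rightarrow> nat \<Rightarrow> bool" where
  "regular_graph E d \<longleftrightarrow> (\<forall>v. card {w. {v, w} \<in> E} = d)"

definition connected_graph :: "'a set set \<Rightarrow> bool" where
  "connected_graph E \<longleftrightarrow> (\<forall>u v. (u, v) \<in> {(a, b). {a, b} \<in> E}\<^sup>*)"

definition graph_iso :: "'a set set \<Rightarrow> 'b set \<Rightarrow> 'b set set \<Rightarrow> bool" where
  "graph_iso E V F \<longleftrightarrow> (\<exists>f. bij_betw f UNIV V \<and> (\<lambda>e. f ` e) ` E = F)"

definition cycle_on :: "'a list \<Rightarrow> 'a set set \<Rightarrow> bool" where
  "cycle_on vs F \<longleftrightarrow>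
     3 \<le> length vs \<and> distinct vs \<and>
     F = {{vs ! i, vs ! (Suc i mod length vs)} | i. i < length vs}"

definition cycle_subgraphs :: "'a set set \<Rightarrow> nat \<Rightarrow> 'a set set set" where
  "cycle_subgraphs E n = {F. F \<subseteq> E \<and> (\<exists>vs. length vs = n \<and> cycle_on vs F)}"

definition is_cycle_graph :: "'a set set \<Rightarrow> nat \<Rightarrow> bool" where
  "is_cycle_graph E n \<longleftrightarrow> (\<exists>vs. length vs = n \<and> set vs = UNIV \<and> cycle_on vs E)"

definition is_odd_cycle_graph :: "'a set set \<Rightarrow> bool" where
  "is_odd_cycle_graph E \<longleftrightarrow> (\<exists>n. odd n \<and> is_cycle_graph E n)"

definition contains_even_cycle :: "'a set set \<Rightarrow> bool" where
  "contains_even_cycle E \<longleftrightarrow> (\<exists>n. even n \<and> cycle_subgraphs E n \<noteq> {})"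

definition is_K4 :: "'a::finite set set \<Rightarrow> bool" where
  "is_K4 E \<longleftrightarrow> CARD('a) = 4 \<and> E = {e. card e = 2}"

definition is_K33 :: "'a set set \<Rightarrow> bool" where
  "is_K33 E \<longleftrightarrow> graph_iso E {..<6::nat} {{i, j} | i j. i < 3 \<and> 3 \<le> j \<and> j < 6}"

text \<open>The vertices of the cube are encoded as the subsets of a three-element set.\<close>

definition is_cube :: "'a set set \<Rightarrow> bool" where
  "is_cube E \<longleftrightarrow>
     graph_iso E (Pow {..<3::nat})
       {{A, B} | A B. A \<subseteq> {..<3} \<and> B \<subseteq> {..<3} \<and> card ((A - B) \<union> (B - A)) = 1}"

definition is_petersen :: "'a set set \<Rightarrow> bool" where
  "is_petersen E \<longleftrightarrow>
     graph_iso E {A. A \<subseteq> {..<5::nat} \<and> card A = 2}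
       {{A, B} | A B. A \<subseteq> {..<5} \<and> card A = 2 \<and> B \<subseteq> {..<5} \<and> card B = 2 \<and> A \<inter> B = {}}"

text \<open>
  The one- and two-vertex complete graphs are regular of degree 0 and 1; for them the average below
  is \<open>x\<close> and \<open>(x - 1)\<^sup>2\<close>, which is real-rooted with roots exceeding \<open>4 * (d - 1)\<close>. The degree is
  therefore required to be at least 2.
\<close>

definition computed_case :: "'a::finite set set \<Rightarrow> bool" where
  "computed_case E \<longleftrightarrow>
     (simple_graph E \<and> connected_graph E \<and> (\<exists>d\<ge>2. regular_graph E d) \<and> CARD('a) \<le> 7) \<or>
     is_petersen E \<or> is_cube E \<or> is_K33 E"

definition signings :: "'a set set \<Rightarrow> ('a set \<Rightarrow> real) set" where
  "signings E = E \<rightarrow>\<^sub>E {1, - 1}"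

definition switch_at :: "'a set set \<Rightarrow> 'a \<Rightarrow> ('a set \<Rightarrow> real) \<Rightarrow> 'a set \<Rightarrow> real" where
  "switch_at E v \<sigma> = (\<lambda>e\<in>E. if v \<in> e then - \<sigma> e else \<sigma> e)"

definition switching_classes :: "'a set set \<Rightarrow> ('a set \<Rightarrow> real) set set" where
  "switching_classes E =
     signings E // {(\<sigma>, switch_at E v \<sigma>) | \<sigma> v. \<sigma> \<in> signings E}\<^sup>*"

definition signed_adj :: "'a::finite set set \<Rightarrow> ('a set \<Rightarrow> real) \<Rightarrow> real ^ 'a ^ 'a" where
  "signed_adj E \<sigma> = (\<chi> u v. if {u, v} \<in> E then \<sigma> {u, v} else 0)"

definition signed_adj_sq :: "'a::finite set set \<Rightarrow> ('a set \<Rightarrow> real) \<Rightarrow> real ^ 'a ^ 'a" where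
  "signed_adj_sq E \<sigma> = signed_adj E \<sigma> ** signed_adj E \<sigma>"

definition charpoly :: "real ^ 'n ^ 'n \<Rightarrow> real poly" where
  "charpoly M = det (mat [:0, 1:] - map_matrix (\<lambda>c. [:c:]) M)"

text \<open>The complex eigenvalues, repeated according to algebraic multiplicity.\<close>

definition spectrum :: "real ^ 'n ^ 'n \<Rightarrow> complex multiset" where
  "spectrum M = proots (map_poly complex_of_real (charpoly M))"

definition q_poly :: "'a::finite set set \<Rightarrow> real poly" where
  "q_poly E = smult (1 / real (card (signings E)))
                (\<Sum>\<sigma>\<in>signings E. charpoly (signed_adj_sq E \<sigma>))"

definition real_rooted :: "real poly \<Rightarrow> bool" where
  "real_rooted p \<longleftrightarrow> (\<forall>z. poly (map_poly complex_of_real p) z = 0 \<longrightarrow> z \<in> \<real>)"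

end

theory Submission
  imports Defs
begin

text \<open>
  Put \<open>x = y\<^sup>2\<close>, so that \<open>det (x I - A\<^sup>2) = det (y I - A) det (y I + A)\<close>. Expanding both determinants over the
  cycles of a permutation, fixed points and 2-cycles contribute a matching polynomial \<open>\<mu>\<close> that does not
  depend on the signing, and every longer cycle contributes the product of its signs. Flipping the sign of
  one edge shows that in the expectation only pairs of equal collections of cycles survive. Hence
  \<open>q\<^sub>G (y\<^sup>2)\<close> is the sum of \<open>(-1)\<close> to the number of vertices of \<open>C\<close>, times \<open>4\<close> to the number of cycles of
  \<open>C\<close>, times the square of \<open>\<mu>\<close> of \<open>G - C\<close> at \<open>y\<close>, over all collections \<open>C\<close> of vertex-disjoint cycles. This sum is
  small enough to be evaluated inside the logic for each of the graphs in question.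

  A regular graph on at most seven vertices is, up to complement, complete or 1- or 2-regular, which leaves
  twelve graphs besides the odd cycles and \<open>K\<^sub>4\<close>. A real-rooted polynomial satisfies Laguerre's inequality
  \<open>p p'' \<le> (p')\<^sup>2\<close> everywhere, and each of the twelve polynomials violates it at a rational point. The bound on the
  real parts of the roots is Routh's criterion. For an odd cycle any two signings agree up to switching and
  a global sign, so \<open>q\<^sub>G\<close> is the characteristic polynomial of the square of one symmetric matrix.
\<close>

text \<open>The libraries also use this symbol for coefficients of formal power series, and parsing both
  readings is exponential in the number of occurrences.\<close>

no_notation fps_nth (infixl "$" 75)

section \<open>Principal minors and cycles\<close>

text \<open>Literal averaging is out of reach: \<open>K_7\<close> alone has 2^21 signings. The
  average has to become a recursion that rewriting can carry through to numerals. No permutation is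
  ever split into its cycles. Instead a minor, indexed by a vertex set so that deleting vertices
  changes no type, is expanded along the cycle through one vertex, and this cycle is traced step by
  step by exchanging columns. The obstacle is the order of choices. A determinant decides at once
  what becomes of a vertex, but only the long cycles carry signs, so they must be separated out
  before averaging. Vertices off the long cycles are therefore set aside in a second list, and their
  fixed points and 2-cycles are resolved at the very end;
  \<open>cycle_expansion_Cons_matched\<close> justifies the delay. Non-real roots are never located:
  a single rational point refutes real-rootedness, and a sign test on coefficients bounds the real
  parts.\<close>

definition pdet :: "'a set \<Rightarrow> ('a \<Rightarrow> 'a \<Rightarrow> 'c::comm_ring_1) \<Rightarrow> 'c" where
  "pdet S M = (\<Sum>p | p permutes S. of_int (sign p) * (\<Prod>i\<in>S. M i (p i)))"

text \<open>Column \<open>b\<close> is overwritten by column \<open>v\<close>. This is the effect of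
  composing a permutation with the transposition of \<open>v\<close> and \<open>b\<close>: whatever
  went to \<open>b\<close> now goes to \<open>v\<close>.\<close>

definition replace_col :: "('a \<Rightarrow> 'a \<Rightarrow> 'c) \<Rightarrow> 'a \<Rightarrow> 'a \<Rightarrow> 'a \<Rightarrow> 'a \<Rightarrow> 'c" where
  "replace_col M b v = (\<lambda>i j. M i (if j = b then v else j))"

lemma pdet_empty [simp]: "pdet {} M = 1"
  by (simp add: pdet_def)

lemma pdet_cong:
  assumes "\<And>i j. i \<in> S \<Longrightarrow> j \<in> S \<Longrightarrow> M i j = N i j"
  shows "pdet S M = pdet S N"
  unfolding pdet_def
proof (intro sum.cong refl arg_cong2[where f = "(*)"] prod.cong)
  fix p i assume "p \<in> {p. p permutes S}" "i \<in> S"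
  then show "M i (p i) = N i (p i)"
    by (intro assms) (auto simp: permutes_in_image)
qed

text \<open>Every permutation of \<open>insert v S\<close> is uniquely a permutation of
  \<open>S\<close> followed by a transposition of \<open>v\<close> with some \<open>b\<close>. For
  \<open>b = v\<close> it fixes \<open>v\<close>; otherwise \<open>v\<close> goes to
  \<open>b\<close>, the element formerly sent to \<open>b\<close> goes to \<open>v\<close>, and the
  sign changes.\<close>

lemma pdet_insert:
  assumes fin: "finite S" and v: "v \<notin> S"
  shows "pdet (insert v S) M = M v v * pdet S M - (\<Sum>b\<in>S. M v b * pdet S (replace_col M b v))"
proof -
  let ?f = "\<lambda>p. of_int (sign p) * (\<Prod>i\<in>insert v S. M i (p i))"
  have diag: "(\<Sum>q | q permutes S. ?f (Transposition.transpose v v \<circ> q)) = M v v * pdet S M"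
    unfolding pdet_def sum_distrib_left
  proof (intro sum.cong refl)
    fix q assume "q \<in> {q. q permutes S}"
    then have "q v = v" using v by (auto simp: permutes_not_in)
    then show "?f (Transposition.transpose v v \<circ> q) = M v v * (of_int (sign q) * (\<Prod>i\<in>S. M i (q i)))"
      using fin v by (simp add: algebra_simps)
  qed
  have off: "(\<Sum>q | q permutes S. ?f (Transposition.transpose v b \<circ> q)) = - (M v b * pdet S (replace_col M b v))"
    if b: "b \<in> S" for b
    unfolding pdet_def sum_distrib_left sum_negf[symmetric]
  proof (intro sum.cong refl)
    fix q assume "q \<in> {q. q permutes S}"
    then have q: "q permutes S" by simp
    then have qv: "q v = v" using v by (auto simp: permutes_not_in)
    have "permutation q" using q fin permutation_permutes by blast
    moreover have "v \<noteq> b" using b v by auto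
    ultimately have "sign (Transposition.transpose v b \<circ> q) = - sign q"
      by (simp add: sign_compose permutation_swap_id sign_swap_id)
    moreover have "(\<Prod>i\<in>S. M i ((Transposition.transpose v b \<circ> q) i)) = (\<Prod>i\<in>S. replace_col M b v i (q i))"
    proof (intro prod.cong refl)
      fix i assume "i \<in> S"
      then have "q i \<noteq> v" using q v by (metis permutes_in_image)
      then show "M i ((Transposition.transpose v b \<circ> q) i) = replace_col M b v i (q i)"
        by (simp add: replace_col_def Transposition.transpose_def)
    qed
    ultimately show "?f (Transposition.transpose v b \<circ> q) =
        - (M v b * (of_int (sign q) * (\<Prod>i\<in>S. replace_col M b v i (q i))))"
      using fin v qv by (simp add: algebra_simps)
  qed
  have "pdet (insert v S) M =
      (\<Sum>b\<in>insert v S. \<Sum>q | q permutes S. ?f (Transposition.transpose v b \<circ> q))"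
    unfolding pdet_def[of "insert v S"] by (rule sum_over_permutations_insert[OF fin v])
  also have "\<dots> = M v v * pdet S M + (\<Sum>b\<in>S. - (M v b * pdet S (replace_col M b v)))"
    unfolding sum.insert[OF fin v] diag by (intro arg_cong2[where f = "(+)"] refl sum.cong off)
  finally show ?thesis
    by (simp add: sum_negf)
qed

text \<open>One step along the cycle through \<open>v\<close>: from \<open>b\<close> it closes up at
  \<open>v\<close> or moves on to \<open>c\<close>. In the second case the two replacements compose,
  and column \<open>v\<close> now stands in place of column \<open>c\<close>.\<close>

lemma pdet_replace_col_insert:
  assumes fin: "finite S" and b: "b \<notin> S"
  shows "pdet (insert b S) (replace_col M b v) =
    M b v * pdet S M - (\<Sum>c\<in>S. M b c * pdet S (replace_col M c v))"
proof -
  have "pdet S (replace_col (replace_col M b v) c b) = pdet S (replace_col M c v)" if "c \<in> S" for c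
    using that b by (intro pdet_cong) (auto simp: replace_col_def)
  moreover have "pdet S (replace_col M b v) = pdet S M"
    using b by (intro pdet_cong) (auto simp: replace_col_def)
  moreover have "replace_col M b v b c = M b c" if "c \<in> S" for c
    using that b by (auto simp: replace_col_def)
  moreover have "replace_col M b v b b = M b v"
    by (simp add: replace_col_def)
  ultimately show ?thesis
    by (simp add: pdet_insert[OF fin b])
qed

definition arrangements :: "'a set \<Rightarrow> 'a list set" where
  "arrangements S = {p. distinct p \<and> set p \<subseteq> S}"

lemma finite_arrangements [simp]: "finite S \<Longrightarrow> finite (arrangements S)"
  using finite_subset_distinct[of S] by (simp add: arrangements_def conj_commute)

lemma sum_arrangements:
  assumes "finite S"
  shows "sum f (arrangements S) = f [] + (\<Sum>c\<in>S. \<Sum>p\<in>arrangements (S - {c}). f (c # p))"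
proof -
  have "arrangements S = insert [] (\<Union>c\<in>S. (#) c ` arrangements (S - {c}))"
  proof (intro set_eqI)
    fix p :: "'a list"
    show "p \<in> arrangements S \<longleftrightarrow> p \<in> insert [] (\<Union>c\<in>S. (#) c ` arrangements (S - {c}))"
      by (cases p) (auto simp: arrangements_def)
  qed
  then have "sum f (arrangements S) = f [] + sum f (\<Union>c\<in>S. (#) c ` arrangements (S - {c}))"
    using assms by (simp only:) (subst sum.insert; auto)
  also have "sum f (\<Union>c\<in>S. (#) c ` arrangements (S - {c})) =
      (\<Sum>c\<in>S. sum f ((#) c ` arrangements (S - {c})))"
    using assms by (intro sum.UNION_disjoint) auto
  also have "\<dots> = (\<Sum>c\<in>S. \<Sum>p\<in>arrangements (S - {c}). f (c # p))"
    by (simp add: sum.reindex)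
  finally show ?thesis .
qed

fun path_weight :: "('a \<Rightarrow> 'a \<Rightarrow> 'c::comm_ring_1) \<Rightarrow> 'a list \<Rightarrow> 'c" where
  "path_weight M (u # w # p) = M u w * path_weight M (w # p)"
| "path_weight M p = 1"

definition cycle_weight :: "('a \<Rightarrow> 'a \<Rightarrow> 'c::comm_ring_1) \<Rightarrow> 'a list \<Rightarrow> 'c" where
  "cycle_weight M p = path_weight M p * M (last p) (hd p)"

lemma path_weight_snoc:
  "p \<noteq> [] \<Longrightarrow> path_weight M (p @ [u]) = path_weight M p * M (last p) u"
  by (induction M p rule: path_weight.induct) (simp_all add: mult.assoc)

text \<open>Iterating the step follows the path from \<open>b\<close> until it returns to
  \<open>v\<close>. The list \<open>p\<close> records the vertices in between, each of which
  contributes a minus sign.\<close>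

lemma pdet_replace_col_paths:
  assumes "finite S" "b \<notin> S"
  shows "pdet (insert b S) (replace_col M b v) =
    (\<Sum>p\<in>arrangements S. (-1) ^ length p * path_weight M (b # p @ [v]) * pdet (S - set p) M)"
  using assms
proof (induction "card S" arbitrary: S b)
  case 0
  then have "S = {}" by simp
  moreover have "arrangements {} = {[] :: 'a list}" by (auto simp: arrangements_def)
  ultimately show ?case
    by (simp add: pdet_replace_col_insert)
next
  case (Suc n)
  have IH: "pdet S (replace_col M c v) =
      (\<Sum>p\<in>arrangements (S - {c}). (-1) ^ length p * path_weight M (c # p @ [v]) * pdet (S - {c} - set p) M)"
    if c: "c \<in> S" for c
  proof -
    have "insert c (S - {c}) = S" using c by auto
    moreover have "n = card (S - {c})" using Suc c by simp
    ultimately show ?thesis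
      using Suc(1)[of "S - {c}" c] Suc(3) by simp
  qed
  have "S - {c} - set p = S - set (c # p)" for c and p :: "'a list" by auto
  then have "M b c * pdet S (replace_col M c v) = - (\<Sum>p\<in>arrangements (S - {c}).
      (-1) ^ length (c # p) * path_weight M (b # (c # p) @ [v]) * pdet (S - set (c # p)) M)"
    if "c \<in> S" for c
    unfolding IH[OF that] sum_distrib_left sum_negf[symmetric]
    by (intro sum.cong) (auto simp: algebra_simps)
  then show ?case
    unfolding pdet_replace_col_insert[OF Suc(3,4)] sum_arrangements[OF Suc(3)]
    by (simp add: sum_negf)
qed

text \<open>Replacing a column by itself changes nothing, so the path expansion applies with
  \<open>b = v\<close>. The sign is that of a cycle on \<open>length p + 1\<close> elements.\<close>

lemma pdet_insert_cycles:
  assumes "finite S" "v \<notin> S"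
  shows "pdet (insert v S) M =
    (\<Sum>p\<in>arrangements S. (-1) ^ length p * cycle_weight M (v # p) * pdet (S - set p) M)"
proof -
  have "replace_col M v v = M" by (auto simp: replace_col_def)
  then show ?thesis
    using pdet_replace_col_paths[OF assms, of M v]
    by (simp add: cycle_weight_def path_weight_snoc flip: append_Cons)
qed

section \<open>Expansion of the characteristic polynomial\<close>

lemma path_weight_cong:
  "(\<And>i j. i \<in> set p \<Longrightarrow> j \<in> set p \<Longrightarrow> M i j = N i j) \<Longrightarrow> path_weight M p = path_weight N p"
  by (induction M p rule: path_weight.induct) auto

lemma cycle_weight_cong:
  "p \<noteq> [] \<Longrightarrow> (\<And>i j. i \<in> set p \<Longrightarrow> j \<in> set p \<Longrightarrow> M i j = N i j) \<Longrightarrow> cycle_weight M p = cycle_weight N p"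
  using path_weight_cong[of p M N] by (simp add: cycle_weight_def)

lemma path_weight_Cons:
  "p \<noteq> [] \<Longrightarrow> path_weight M (u # p) = M u (hd p) * path_weight M p"
  by (cases p) auto

lemma path_weight_rev:
  assumes "\<And>i j. M i j = M j i"
  shows "path_weight M (rev p) = path_weight M p"
proof (induction p)
  case (Cons u p)
  show ?case
  proof (cases "p = []")
    case False
    then show ?thesis
      using Cons assms[of u "hd p"] by (simp add: path_weight_snoc path_weight_Cons last_rev)
  qed simp
qed simp

lemma cycle_weight_Cons:
  "p \<noteq> [] \<Longrightarrow> cycle_weight M (v # p) = M v (hd p) * path_weight M p * M (last p) v"
  by (simp add: cycle_weight_def path_weight_Cons)

lemma path_weight_uminus: "p \<noteq> [] \<Longrightarrow> path_weight (\<lambda>i j. - M i j) p = (-1) ^ (length p - 1) * path_weight M p"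
proof (induction p)
  case (Cons u p)
  then show ?case
    by (cases "p = []") (auto simp: path_weight_Cons power_eq_if)
qed simp

text \<open>For a cycle with at least two vertices, the sign of the cycle and the signs of the negated entries
  combine to a single minus.\<close>

lemma pdet_char_insert:
  fixes A :: "'a \<Rightarrow> 'a \<Rightarrow> real"
  assumes fin: "finite S" and v: "v \<notin> S" and diag: "A v v = 0"
    and M: "M = (\<lambda>i j. (if i = j then y else 0) - A i j)"
  shows "pdet (insert v S) M =
    y * pdet S M - (\<Sum>p\<in>arrangements S - {[]}. cycle_weight A (v # p) * pdet (S - set p) M)"
proof -
  have "(-1) ^ length p * cycle_weight M (v # p) = - cycle_weight A (v # p)"
    if p: "p \<in> arrangements S - {[]}" for p
  proof -
    have p': "p \<noteq> []" "distinct (v # p)" using p v by (auto simp: arrangements_def)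
    \<comment> \<open>Consecutive entries of a distinct list never meet the diagonal, so
      \<open>y\<close> does not occur.\<close>
    have "path_weight M q = path_weight (\<lambda>i j. - A i j) q" if "distinct q" for q
      using that by (induction q rule: induct_list012) (auto simp: M)
    then have "path_weight M (v # p) = (-1) ^ length p * path_weight A (v # p)"
      using path_weight_uminus[of "v # p" A] p' by simp
    moreover have "last p \<noteq> v" using p' last_in_set by fastforce
    ultimately show ?thesis
      using p' by (simp add: cycle_weight_def M)
  qed
  moreover have "cycle_weight M [v] = y" by (simp add: cycle_weight_def M diag)
  moreover have "[] \<in> arrangements S" by (simp add: arrangements_def)
  ultimately show ?thesis
    unfolding pdet_insert_cycles[OF fin v]
    by (subst sum.remove[of _ "[]"]) (auto simp: fin sum_negf[symmetric] intro!: sum.cong)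
qed

section \<open>Expansion over collections of long cycles\<close>

definition delete :: "'a list \<Rightarrow> 'a set \<Rightarrow> 'a list" where
  "delete S X = filter (\<lambda>x. x \<notin> X) S"

lemma set_delete [simp]: "set (delete S X) = set S - X"
  by (auto simp: delete_def)

lemma distinct_delete [simp]: "distinct S \<Longrightarrow> distinct (delete S X)"
  by (simp add: delete_def)

lemma length_delete_le: "length (delete S X) \<le> length S"
  by (simp add: delete_def)

lemma delete_delete: "delete (delete S X) Y = delete S (X \<union> Y)"
  unfolding delete_def by (auto simp: conj_commute intro: filter_cong)

lemma delete_Cons [simp]: "delete (v # S) X = (if v \<in> X then delete S X else v # delete S X)"
  by (simp add: delete_def)

lemma delete_Nil [simp]: "delete [] X = []"
  by (simp add: delete_def)

lemma delete_append [simp]: "delete (S @ T) X = delete S X @ delete T X"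
  by (simp add: delete_def)

lemma delete_id: "set S \<inter> X = {} \<Longrightarrow> delete S X = S"
  unfolding delete_def by (rule filter_True) auto

text \<open>A cycle through \<open>v\<close> of length at least three is listed as \<open>v # p\<close>, the direction being
  fixed by \<open>hd p < last p\<close>.\<close>

definition cycle_tails :: "'a::linorder set \<Rightarrow> 'a list set" where
  "cycle_tails S = {p \<in> arrangements S. 2 \<le> length p \<and> hd p < last p}"

lemma finite_cycle_tails [simp]: "finite S \<Longrightarrow> finite (cycle_tails S)"
  by (simp add: cycle_tails_def)

function match_poly :: "('a \<Rightarrow> 'a \<Rightarrow> bool) \<Rightarrow> 'c::comm_ring_1 \<Rightarrow> 'a list \<Rightarrow> 'c" where
  "match_poly adj y [] = 1"
| "match_poly adj y (v # T) =
     y * match_poly adj y T - (\<Sum>b\<in>set T. if adj v b then match_poly adj y (delete T {b}) else 0)"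
  by pat_completeness auto
termination
  by (relation "Wellfounded.measure (\<lambda>(adj, y, T). length T)")
     (auto intro: le_less_trans[OF length_delete_le])

text \<open>The vertices in \<open>T\<close> are already committed to fixed points and 2-cycles of the permutation; those in
  \<open>S\<close> may still lie on longer cycles.\<close>

function cycle_expansion ::
  "('a::linorder \<Rightarrow> 'a \<Rightarrow> bool) \<Rightarrow> ('a \<Rightarrow> 'a \<Rightarrow> 'c::comm_ring_1) \<Rightarrow> 'c \<Rightarrow> 'a list \<Rightarrow> 'a list \<Rightarrow> 'c" where
  "cycle_expansion adj A y [] T = match_poly adj y T"
| "cycle_expansion adj A y (v # S) T = cycle_expansion adj A y S (T @ [v]) -
     2 * (\<Sum>p\<in>cycle_tails (set S). cycle_weight A (v # p) * cycle_expansion adj A y (delete S (set p)) T)"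
  by pat_completeness auto
termination
  by (relation "Wellfounded.measure (\<lambda>(adj, A, y, S, T). length S)")
     (auto simp: less_Suc_eq_le length_delete_le)

text \<open>Reversal has no fixed points among lists of at least two distinct vertices, so each tail
  counts twice. One-vertex lists, which stand for the 2-cycles, count once.\<close>

lemma sum_nonempty_arrangements:
  fixes f :: "'a::linorder list \<Rightarrow> real"
  assumes fin: "finite S" and rev: "\<And>p. f (rev p) = f p"
  shows "sum f (arrangements S - {[]}) = (\<Sum>b\<in>S. f [b]) + 2 * sum f (cycle_tails S)"
proof -
  let ?R = "rev ` cycle_tails S"
  have "p \<in> arrangements S - {[]} \<longleftrightarrow> p \<in> (\<lambda>b. [b]) ` S \<union> (cycle_tails S \<union> ?R)" for p
  proof -
    have "p \<in> ?R \<longleftrightarrow> rev p \<in> cycle_tails S" by (metis imageE imageI rev_rev_ident)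
    also have "\<dots> \<longleftrightarrow> p \<in> arrangements S \<and> 2 \<le> length p \<and> last p < hd p"
      by (cases "p = []") (auto simp: cycle_tails_def arrangements_def hd_rev last_rev)
    finally have R: "p \<in> ?R \<longleftrightarrow> p \<in> arrangements S \<and> 2 \<le> length p \<and> last p < hd p" .
    show ?thesis
    proof (cases "2 \<le> length p")
      case True
      then obtain a b q where "p = a # b # q" by (cases p; cases "tl p") auto
      then have "hd p \<noteq> last p" if "distinct p" using that last_in_set[of "b # q"] by auto
      then show ?thesis
        using True R by (auto simp: cycle_tails_def arrangements_def neq_iff)
    next
      case False
      then consider "p = []" | b where "p = [b]" by (cases p; cases "tl p") auto
      then show ?thesis
        using R by cases (auto simp: cycle_tails_def arrangements_def)
    qed
  qed
  then have "arrangements S - {[]} = (\<lambda>b. [b]) ` S \<union> (cycle_tails S \<union> ?R)" by blast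
  moreover have "(\<lambda>b. [b]) ` S \<inter> (cycle_tails S \<union> ?R) = {}"
    by (auto simp: cycle_tails_def)
  moreover have "cycle_tails S \<inter> ?R = {}"
    by (auto simp: cycle_tails_def hd_rev last_rev)
  ultimately have "sum f (arrangements S - {[]}) =
      sum f ((\<lambda>b. [b]) ` S) + (sum f (cycle_tails S) + sum f ?R)"
    using fin by (simp add: sum.union_disjoint)
  moreover have "sum f ?R = sum f (cycle_tails S)"
    by (subst sum.reindex) (auto simp: inj_on_def rev)
  moreover have "sum f ((\<lambda>b. [b]) ` S) = (\<Sum>b\<in>S. f [b])"
    by (subst sum.reindex) (auto simp: inj_on_def)
  ultimately show ?thesis by simp
qed

lemma cycle_weight_Cons_rev:
  fixes A :: "'a \<Rightarrow> 'a \<Rightarrow> real"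
  assumes "\<And>i j. A i j = A j i"
  shows "cycle_weight A (v # rev p) = cycle_weight A (v # p)"
  using assms by (cases "p = []") (auto simp: cycle_weight_Cons path_weight_rev hd_rev last_rev)

lemma cycle_tails_Diff:
  "cycle_tails (S - {b}) = {p \<in> cycle_tails S. b \<notin> set p}"
  by (auto simp: cycle_tails_def arrangements_def)

text \<open>A vertex \<open>v\<close> already set aside is a fixed point, or paired with another
  vertex set aside, or paired with a vertex \<open>b\<close> of \<open>S\<close> that is thereby
  barred from long cycles. The long cycles may be chosen before or after this decision.\<close>

lemma cycle_expansion_Cons_matched:
  fixes y :: real
  assumes "distinct (v # T @ S)"
  shows "cycle_expansion adj A y S (v # T) = y * cycle_expansion adj A y S T
    - (\<Sum>b\<in>set T. if adj v b then cycle_expansion adj A y S (delete T {b}) else 0)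
    - (\<Sum>b\<in>set S. if adj v b then cycle_expansion adj A y (delete S {b}) T else 0)"
  using assms
proof (induction "length S" arbitrary: S T rule: less_induct)
  case less
  let ?E = "cycle_expansion adj A y"
  show ?case
  proof (cases S)
    case Nil
    then show ?thesis by (auto intro!: sum.cong)
  next
    case (Cons w S')
    define C where "C = cycle_tails (set S')"
    have dw: "w \<notin> set T" "w \<notin> set S'" "distinct T" "distinct S'" "v \<noteq> w" "v \<notin> set T" "v \<notin> set S'"
      "set T \<inter> set S' = {}"
      using less(2) Cons by auto
    have step: "?E (w # S'') T' = ?E S'' (T' @ [w]) -
        2 * (\<Sum>p\<in>cycle_tails (set S''). cycle_weight A (w # p) * ?E (delete S'' (set p)) T')" for S'' T'
      by simp
    define a where "a b = (if adj v b then 1 else 0 :: real)" for b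
    have IH: "?E S'' (v # T') = y * ?E S'' T' - (\<Sum>b\<in>set T'. a b * ?E S'' (delete T' {b}))
        - (\<Sum>b\<in>set S''. a b * ?E (delete S'' {b}) T')"
      if "length S'' < length S" "distinct (v # T' @ S'')" for S'' T'
      unfolding less(1)[OF that] a_def by (simp add: if_distrib if_distribR cong: if_cong)
    have delw: "delete (T @ [w]) {b} = delete T {b} @ [w]" if "b \<in> set T" for b
      using that dw by auto
    have delw': "delete (T @ [w]) {w} = T" "delete S' {w} = S'" using dw by (simp_all add: delete_id)
    have 1: "?E S' (v # T @ [w]) = y * ?E S' (T @ [w])
        - ((\<Sum>b\<in>set T. a b * ?E S' (delete T {b} @ [w])) + a w * ?E S' T)
        - (\<Sum>b\<in>set S'. a b * ?E (delete S' {b}) (T @ [w]))"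
    proof -
      have "(\<Sum>b\<in>set T. a b * ?E S' (delete (T @ [w]) {b})) = (\<Sum>b\<in>set T. a b * ?E S' (delete T {b} @ [w]))"
        by (intro sum.cong refl) (simp only: delw)
      moreover have "set (T @ [w]) = insert w (set T)" by simp
      ultimately have "(\<Sum>b\<in>set (T @ [w]). a b * ?E S' (delete (T @ [w]) {b})) =
          (\<Sum>b\<in>set T. a b * ?E S' (delete T {b} @ [w])) + a w * ?E S' T"
        using dw by (simp only: sum.insert finite_set delw' add.commute simp_thms)
      moreover have "length S' < length S" "distinct (v # (T @ [w]) @ S')" using dw Cons by auto
      ultimately show ?thesis
        by (simp only: IH)
    qed
    \<comment> \<open>The sum over the vertices off \<open>p\<close> is extended by zeros to all of
      \<open>S'\<close>, so that its range no longer depends on \<open>p\<close> and the sums can be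
      interchanged.\<close>
    have 2: "?E (delete S' (set p)) (v # T) = y * ?E (delete S' (set p)) T
        - (\<Sum>b\<in>set T. a b * ?E (delete S' (set p)) (delete T {b}))
        - (\<Sum>b\<in>set S'. if b \<in> set p then 0 else a b * ?E (delete S' (insert b (set p))) T)" for p
    proof -
      have "length (delete S' (set p)) < length S"
        using length_delete_le[of S' "set p"] Cons by simp
      moreover have "(\<Sum>b\<in>set S' - set p. a b * ?E (delete S' (insert b (set p))) T) =
          (\<Sum>b\<in>set S'. if b \<in> set p then 0 else a b * ?E (delete S' (insert b (set p))) T)"
        by (intro sum.mono_neutral_cong_left) auto
      ultimately show ?thesis
        using IH[of "delete S' (set p)" T] dw by (auto simp: delete_delete)
    qed
    have 3: "?E (delete S {b}) T = ?E (delete S' {b}) (T @ [w]) -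
        2 * (\<Sum>p\<in>C. if b \<in> set p then 0 else cycle_weight A (w # p) * ?E (delete S' (insert b (set p))) T)"
      if b: "b \<in> set S'" for b
    proof -
      have "b \<noteq> w" using b dw by auto
      moreover have "(\<Sum>p\<in>cycle_tails (set S' - {b}). cycle_weight A (w # p) * ?E (delete S' (insert b (set p))) T) =
        (\<Sum>p\<in>C. if b \<in> set p then 0 else cycle_weight A (w # p) * ?E (delete S' (insert b (set p))) T)"
        unfolding C_def by (intro sum.mono_neutral_cong_left) (auto simp: cycle_tails_Diff)
      ultimately show ?thesis
        using Cons by (simp add: delete_delete)
    qed
    \<comment> \<open>A cycle through \<open>w\<close> and then a partner \<open>b\<close> off it,
      or a partner first and then a cycle avoiding it: the same pairs are summed.\<close>
    have swap: "(\<Sum>p\<in>C. cycle_weight A (w # p) *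
          (\<Sum>b\<in>set S'. if b \<in> set p then 0 else a b * ?E (delete S' (insert b (set p))) T)) =
        (\<Sum>b\<in>set S'. a b * (\<Sum>p\<in>C. if b \<in> set p then 0
          else cycle_weight A (w # p) * ?E (delete S' (insert b (set p))) T))"
      unfolding sum_distrib_left by (subst sum.swap) (auto intro!: sum.cong)
    have swap': "(\<Sum>p\<in>C. cycle_weight A (w # p) * (\<Sum>b\<in>set T. a b * ?E (delete S' (set p)) (delete T {b}))) =
        (\<Sum>b\<in>set T. a b * (\<Sum>p\<in>C. cycle_weight A (w # p) * ?E (delete S' (set p)) (delete T {b})))"
      unfolding sum_distrib_left by (subst sum.swap) (auto intro!: sum.cong)
    have "?E S (v # T) = ?E S' (v # T @ [w]) - 2 * (\<Sum>p\<in>C. cycle_weight A (w # p) * ?E (delete S' (set p)) (v # T))"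
      unfolding Cons step C_def by simp
    also have "(\<Sum>p\<in>C. cycle_weight A (w # p) * ?E (delete S' (set p)) (v # T)) =
        y * (\<Sum>p\<in>C. cycle_weight A (w # p) * ?E (delete S' (set p)) T)
        - (\<Sum>b\<in>set T. a b * (\<Sum>p\<in>C. cycle_weight A (w # p) * ?E (delete S' (set p)) (delete T {b})))
        - (\<Sum>b\<in>set S'. a b * (\<Sum>p\<in>C. if b \<in> set p then 0
          else cycle_weight A (w # p) * ?E (delete S' (insert b (set p))) T))"
      unfolding 2 swap[symmetric] swap'[symmetric]
      by (simp add: right_diff_distrib sum_subtractf sum_distrib_left mult.left_commute)
    also have "?E S' (v # T @ [w]) - 2 * \<dots> = y * ?E S T - (\<Sum>b\<in>set T. a b * ?E S (delete T {b}))
        - (a w * ?E (delete S {w}) T + (\<Sum>b\<in>set S'. a b * ?E (delete S {b}) T))"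
    proof -
      have "(\<Sum>b\<in>set S'. a b * ?E (delete S {b}) T) = (\<Sum>b\<in>set S'. a b * ?E (delete S' {b}) (T @ [w])) -
          2 * (\<Sum>b\<in>set S'. a b * (\<Sum>p\<in>C. if b \<in> set p then 0
          else cycle_weight A (w # p) * ?E (delete S' (insert b (set p))) T))"
        unfolding sum_distrib_left[of 2] sum_subtractf[symmetric]
        by (intro sum.cong refl) (simp add: 3 algebra_simps)
      moreover have "(\<Sum>b\<in>set T. a b * ?E S (delete T {b})) = (\<Sum>b\<in>set T. a b * ?E S' (delete T {b} @ [w])) -
          2 * (\<Sum>b\<in>set T. a b * (\<Sum>p\<in>C. cycle_weight A (w # p) * ?E (delete S' (set p)) (delete T {b})))"
        unfolding sum_distrib_left[of 2] sum_subtractf[symmetric] Cons step C_def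
        by (intro sum.cong refl) (simp add: algebra_simps sum_distrib_left)
      moreover have "?E (delete S {w}) T = ?E S' T" using delw' Cons by simp
      moreover have "y * ?E S T = y * ?E S' (T @ [w]) -
          2 * (y * (\<Sum>p\<in>C. cycle_weight A (w # p) * ?E (delete S' (set p)) T))"
        unfolding Cons step C_def by (simp add: algebra_simps)
      ultimately show ?thesis
        unfolding 1 by (simp add: algebra_simps)
    qed
    \<comment> \<open>The term for \<open>w\<close> arose in the sum over the vertices set aside;
      here it rejoins the sum over \<open>S\<close>.\<close>
    also have "a w * ?E (delete S {w}) T + (\<Sum>b\<in>set S'. a b * ?E (delete S {b}) T) =
        (\<Sum>b\<in>set S. a b * ?E (delete S {b}) T)"
      using dw Cons by simp
    finally show ?thesis
      unfolding a_def by (simp add: if_distrib if_distribR cong: if_cong)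
  qed
qed

text \<open>When the head \<open>v\<close> is expanded, the diagonal term and the 2-cycles together
  form the recursion of a vertex set aside, so they collapse to \<open>v\<close> being moved to the
  second list. On 2-cycles the entries of \<open>A\<close> are squared and turn into
  adjacency.\<close>

lemma pdet_cycle_expansion:
  fixes y :: real
  assumes sym: "\<And>i j. A i j = A j i" and sq: "\<And>i j. (A i j)\<^sup>2 = (if adj i j then 1 else 0)"
    and irr: "\<And>i. \<not> adj i i" and "distinct S"
  shows "pdet (set S) (\<lambda>i j. (if i = j then y else 0) - A i j) = cycle_expansion adj A y S []"
  using \<open>distinct S\<close>
proof (induction "length S" arbitrary: S rule: less_induct)
  case less
  let ?M = "\<lambda>i j. (if i = j then y else 0) - A i j"
  let ?E = "cycle_expansion adj A y"
  show ?case
  proof (cases S)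
    case (Cons v S')
    have v: "v \<notin> set S'" "distinct S'" using less(2) Cons by auto
    have "A v v = 0" using sq[of v v] irr by simp
    have IH: "pdet (set S' - X) ?M = ?E (delete S' X) []" for X
      using less(1)[of "delete S' X"] v Cons by (simp add: less_Suc_eq_le length_delete_le)
    let ?f = "\<lambda>p. cycle_weight A (v # p) * pdet (set S' - set p) ?M"
    have "pdet (set S) ?M = y * pdet (set S') ?M - sum ?f (arrangements (set S') - {[]})"
      using pdet_char_insert[of "set S'" v A ?M y] v(1) \<open>A v v = 0\<close> Cons by simp
    also have "sum ?f (arrangements (set S') - {[]}) =
        (\<Sum>b\<in>set S'. ?f [b]) + 2 * sum ?f (cycle_tails (set S'))"
      by (intro sum_nonempty_arrangements) (auto simp: cycle_weight_Cons_rev[OF sym])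
    also have "(\<Sum>b\<in>set S'. ?f [b]) = (\<Sum>b\<in>set S'. if adj v b then ?E (delete S' {b}) [] else 0)"
    proof (intro sum.cong refl)
      fix b
      have "cycle_weight A [v, b] = (A v b)\<^sup>2"
        using sym[of b v] by (simp add: cycle_weight_def power2_eq_square)
      then show "?f [b] = (if adj v b then ?E (delete S' {b}) [] else 0)"
        using IH[of "{b}"] by (simp add: sq)
    qed
    also have "sum ?f (cycle_tails (set S')) =
        (\<Sum>p\<in>cycle_tails (set S'). cycle_weight A (v # p) * ?E (delete S' (set p)) [])"
      by (simp add: IH)
    finally show ?thesis
      using cycle_expansion_Cons_matched[of v "[]" S' adj A y] v Cons IH[of "{}"]
      by (simp add: delete_id)
  qed simp
qed

section \<open>Averaging over signings\<close>

definition flip_entry :: "'a \<Rightarrow> 'a \<Rightarrow> ('a \<Rightarrow> 'a \<Rightarrow> real) \<Rightarrow> 'a \<Rightarrow> 'a \<Rightarrow> real" where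
  "flip_entry i j B = (\<lambda>k l. if {k, l} = {i, j} then - B k l else B k l)"

lemma path_weight_flip_entry:
  "\<not> {i, j} \<subseteq> set p \<Longrightarrow> path_weight (flip_entry i j B) p = path_weight B p"
  by (intro path_weight_cong) (auto simp: flip_entry_def doubleton_eq_iff)

lemma cycle_expansion_cong:
  assumes "\<And>i j. i \<in> set S \<Longrightarrow> j \<in> set S \<Longrightarrow> A i j = B i j"
  shows "cycle_expansion adj A y S T = cycle_expansion adj B y S T"
  using assms
proof (induction "length S" arbitrary: S T rule: less_induct)
  case less
  show ?case
  proof (cases S)
    case (Cons v S')
    have "cycle_weight A (v # p) = cycle_weight B (v # p)" if "p \<in> cycle_tails (set S')" for p
      using that less(2) Cons by (intro cycle_weight_cong) (auto simp: cycle_tails_def arrangements_def)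
    moreover have "cycle_expansion adj A y (delete S' X) T' = cycle_expansion adj B y (delete S' X) T'" for X T'
      using Cons by (intro less(1) less(2)) (auto simp: less_Suc_eq_le length_delete_le)
    moreover have "cycle_expansion adj A y S' T' = cycle_expansion adj B y S' T'" for T'
      using less Cons by simp
    ultimately show ?thesis
      using Cons by simp
  qed simp
qed

lemma cycle_expansion_flip_entry:
  "\<not> {i, j} \<subseteq> set S \<Longrightarrow> cycle_expansion adj (flip_entry i j B) y S T = cycle_expansion adj B y S T"
  by (intro cycle_expansion_cong) (auto simp: flip_entry_def doubleton_eq_iff)

text \<open>The edge from \<open>v\<close> to an end of \<open>p\<close> is used exactly once by the
  cycle. On a 2-cycle it would be traversed twice and the sign would cancel.\<close>

lemma cycle_weight_flip_entry_end:
  assumes "distinct (v # p)" "2 \<le> length p" "x \<in> {hd p, last p}"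
  shows "cycle_weight (flip_entry v x B) (v # p) = - cycle_weight B (v # p)"
proof -
  obtain a b q where p: "p = a # b # q"
    using assms(2) by (cases p; cases "tl p") auto
  have "last p \<in> set (b # q)" unfolding p by simp
  then have "hd p \<noteq> last p" using assms(1) p by auto
  moreover have "v \<noteq> hd p" "v \<noteq> last p" using assms(1) \<open>last p \<in> set (b # q)\<close> p by auto
  moreover have "path_weight (flip_entry v x B) p = path_weight B p"
    using assms(1) by (intro path_weight_flip_entry) auto
  ultimately show ?thesis
    using assms(3) p by (auto simp: cycle_weight_Cons flip_entry_def doubleton_eq_iff)
qed

lemma cycle_weight_flip_entry_other:
  assumes "v \<notin> set p" "p \<noteq> []" "x \<notin> {hd p, last p}"
  shows "cycle_weight (flip_entry v x B) (v # p) = cycle_weight B (v # p)"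
proof -
  have "path_weight (flip_entry v x B) p = path_weight B p"
    using assms(1) by (intro path_weight_flip_entry) auto
  then show ?thesis
    using assms by (auto simp: cycle_weight_Cons flip_entry_def doubleton_eq_iff)
qed

text \<open>The edge along which two paths first part occurs in exactly one of them.\<close>

lemma path_weights_diverge:
  assumes "distinct p" "distinct q" "p \<noteq> []" "q \<noteq> []" "hd p = hd q" "last p = last q" "p \<noteq> q"
  obtains x w where "x \<noteq> w" "x \<in> set p" "x \<in> set q" "w \<in> set p \<union> set q"
    "\<And>B. path_weight (flip_entry x w B) p * path_weight (flip_entry x w B) q =
        - (path_weight B p * path_weight B q)"
  using assms
proof (induction p arbitrary: q thesis)
  case (Cons c p)
  obtain q' where q: "q = c # q'" using Cons.prems by (cases q) auto
  have "p \<noteq> q'" using Cons.prems q by simp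
  have p0: "p \<noteq> []" using Cons.prems q last_in_set[of q'] by (cases "q' = []") auto
  have q0: "q' \<noteq> []" using Cons.prems q last_in_set[of p] by (cases "p = []") auto
  show thesis
  proof (cases "hd p = hd q'")
    case True
    obtain x w where *: "x \<noteq> w" "x \<in> set p" "x \<in> set q'" "w \<in> set p \<union> set q'"
      "\<And>B. path_weight (flip_entry x w B) p * path_weight (flip_entry x w B) q' =
          - (path_weight B p * path_weight B q')"
      using Cons.IH[of q'] Cons.prems q p0 q0 True \<open>p \<noteq> q'\<close> by auto
    have "c \<noteq> x" "c \<noteq> w" using * Cons.prems q by auto
    then have "flip_entry x w B c d = B c d" for B d
      by (auto simp: flip_entry_def doubleton_eq_iff)
    then show thesis
      using * q p0 q0 by (intro Cons.prems(1)[of x w]) (auto simp: path_weight_Cons mult_ac)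
  next
    case False
    \<comment> \<open>The paths part at \<open>c\<close>. The edge from \<open>c\<close> to
      \<open>hd p\<close> opens \<open>p\<close> here and cannot occur in \<open>q\<close>, which
      leaves \<open>c\<close> for another vertex and never comes back.\<close>
    have c: "c \<notin> set p" "c \<notin> set q'" using Cons.prems q by auto
    then have "c \<noteq> hd p" "c \<noteq> hd q'" using p0 q0 by auto
    then have "flip_entry c (hd p) B c (hd p) = - B c (hd p)" "flip_entry c (hd p) B c (hd q') = B c (hd q')" for B
      using False by (auto simp: flip_entry_def doubleton_eq_iff)
    then show thesis
      using q p0 q0 c \<open>c \<noteq> hd p\<close>
      by (intro Cons.prems(1)[of c "hd p"]) (auto simp: path_weight_Cons path_weight_flip_entry)
  qed
qed simp

lemma cycle_weight_square:
  fixes A :: "'a \<Rightarrow> 'a \<Rightarrow> real"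
  assumes "\<And>i j. (A i j)\<^sup>2 = B i j"
  shows "(cycle_weight A p)\<^sup>2 = cycle_weight B p"
proof -
  have "(path_weight A p)\<^sup>2 = path_weight B p"
    by (induction p rule: induct_list012) (simp_all add: power_mult_distrib assms)
  then show ?thesis
    by (simp add: cycle_weight_def power_mult_distrib assms)
qed

text \<open>Two copies of \<open>cycle_expansion\<close>, at \<open>y\<close> and at
  \<open>z\<close>, forced to select the same cycles: the two factors 2 give 4, and the squared
  signs of a cycle leave only the test whether its edges are present.\<close>

function cycle_pair_expansion ::
  "('a::linorder \<Rightarrow> 'a \<Rightarrow> bool) \<Rightarrow> real \<Rightarrow> real \<Rightarrow> 'a list \<Rightarrow> 'a list \<Rightarrow> real" where
  "cycle_pair_expansion adj y z [] T = match_poly adj y T * match_poly adj z T"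
| "cycle_pair_expansion adj y z (v # S) T = cycle_pair_expansion adj y z S (T @ [v]) +
     4 * (\<Sum>p\<in>cycle_tails (set S). cycle_weight (\<lambda>i j. if adj i j then 1 else 0) (v # p) *
       cycle_pair_expansion adj y z (delete S (set p)) T)"
  by pat_completeness auto
termination
  by (relation "Wellfounded.measure (\<lambda>(adj, y, z, S, T). length S)")
     (auto simp: less_Suc_eq_le length_delete_le)

text \<open>All that averaging uses of the signings: they are finitely many, they are permuted by
  reversing the sign of a single pair, and squared entries do not depend on the signing.\<close>

locale random_signing =
  fixes Sg :: "'s set" and A :: "'s \<Rightarrow> 'a::linorder \<Rightarrow> 'a \<Rightarrow> real" and adj :: "'a \<Rightarrow> 'a \<Rightarrow> bool"
  assumes finite_Sg: "finite Sg"
    and flip: "i \<noteq> j \<Longrightarrow> \<exists>\<phi>. bij_betw \<phi> Sg Sg \<and> (\<forall>s\<in>Sg. A (\<phi> s) = flip_entry i j (A s))"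
    and square: "s \<in> Sg \<Longrightarrow> (A s i j)\<^sup>2 = (if adj i j then 1 else 0)"
begin

text \<open>The reversal permutes the signings, so a quantity that it negates sums to its own
  negative.\<close>

lemma sum_zero:
  assumes "i \<noteq> j" "\<And>s. s \<in> Sg \<Longrightarrow> F (flip_entry i j (A s)) = - F (A s)"
  shows "(\<Sum>s\<in>Sg. F (A s)) = (0::real)"
proof -
  obtain \<phi> where \<phi>: "bij_betw \<phi> Sg Sg" "\<And>s. s \<in> Sg \<Longrightarrow> A (\<phi> s) = flip_entry i j (A s)"
    using flip[OF assms(1)] by blast
  have "(\<Sum>s\<in>Sg. F (A s)) = (\<Sum>s\<in>Sg. F (A (\<phi> s)))"
    by (rule sum.reindex_bij_betw[OF \<phi>(1), symmetric])
  also have "\<dots> = - (\<Sum>s\<in>Sg. F (A s))"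
    using \<phi>(2) assms(2) by (simp add: sum_negf)
  finally show ?thesis by simp
qed

text \<open>Some edge is used by exactly one of two distinct cycles through \<open>v\<close>: an
  edge at \<open>v\<close> if their end pairs differ, otherwise the edge where the paths part.
  Reversing its sign negates the product of the weights, and the remaining factors do not see it,
  because an end of that edge is missing from each of their vertex lists.\<close>

lemma sum_cycle_weights_orthogonal:
  assumes S: "distinct (v # S)" and p: "p \<in> cycle_tails (set S)" "q \<in> cycle_tails (set S)" "p \<noteq> q"
  shows "(\<Sum>s\<in>Sg. cycle_weight (A s) (v # p) * cycle_weight (A s) (v # q) *
    (cycle_expansion adj (A s) y (delete S (set p)) T * cycle_expansion adj (A s) z (delete S (set q)) T)) = 0"
    (is "(\<Sum>s\<in>Sg. ?F (A s)) = 0")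
proof -
  have pq: "distinct (v # p)" "2 \<le> length p" "hd p < last p" "distinct (v # q)" "2 \<le> length q" "hd q < last q"
      "p \<noteq> []" "q \<noteq> []" "v \<notin> set S"
    using p S by (auto simp: cycle_tails_def arrangements_def)
  show ?thesis
  proof (cases "hd p = hd q \<and> last p = last q")
    case True
    then obtain x w where x: "x \<noteq> w" "x \<in> set p" "x \<in> set q" "w \<in> set p \<union> set q"
      and W: "\<And>B. path_weight (flip_entry x w B) p * path_weight (flip_entry x w B) q =
        - (path_weight B p * path_weight B q)"
      using path_weights_diverge[of p q] pq p(3) by auto
    have v: "v \<noteq> x" "v \<noteq> w" using x pq by auto
    have "?F (flip_entry x w B) = - ?F B" for B
    proof -
      have "cycle_weight (flip_entry x w B) (v # p) * cycle_weight (flip_entry x w B) (v # q) =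
          - (cycle_weight B (v # p) * cycle_weight B (v # q))"
        using W[of B] v pq by (simp add: cycle_weight_Cons flip_entry_def doubleton_eq_iff mult_ac)
      moreover have "cycle_expansion adj (flip_entry x w B) y (delete S (set p)) T =
          cycle_expansion adj B y (delete S (set p)) T"
        "cycle_expansion adj (flip_entry x w B) z (delete S (set q)) T =
          cycle_expansion adj B z (delete S (set q)) T"
        using x by (auto intro!: cycle_expansion_flip_entry)
      ultimately show ?thesis by simp
    qed
    then show ?thesis using sum_zero[OF x(1), of ?F] by simp
  next
    case False
    \<comment> \<open>Here the fixed direction \<open>hd p < last p\<close> matters: two increasing
      pairs, one contained in the other, agree entry by entry.\<close>
    have "\<not> {hd p, last p} \<subseteq> {hd q, last q}"
      using False pq(3,6) by auto
    then obtain x where x: "x \<in> {hd p, last p}" "x \<notin> {hd q, last q}" by blast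
    have "x \<in> set p" using x(1) pq(7) by auto
    then have "v \<noteq> x" using pq by auto
    moreover have "?F (flip_entry v x B) = - ?F B" for B
      using pq x by (simp add: cycle_weight_flip_entry_end cycle_weight_flip_entry_other cycle_expansion_flip_entry)
    ultimately show ?thesis using sum_zero[of v x ?F] by simp
  qed
qed

text \<open>This removes the mixed terms, in which \<open>v\<close> lies on a long cycle in one
  factor only. The first edge of that cycle at \<open>v\<close> occurs in no other factor, since
  \<open>v\<close> is absent from \<open>S\<close>.\<close>

lemma sum_cycle_weight_zero:
  assumes S: "distinct (v # S)" and p: "p \<in> cycle_tails (set S)"
  shows "(\<Sum>s\<in>Sg. cycle_weight (A s) (v # p) *
    (cycle_expansion adj (A s) y (delete S (set p)) T * cycle_expansion adj (A s) z S T')) = 0"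
    (is "(\<Sum>s\<in>Sg. ?F (A s)) = 0")
proof -
  have p': "distinct (v # p)" "2 \<le> length p" "p \<noteq> []" "v \<notin> set S"
    using p S by (auto simp: cycle_tails_def arrangements_def)
  then have "v \<noteq> hd p" by auto
  moreover have "?F (flip_entry v (hd p) B) = - ?F B" for B
    using p' by (simp add: cycle_weight_flip_entry_end cycle_expansion_flip_entry)
  ultimately show ?thesis using sum_zero[of v "hd p" ?F] by simp
qed

theorem sum_cycle_expansions:
  assumes "distinct S"
  shows "(\<Sum>s\<in>Sg. cycle_expansion adj (A s) y S T * cycle_expansion adj (A s) z S T) =
    card Sg * cycle_pair_expansion adj y z S T"
  using assms
proof (induction "length S" arbitrary: S T rule: less_induct)
  case less
  show ?case
  proof (cases S)
    case (Cons v S')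
    let ?C = "cycle_tails (set S')"
    let ?I = "\<lambda>i j. if adj i j then 1 else 0 :: real"
    have S': "distinct (v # S')" "distinct S'" using less Cons by auto
    define a where "a s = cycle_expansion adj (A s) y S' (T @ [v])" for s
    define b where "b s = cycle_expansion adj (A s) z S' (T @ [v])" for s
    define f where "f p s = cycle_expansion adj (A s) y (delete S' (set p)) T" for p s
    define g where "g p s = cycle_expansion adj (A s) z (delete S' (set p)) T" for p s
    define w where "w p s = cycle_weight (A s) (v # p)" for p s
    have IH: "(\<Sum>s\<in>Sg. f p s * g p s) = card Sg * cycle_pair_expansion adj y z (delete S' (set p)) T" for p
      unfolding f_def g_def using less(1)[of "delete S' (set p)" T] Cons S'
      by (simp add: less_Suc_eq_le length_delete_le)
    have sq: "(w p s)\<^sup>2 = cycle_weight ?I (v # p)" if "s \<in> Sg" for p s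
      unfolding w_def using square[OF that] by (rule cycle_weight_square)
    have "(\<Sum>s\<in>Sg. cycle_expansion adj (A s) y S T * cycle_expansion adj (A s) z S T) =
        (\<Sum>s\<in>Sg. (a s - 2 * (\<Sum>p\<in>?C. w p s * f p s)) * (b s - 2 * (\<Sum>p\<in>?C. w p s * g p s)))"
      by (simp add: Cons a_def b_def f_def g_def w_def)
    also have "\<dots> = (\<Sum>s\<in>Sg. a s * b s - 2 * (\<Sum>p\<in>?C. w p s * (f p s * b s)) -
        2 * (\<Sum>p\<in>?C. w p s * (g p s * a s)) + 4 * (\<Sum>p\<in>?C. \<Sum>q\<in>?C. w p s * w q s * (f p s * g q s)))"
    proof (intro sum.cong refl)
      fix s
      have "(\<Sum>p\<in>?C. \<Sum>q\<in>?C. w p s * w q s * (f p s * g q s)) =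
          (\<Sum>p\<in>?C. w p s * f p s) * (\<Sum>p\<in>?C. w p s * g p s)"
        by (simp add: sum_product mult_ac)
      moreover have "(\<Sum>p\<in>?C. w p s * (f p s * b s)) = (\<Sum>p\<in>?C. w p s * f p s) * b s"
        "(\<Sum>p\<in>?C. w p s * (g p s * a s)) = (\<Sum>p\<in>?C. w p s * g p s) * a s"
        by (simp_all only: sum_distrib_right mult.assoc)
      ultimately show "(a s - 2 * (\<Sum>p\<in>?C. w p s * f p s)) * (b s - 2 * (\<Sum>p\<in>?C. w p s * g p s)) =
          a s * b s - 2 * (\<Sum>p\<in>?C. w p s * (f p s * b s)) -
        2 * (\<Sum>p\<in>?C. w p s * (g p s * a s)) + 4 * (\<Sum>p\<in>?C. \<Sum>q\<in>?C. w p s * w q s * (f p s * g q s))"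
        by (simp add: algebra_simps)
    qed
    also have "\<dots> = (\<Sum>s\<in>Sg. a s * b s) - 2 * (\<Sum>p\<in>?C. \<Sum>s\<in>Sg. w p s * (f p s * b s)) -
        2 * (\<Sum>p\<in>?C. \<Sum>s\<in>Sg. w p s * (g p s * a s)) +
        4 * (\<Sum>p\<in>?C. \<Sum>q\<in>?C. \<Sum>s\<in>Sg. w p s * w q s * (f p s * g q s))"
      unfolding sum.distrib sum_subtractf sum_distrib_left[symmetric]
      by (simp add: sum.swap[of _ Sg ?C])
    also have "(\<Sum>p\<in>?C. \<Sum>s\<in>Sg. w p s * (f p s * b s)) = 0"
      unfolding w_def f_def b_def by (intro sum.neutral ballI sum_cycle_weight_zero S')
    also have "(\<Sum>p\<in>?C. \<Sum>s\<in>Sg. w p s * (g p s * a s)) = 0"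
      unfolding w_def g_def a_def by (intro sum.neutral ballI sum_cycle_weight_zero S')
    \<comment> \<open>Orthogonality leaves the diagonal \<open>q = p\<close>, where the squared
      weight is independent of the signing.\<close>
    also have "(\<Sum>p\<in>?C. \<Sum>q\<in>?C. \<Sum>s\<in>Sg. w p s * w q s * (f p s * g q s)) =
        (\<Sum>p\<in>?C. cycle_weight ?I (v # p) * (\<Sum>s\<in>Sg. f p s * g p s))"
    proof (intro sum.cong refl)
      fix p assume p: "p \<in> ?C"
      have "(\<Sum>q\<in>?C. \<Sum>s\<in>Sg. w p s * w q s * (f p s * g q s)) =
          (\<Sum>q\<in>{p}. \<Sum>s\<in>Sg. w p s * w q s * (f p s * g q s))"
        using p unfolding w_def f_def g_def
        by (intro sum.mono_neutral_right) (auto intro!: sum_cycle_weights_orthogonal S'(1))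
      also have "\<dots> = (\<Sum>s\<in>Sg. cycle_weight ?I (v # p) * (f p s * g p s))"
        by (auto simp: sq[symmetric] power2_eq_square intro!: sum.cong)
      finally show "(\<Sum>q\<in>?C. \<Sum>s\<in>Sg. w p s * w q s * (f p s * g q s)) =
          cycle_weight ?I (v # p) * (\<Sum>s\<in>Sg. f p s * g p s)"
        by (simp add: sum_distrib_left)
    qed
    also have "(\<Sum>s\<in>Sg. a s * b s) = card Sg * cycle_pair_expansion adj y z S' (T @ [v])"
      unfolding a_def b_def using less(1)[of S' "T @ [v]"] Cons S' by simp
    finally show ?thesis
      by (simp add: IH Cons algebra_simps sum_distrib_left)
  qed simp
qed

end

section \<open>Evaluation by integer lists\<close>

text \<open>Coefficients in ascending order. The value lies in an arbitrary commutative ring because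
  the same list is evaluated at real squares and at complex roots.\<close>

fun eval_list :: "int list \<Rightarrow> 'c::comm_ring_1 \<Rightarrow> 'c" where
  "eval_list [] x = 0"
| "eval_list (a # as) x = of_int a + x * eval_list as x"

fun add_list :: "int list \<Rightarrow> int list \<Rightarrow> int list" where
  "add_list [] q = q"
| "add_list p [] = p"
| "add_list (a # p) (b # q) = (a + b) # add_list p q"

definition smult_list :: "int \<Rightarrow> int list \<Rightarrow> int list" where
  "smult_list c p = map ((*) c) p"

fun mult_list :: "int list \<Rightarrow> int list \<Rightarrow> int list" where
  "mult_list [] q = []"
| "mult_list (a # p) q = add_list (smult_list a q) (0 # mult_list p q)"

lemma eval_add_list [simp]: "eval_list (add_list p q) x = eval_list p x + eval_list q x"
  by (induction p q rule: add_list.induct) (simp_all add: algebra_simps)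

lemma eval_smult_list [simp]: "eval_list (smult_list c p) x = of_int c * eval_list p x"
  by (induction p) (simp_all add: smult_list_def algebra_simps)

lemma eval_mult_list [simp]: "eval_list (mult_list p q) x = eval_list p x * eval_list q x"
  by (induction p) (simp_all add: algebra_simps)

lemma eval_foldr_add_list:
  "distinct S \<Longrightarrow> eval_list (foldr (\<lambda>b. add_list (g b)) S []) x = (\<Sum>b\<in>set S. eval_list (g b) x)"
  by (induction S) simp_all

lemma remove1_eq_delete: "distinct S \<Longrightarrow> remove1 b S = delete S {b}"
  by (simp add: distinct_remove1_removeAll removeAll_filter_not_eq delete_def eq_commute)

text \<open>The matching polynomial of an \<open>n\<close>-vertex graph is \<open>y ^ (n mod 2)\<close> times a polynomial in
  \<open>y\<^sup>2\<close>; these lists hold the coefficients of the latter.\<close>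

function match_list :: "(nat \<Rightarrow> nat \<Rightarrow> bool) \<Rightarrow> nat list \<Rightarrow> int list" where
  "match_list adj [] = [1]"
| "match_list adj (v # T) =
     add_list (if odd (length T) then 0 # match_list adj T else match_list adj T)
       (smult_list (- 1)
         (foldr (\<lambda>b. add_list (if adj v b then match_list adj (remove1 b T) else [])) T []))"
  by pat_completeness auto
termination
  by (relation "Wellfounded.measure (\<lambda>(adj, T). length T)")
     (auto simp: length_remove1 dest: length_pos_if_in_set)

text \<open>Up to sign this is the product of the matching polynomials at \<open>y\<close> and
  \<open>- y\<close>. For an odd number of vertices the two factors omitted from
  \<open>match_list\<close> multiply to \<open>- y^2\<close>, hence the 0 in front.\<close>

definition match_square_list :: "(nat \<Rightarrow> nat \<Rightarrow> bool) \<Rightarrow> nat list \<Rightarrow> int list" where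
  "match_square_list adj T =
     (let m = match_list adj T; p = mult_list m m in if odd (length T) then 0 # p else p)"

text \<open>\<open>path_list\<close> grows a cycle from \<open>v\<close> along edges only, instead
  of testing every arrangement: \<open>f\<close> is the first vertex after \<open>v\<close>,
  \<open>b\<close> is the current end, and \<open>f < b\<close> at closure keeps one of the two
  directions. Every step of the cycle carries a minus sign, which accounts for \<open>(-1)\<close>
  to the number of vertices removed.\<close>

function expansion_list :: "(nat \<Rightarrow> nat \<Rightarrow> bool) \<Rightarrow> nat list \<Rightarrow> nat list \<Rightarrow> int list"
  and path_list :: "(nat \<Rightarrow> nat \<Rightarrow> bool) \<Rightarrow> nat \<Rightarrow> nat \<Rightarrow> nat \<Rightarrow> nat list \<Rightarrow> nat list \<Rightarrow> int list" where
  "expansion_list adj [] T = match_square_list adj T"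
| "expansion_list adj (v # S) T = add_list (expansion_list adj S (T @ [v]))
     (smult_list (- 1)
       (foldr (\<lambda>b. add_list (if adj v b then path_list adj v b b (remove1 b S) T else [])) S []))"
| "path_list adj v f b S T =
     add_list (if adj b v \<and> f < b then smult_list (- 4) (expansion_list adj S T) else [])
       (smult_list (- 1)
         (foldr (\<lambda>c. add_list (if adj b c then path_list adj v f c (remove1 c S) T else [])) S []))"
  by pat_completeness auto
termination
  by (relation "Wellfounded.measure (case_sum (\<lambda>(adj, S, T). 2 * length S)
        (\<lambda>(adj, v, f, b, S, T). 2 * length S + 1))")
     (auto simp: length_remove1 dest: length_pos_if_in_set)

lemma length_delete_single: "distinct S \<Longrightarrow> b \<in> set S \<Longrightarrow> length S = Suc (length (delete S {b}))"
  by (metis Suc_pred' length_pos_if_in_set length_remove1 remove1_eq_delete One_nat_def)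

lemma match_list_correct:
  fixes y :: real
  assumes "distinct T"
  shows "match_poly adj y T = (if odd (length T) then y else 1) * eval_list (match_list adj T) (y\<^sup>2)"
  using assms
proof (induction "length T" arbitrary: T rule: less_induct)
  case less
  show ?case
  proof (cases T)
    case (Cons v T')
    have d: "distinct T'" using less Cons by auto
    have "match_poly adj y (delete T' {b}) =
        (if odd (length T') then 1 else y) * eval_list (match_list adj (remove1 b T')) (y\<^sup>2)"
      if b: "b \<in> set T'" for b
      using less(1)[of "delete T' {b}"] Cons d length_delete_single[OF d b]
      by (auto simp: remove1_eq_delete)
    then have "(\<Sum>b\<in>set T'. if adj v b then match_poly adj y (delete T' {b}) else 0) =
        (if odd (length T') then 1 else y) *
          (\<Sum>b\<in>set T'. eval_list (if adj v b then match_list adj (remove1 b T') else []) (y\<^sup>2))"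
      unfolding sum_distrib_left by (intro sum.cong) auto
    moreover have "match_poly adj y T' = (if odd (length T') then y else 1) * eval_list (match_list adj T') (y\<^sup>2)"
      using less(1)[of T'] Cons d by simp
    ultimately show ?thesis
      using Cons d by (simp add: eval_foldr_add_list algebra_simps power2_eq_square)
  qed simp
qed

lemma match_square_list_correct:
  fixes y :: real
  assumes "distinct T"
  shows "eval_list (match_square_list adj T) (y\<^sup>2) =
    (-1) ^ length T * (match_poly adj y T * match_poly adj (- y) T)"
  by (simp add: match_list_correct[OF assms] match_square_list_def Let_def power2_eq_square)

text \<open>In the second part \<open>q\<close> ranges over the prolongations of the path beyond
  \<open>b\<close> before it returns to \<open>v\<close>; the empty one is closure at
  \<open>b\<close>. The comparison with \<open>f\<close> concerns the eventual last vertex,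
  whichever it turns out to be.\<close>

lemma expansion_list_correct:
  fixes y :: real
  shows "distinct (T @ S) \<Longrightarrow> eval_list (expansion_list adj S T) (y\<^sup>2) =
      (-1) ^ (length S + length T) * cycle_pair_expansion adj y (- y) S T"
    and "distinct (T @ S) \<Longrightarrow> eval_list (path_list adj v f b S T) (y\<^sup>2) =
      - 4 * (-1) ^ (length S + length T) * (\<Sum>q\<in>arrangements (set S). if f < last (b # q)
        then path_weight (\<lambda>i j. if adj i j then 1 else 0) (b # q @ [v]) *
          cycle_pair_expansion adj y (- y) (delete S (set q)) T else 0)"
proof (induction adj S T and adj v f b S T rule: expansion_list_path_list.induct)
  case (1 adj T)
  then show ?case by (simp add: match_square_list_correct)
next
  case (2 adj v S T)
  let ?I = "\<lambda>i j. if adj i j then 1 else 0 :: real"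
  let ?Q = "cycle_pair_expansion adj y (- y)"
  have dS: "distinct S" "v \<notin> set S" using 2 by auto
  have "eval_list (if adj v b then path_list adj v b b (remove1 b S) T else []) (y\<^sup>2) =
      4 * (-1) ^ (length S + length T) *
      (\<Sum>q\<in>arrangements (set S - {b}). if b < last (b # q)
        then cycle_weight ?I (v # b # q) * ?Q (delete S (set (b # q))) T else 0)"
    if b: "b \<in> set S" for b
  proof (cases "adj v b")
    case True
    have len: "length S = Suc (length (remove1 b S))"
      using length_delete_single[OF dS(1) b] dS by (simp add: remove1_eq_delete)
    have del: "delete (remove1 b S) (set q) = delete S (set (b # q))" for q
      using dS by (simp add: remove1_eq_delete delete_delete)
    have cw: "cycle_weight ?I (v # b # q) = path_weight ?I (b # q @ [v])" for q
      using True path_weight_snoc[of "b # q" ?I v] by (simp add: cycle_weight_Cons)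
    have "set (remove1 b S) = set S - {b}" "distinct (T @ remove1 b S)"
      using 2(3) by (auto simp: set_remove1_eq)
    then show ?thesis
      using 2(2)[OF b True] True unfolding len del cw by simp
  next
    case False
    then show ?thesis by (auto simp: cycle_weight_Cons intro!: sum.neutral)
  qed
  then have "eval_list (foldr (\<lambda>b. add_list (if adj v b then path_list adj v b b (remove1 b S) T else [])) S []) (y\<^sup>2) =
      4 * (-1) ^ (length S + length T) * (\<Sum>b\<in>set S. \<Sum>q\<in>arrangements (set S - {b}). if b < last (b # q)
        then cycle_weight ?I (v # b # q) * ?Q (delete S (set (b # q))) T else 0)"
    unfolding eval_foldr_add_list[OF dS(1)] sum_distrib_left by (intro sum.cong) auto
  also have "(\<Sum>b\<in>set S. \<Sum>q\<in>arrangements (set S - {b}). if b < last (b # q)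
        then cycle_weight ?I (v # b # q) * ?Q (delete S (set (b # q))) T else 0) =
      (\<Sum>p\<in>arrangements (set S). if p \<noteq> [] \<and> hd p < last p
        then cycle_weight ?I (v # p) * ?Q (delete S (set p)) T else 0)"
    by (subst sum_arrangements) auto
  also have "\<dots> = (\<Sum>p\<in>cycle_tails (set S). cycle_weight ?I (v # p) * ?Q (delete S (set p)) T)"
  proof (intro sum.mono_neutral_cong_right ballI)
    fix p assume "p \<in> arrangements (set S) - cycle_tails (set S)"
    then have "\<not> (2 \<le> length p \<and> hd p < last p)" by (auto simp: cycle_tails_def)
    \<comment> \<open>A one-vertex list has equal first and last entry, so the strict inequality
      alone forces length at least two.\<close>
    then have "\<not> (p \<noteq> [] \<and> hd p < last p)" by (cases p; cases "tl p") auto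
    then show "(if p \<noteq> [] \<and> hd p < last p
        then cycle_weight ?I (v # p) * ?Q (delete S (set p)) T else 0) = 0" by (rule if_not_P)
  qed (auto simp: cycle_tails_def)
  moreover have "eval_list (expansion_list adj S (T @ [v])) (y\<^sup>2) =
      (-1) ^ (length S + length (T @ [v])) * ?Q S (T @ [v])"
    using 2(1) 2(3) by simp
  ultimately show ?case
    by (simp only: expansion_list.simps eval_add_list eval_smult_list cycle_pair_expansion.simps)
      (simp add: algebra_simps)
next
  case (3 adj v f b S T)
  let ?I = "\<lambda>i j. if adj i j then 1 else 0 :: real"
  let ?Q = "cycle_pair_expansion adj y (- y)"
  have dS: "distinct S" using 3 by auto
  let ?s = "\<lambda>b q. if f < last (b # q) then path_weight ?I (b # q @ [v]) * ?Q (delete S (set q)) T else 0"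
  have "eval_list (if adj b c then path_list adj v f c (remove1 c S) T else []) (y\<^sup>2) =
      4 * (-1) ^ (length S + length T) * (\<Sum>q\<in>arrangements (set S - {c}). ?s b (c # q))"
    if c: "c \<in> set S" for c
  proof (cases "adj b c")
    case True
    have len: "length S = Suc (length (remove1 c S))"
      using length_delete_single[OF dS c] dS by (simp add: remove1_eq_delete)
    have del: "delete (remove1 c S) (set q) = delete S (set (c # q))" for q
      using dS by (simp add: remove1_eq_delete delete_delete)
    have pw: "path_weight ?I (b # (c # q) @ [v]) = path_weight ?I (c # q @ [v])" for q
      using True by simp
    have set: "set (remove1 c S) = set S - {c}" and dist: "distinct (T @ remove1 c S)"
      using 3(3) by (auto simp: set_remove1_eq)
    have "eval_list (path_list adj v f c (remove1 c S) T) (y\<^sup>2) =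
        4 * (-1) ^ (length S + length T) * (\<Sum>q\<in>arrangements (set S - {c}). ?s b (c # q))"
      unfolding 3(2)[OF c True dist] set len del pw by simp
    then show ?thesis
      using True by (simp only: if_True)
  next
    case False
    then show ?thesis by (auto intro!: sum.neutral)
  qed
  then have cont: "eval_list (foldr (\<lambda>c. add_list (if adj b c then path_list adj v f c (remove1 c S) T else [])) S []) (y\<^sup>2) =
      4 * (-1) ^ (length S + length T) * (\<Sum>c\<in>set S. \<Sum>q\<in>arrangements (set S - {c}). ?s b (c # q))"
    unfolding eval_foldr_add_list[OF dS] sum_distrib_left by (intro sum.cong) auto
  have close: "eval_list (if adj b v \<and> f < b then smult_list (- 4) (expansion_list adj S T) else []) (y\<^sup>2) =
      - 4 * (-1) ^ (length S + length T) * ?s b []"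
    using 3(1)[OF _ 3(3)] by (auto simp: delete_def)
  have split: "sum (?s b) (arrangements (set S)) =
      ?s b [] + (\<Sum>c\<in>set S. \<Sum>q\<in>arrangements (set S - {c}). ?s b (c # q))"
    by (rule sum_arrangements) simp
  show ?case
    unfolding split
    by (subst path_list.simps) (simp only: eval_add_list eval_smult_list cont close distrib_left of_int_minus of_int_1 mult_minus_left mult_1_left)
qed

definition edge_rel :: "(nat \<times> nat) list \<Rightarrow> nat \<Rightarrow> nat \<Rightarrow> bool" where
  "edge_rel es i j \<longleftrightarrow> (i, j) \<in> set es \<or> (j, i) \<in> set es"

definition edge_table :: "nat \<Rightarrow> (nat \<times> nat) list \<Rightarrow> bool list list" where
  "edge_table n es = map (\<lambda>i. map (edge_rel es i) [0..<n]) [0..<n]"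

text \<open>Indices outside the table default to nonadjacent, so for a proper edge list the table
  agrees with \<open>edge_rel\<close> on all natural numbers and the two are equal as
  functions.\<close>

definition table_rel :: "bool list list \<Rightarrow> nat \<Rightarrow> nat \<Rightarrow> bool" where
  "table_rel t i j = nth_default False (nth_default [] t i) j"

definition table_expansion :: "nat list \<Rightarrow> bool list list \<Rightarrow> int list" where
  "table_expansion S t = expansion_list (table_rel t) S []"

text \<open>Passing the table as an argument makes the simplifier evaluate it only once.\<close>

definition average_list :: "nat \<Rightarrow> (nat \<times> nat) list \<Rightarrow> int list" where
  "average_list n es = table_expansion [0..<n] (edge_table n es)"

section \<open>The averaged polynomial of a concrete graph\<close>

text \<open>Carries a determinant over the vertex type to one over indices. Induction through the
  expansion at one vertex avoids conjugating permutations by \<open>f\<close>.\<close>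

lemma pdet_reindex:
  assumes "finite S" "inj_on f S"
  shows "pdet (f ` S) M = pdet S (\<lambda>i j. M (f i) (f j))"
  using assms
proof (induction S arbitrary: M rule: finite_induct)
  case (insert v S)
  have inj: "inj_on f S" "f v \<notin> f ` S" using insert by auto
  have "pdet S (replace_col (\<lambda>i j. M (f i) (f j)) b v) = pdet (f ` S) (replace_col M (f b) (f v))"
    if "b \<in> S" for b
    unfolding insert.IH[OF inj(1)] using that inj(1)
    by (intro pdet_cong) (auto simp: replace_col_def inj_on_def)
  then show ?case
    using insert.hyps inj by (simp add: pdet_insert insert.IH sum.reindex)
qed simp

lemma pdet_uminus: "pdet S (\<lambda>i j. - M i j) = (-1) ^ card S * pdet S M"
  by (simp add: pdet_def prod_uminus sum_distrib_left mult_ac)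

lemma det_eq_pdet: "det M = pdet UNIV (\<lambda>i j. M $ i $ j)"
  by (simp add: det_def pdet_def)

lemma poly_charpoly: "poly (charpoly M) x = det (mat x - M)"
  unfolding charpoly_def det_def map_matrix_def
  by (simp add: poly_sum poly_prod mat_def)
    (auto intro!: sum.cong prod.cong arg_cong2[where f = "(*)"])

lemma mat_diff_square: "mat (y\<^sup>2) - A ** A = (mat y - A) ** (mat y + A)"
  for A :: "real ^ 'n ^ 'n"
proof -
  have "(\<Sum>k\<in>UNIV. ((if i = k then y else 0) - A $ i $ k) * ((if k = j then y else 0) + A $ k $ j)) =
      (if i = j then y\<^sup>2 else 0) - (\<Sum>k\<in>UNIV. A $ i $ k * A $ k $ j)" for i j
  proof -
    have "(\<Sum>k\<in>UNIV. ((if i = k then y else 0) - A $ i $ k) * ((if k = j then y else 0) + A $ k $ j)) =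
        (\<Sum>k\<in>UNIV. (if k = i then if k = j then y\<^sup>2 else 0 else 0) + (if k = i then y * A $ k $ j else 0) -
          (if k = j then A $ i $ k * y else 0) - A $ i $ k * A $ k $ j)"
      by (intro sum.cong refl) (simp add: algebra_simps power2_eq_square)
    then show ?thesis
      by (simp add: sum.distrib sum_subtractf)
  qed
  then show ?thesis
    by (simp add: vec_eq_iff matrix_matrix_mult_def mat_def)
qed

text \<open>\<open>y I + A\<close> is the negative of \<open>(- y) I - A\<close>, so both factors
  are the characteristic polynomial of \<open>A\<close>, at \<open>y\<close> and at
  \<open>- y\<close>, and one expansion serves for both.\<close>

lemma det_mat_diff_square:
  fixes A :: "real ^ 'n ^ 'n"
  shows "det (mat (y\<^sup>2) - A ** A) =
    (-1) ^ CARD('n) * (det (mat y - A) * det (mat (- y) - A))"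
proof -
  have "(\<lambda>i j. (mat y + A) $ i $ j) = (\<lambda>i j. - ((mat (- y) - A) $ i $ j))"
    by (auto simp: mat_def fun_eq_iff)
  then have "det (mat y + A) = (-1) ^ CARD('n) * det (mat (- y) - A)"
    unfolding det_eq_pdet by (simp only: pdet_uminus)
  then show ?thesis
    by (simp add: mat_diff_square det_mul)
qed

text \<open>Edges are pairs of positions in a vertex list, so that computations stay on natural
  numbers whatever the vertex type.\<close>

definition graph_on :: "'a list \<Rightarrow> (nat \<times> nat) list \<Rightarrow> 'a set set" where
  "graph_on vs es = (\<lambda>(i, j). {vs ! i, vs ! j}) ` set es"

definition proper_edges :: "nat \<Rightarrow> (nat \<times> nat) list \<Rightarrow> bool" where
  "proper_edges n es \<longleftrightarrow> (\<forall>(i, j)\<in>set es. i < j \<and> j < n)"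

lemma graph_on_iff:
  assumes "distinct vs" "proper_edges (length vs) es" "i < length vs" "j < length vs"
  shows "{vs ! i, vs ! j} \<in> graph_on vs es \<longleftrightarrow> edge_rel es i j"
proof -
  have "{vs ! i, vs ! j} = {vs ! k, vs ! l} \<longleftrightarrow> (i = k \<and> j = l \<or> i = l \<and> j = k)"
    if "(k, l) \<in> set es" for k l
    using that assms by (auto simp: doubleton_eq_iff nth_eq_iff_index_eq proper_edges_def)
  then show ?thesis
    by (auto simp: graph_on_def edge_rel_def image_iff)
qed

lemma edge_rel_bounds:
  "proper_edges n es \<Longrightarrow> edge_rel es i j \<Longrightarrow> i < n \<and> j < n \<and> i \<noteq> j"
  by (auto simp: proper_edges_def edge_rel_def)

lemma finite_signings [simp]: "finite (signings (E :: 'a::finite set set))"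
  by (simp add: signings_def finite_PiE)

lemma signings_nonempty: "signings E \<noteq> {}"
  by (auto simp: signings_def PiE_eq_empty_iff)

definition index_weight :: "'a list \<Rightarrow> (nat \<times> nat) list \<Rightarrow> ('a set \<Rightarrow> real) \<Rightarrow> nat \<Rightarrow> nat \<Rightarrow> real" where
  "index_weight vs es \<sigma> i j = (if edge_rel es i j then \<sigma> {vs ! i, vs ! j} else 0)"

lemma random_signing_graph_on:
  fixes vs :: "'a::finite list"
  assumes vs: "distinct vs" "proper_edges (length vs) es"
  shows "random_signing (signings (graph_on vs es)) (index_weight vs es) (edge_rel es)"
proof
  show "finite (signings (graph_on vs es))" by simp
next
  fix \<sigma> i j assume \<sigma>: "\<sigma> \<in> signings (graph_on vs es)"
  show "(index_weight vs es \<sigma> i j)\<^sup>2 = (if edge_rel es i j then 1 else 0)"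
  proof (cases "edge_rel es i j")
    case True
    then have "{vs ! i, vs ! j} \<in> graph_on vs es"
      using edge_rel_bounds[OF vs(2) True] graph_on_iff[OF vs] by auto
    then have "\<sigma> {vs ! i, vs ! j} \<in> {1, - 1}"
      using \<sigma> by (auto simp: signings_def)
    then show ?thesis using True by (auto simp: index_weight_def)
  qed (simp add: index_weight_def)
next
  fix i j :: nat assume "i \<noteq> j"
  let ?E = "graph_on vs es"
  show "\<exists>\<phi>. bij_betw \<phi> (signings ?E) (signings ?E) \<and>
      (\<forall>s\<in>signings ?E. index_weight vs es (\<phi> s) = flip_entry i j (index_weight vs es s))"
  proof (cases "edge_rel es i j")
    case False
    \<comment> \<open>Off the edges the entry is 0 and reversing it has no effect, so the identity
      is a valid choice.\<close>
    then have "index_weight vs es s = flip_entry i j (index_weight vs es s)" for s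
      by (auto simp: flip_entry_def index_weight_def fun_eq_iff doubleton_eq_iff edge_rel_def)
    then show ?thesis by (intro exI[of _ id]) auto
  next
    case True
    define e where "e = {vs ! i, vs ! j}"
    have ij: "i < length vs" "j < length vs" using edge_rel_bounds[OF vs(2) True] by auto
    then have e: "e \<in> ?E" using True vs graph_on_iff unfolding e_def by blast
    define \<phi> :: "('a set \<Rightarrow> real) \<Rightarrow> 'a set \<Rightarrow> real" where "\<phi> s = s(e := - s e)" for s
    have "\<phi> s \<in> signings ?E" if "s \<in> signings ?E" for s
      using that e by (auto simp: signings_def \<phi>_def PiE_iff extensional_def)
    moreover have "\<phi> (\<phi> s) = s" for s by (simp add: \<phi>_def)
    ultimately have "bij_betw \<phi> (signings ?E) (signings ?E)"
      by (intro bij_betw_byWitness[where f' = \<phi>]) auto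
    moreover have "index_weight vs es (\<phi> s) k l = flip_entry i j (index_weight vs es s) k l" for s k l
    proof (cases "edge_rel es k l")
      case True
      then have "k < length vs" "l < length vs" using edge_rel_bounds[OF vs(2) True] by auto
      then have "{vs ! k, vs ! l} = e \<longleftrightarrow> {k, l} = {i, j}"
        using ij vs(1) by (auto simp: e_def doubleton_eq_iff nth_eq_iff_index_eq)
      then show ?thesis using True by (auto simp: index_weight_def flip_entry_def \<phi>_def)
    qed (simp add: index_weight_def flip_entry_def)
    ultimately show ?thesis by (intro exI[of _ \<phi>]) (auto simp: fun_eq_iff)
  qed
qed

lemma det_signed_adj:
  fixes vs :: "'a::finite list"
  assumes vs: "distinct vs" "set vs = UNIV" "proper_edges (length vs) es"
    and \<sigma>: "\<sigma> \<in> signings (graph_on vs es)"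
  shows "det (mat y - signed_adj (graph_on vs es) \<sigma>) =
    cycle_expansion (edge_rel es) (index_weight vs es \<sigma>) y [0..<length vs] []"
proof -
  interpret random_signing "signings (graph_on vs es)" "index_weight vs es" "edge_rel es"
    using random_signing_graph_on vs by blast
  have sym: "index_weight vs es \<sigma> i j = index_weight vs es \<sigma> j i" for i j
    by (auto simp: index_weight_def edge_rel_def insert_commute)
  have irrefl: "\<not> edge_rel es i i" for i
    using edge_rel_bounds[OF vs(3)] by blast
  have inj: "inj_on ((!) vs) (set [0..<length vs])"
    using vs(1) by (simp add: inj_on_nth)
  have UNIV: "UNIV = (!) vs ` set [0..<length vs]"
    using vs(2) by (metis image_set map_nth)
  have "pdet UNIV M = pdet (set [0..<length vs]) (\<lambda>i j. M (vs ! i) (vs ! j))" for M :: "'a \<Rightarrow> 'a \<Rightarrow> real"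
    unfolding UNIV by (rule pdet_reindex[OF finite_set inj])
  then have "det (mat y - signed_adj (graph_on vs es) \<sigma>) =
      pdet (set [0..<length vs]) (\<lambda>i j. (mat y - signed_adj (graph_on vs es) \<sigma>) $ (vs ! i) $ (vs ! j))"
    unfolding det_eq_pdet .
  also have "\<dots> = pdet (set [0..<length vs]) (\<lambda>i j. (if i = j then y else 0) - index_weight vs es \<sigma> i j)"
    using vs by (intro pdet_cong)
      (auto simp: mat_def signed_adj_def graph_on_iff index_weight_def nth_eq_iff_index_eq)
  also have "\<dots> = cycle_expansion (edge_rel es) (index_weight vs es \<sigma>) y [0..<length vs] []"
    using square[OF \<sigma>] sym irrefl by (intro pdet_cycle_expansion) auto
  finally show ?thesis .
qed

lemma poly_q_poly_square:
  fixes vs :: "'a::finite list"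
  assumes vs: "distinct vs" "set vs = UNIV" "proper_edges (length vs) es"
  shows "poly (q_poly (graph_on vs es)) (y\<^sup>2) =
    (-1) ^ length vs * cycle_pair_expansion (edge_rel es) y (- y) [0..<length vs] []"
proof -
  let ?E = "graph_on vs es"
  interpret random_signing "signings ?E" "index_weight vs es" "edge_rel es"
    using random_signing_graph_on vs by blast
  have card: "CARD('a) = length vs" using vs(1,2) distinct_card by fastforce
  have "poly (charpoly (signed_adj_sq ?E \<sigma>)) (y\<^sup>2) = (-1) ^ length vs *
      (cycle_expansion (edge_rel es) (index_weight vs es \<sigma>) y [0..<length vs] [] *
       cycle_expansion (edge_rel es) (index_weight vs es \<sigma>) (- y) [0..<length vs] [])"
    if "\<sigma> \<in> signings ?E" for \<sigma>
    unfolding poly_charpoly signed_adj_sq_def det_mat_diff_square det_signed_adj[OF vs that] card ..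
  then have "poly (q_poly ?E) (y\<^sup>2) = 1 / card (signings ?E) * ((-1) ^ length vs *
      (card (signings ?E) * cycle_pair_expansion (edge_rel es) y (- y) [0..<length vs] []))"
    unfolding q_poly_def poly_smult poly_sum sum_cycle_expansions[OF distinct_upt, symmetric]
    by (simp add: sum_distrib_left)
  then show ?thesis
    using signings_nonempty[of ?E] by simp
qed

lemma table_rel_edge_table:
  assumes "proper_edges n es"
  shows "table_rel (edge_table n es) = edge_rel es"
  using edge_rel_bounds[OF assms]
  by (auto simp: fun_eq_iff table_rel_def edge_table_def nth_default_def)

lemma poly_Poly_of_int: "poly (Poly (map of_int p)) x = eval_list p x"
  by (induction p) auto

text \<open>Squares fill a half-line, and a nonzero polynomial has finitely many roots. The cycle
  expansion yields \<open>q_poly\<close> only at squares.\<close>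

lemma poly_eqI_squares:
  fixes p q :: "real poly"
  assumes "\<And>y. poly p (y\<^sup>2) = poly q (y\<^sup>2)"
  shows "p = q"
proof (rule ccontr)
  assume "p \<noteq> q"
  then have "finite {x. poly (p - q) x = 0}" by (intro poly_roots_finite) simp
  moreover have "{0..} \<subseteq> {x. poly (p - q) x = 0}"
  proof
    fix x :: real assume "x \<in> {0..}"
    then show "x \<in> {x. poly (p - q) x = 0}" using assms[of "sqrt x"] by simp
  qed
  ultimately show False using infinite_Ici[of "0::real"] finite_subset by blast
qed

theorem q_poly_graph_on:
  fixes vs :: "'a::finite list"
  assumes vs: "distinct vs" "set vs = UNIV" "proper_edges (length vs) es"
  shows "q_poly (graph_on vs es) = Poly (map of_int (average_list (length vs) es))"
proof (rule poly_eqI_squares)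
  fix y
  show "poly (q_poly (graph_on vs es)) (y\<^sup>2) = poly (Poly (map of_int (average_list (length vs) es))) (y\<^sup>2)"
    using expansion_list_correct(1)[of "[]" "[0..<length vs]" "edge_rel es" y]
    by (simp add: poly_q_poly_square[OF vs] poly_Poly_of_int average_list_def table_expansion_def
        table_rel_edge_table[OF vs(3)])
qed

section \<open>Laguerre's inequality and Routh's criterion\<close>

lemma map_poly_of_real_mult:
  "map_poly complex_of_real (p * q) = map_poly complex_of_real p * map_poly complex_of_real q"
  by (intro poly_eqI) (simp add: coeff_map_poly coeff_mult)

lemma poly_map_poly_of_real:
  "poly (map_poly complex_of_real p) (complex_of_real x) = complex_of_real (poly p x)"
  by (induction p) (simp_all add: map_poly_pCons)

lemma poly_map_poly_of_real_mult:
  "poly (map_poly complex_of_real (p * q)) z =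
    poly (map_poly complex_of_real p) z * poly (map_poly complex_of_real q) z"
  by (simp add: map_poly_of_real_mult)

text \<open>Where \<open>p\<close> is nonzero this says that the derivative of
  \<open>p' / p\<close>, which is minus the sum of \<open>1 / (x - r)^2\<close> over the roots
  \<open>r\<close>, is nonpositive. Splitting off one real root at a time avoids the
  division.\<close>

lemma real_rooted_Laguerre:
  "real_rooted p \<Longrightarrow> poly p x * poly (pderiv (pderiv p)) x \<le> (poly (pderiv p) x)\<^sup>2"
proof (induction "degree p" arbitrary: p)
  case 0
  then have "pderiv (pderiv p) = 0" by (metis pderiv_0 pderiv_eq_0_iff)
  then show ?case by simp
next
  case (Suc n)
  have "degree (map_poly complex_of_real p) = Suc n"
    using Suc by (simp add: degree_map_poly)
  then have "\<not> constant (poly (map_poly complex_of_real p))"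
    by (simp add: constant_degree)
  then obtain z where z: "poly (map_poly complex_of_real p) z = 0"
    using fundamental_theorem_of_algebra by blast
  then obtain r where r: "z = complex_of_real r"
    using Suc(3) unfolding real_rooted_def by (metis Reals_cases)
  have "poly p r = 0"
    using z unfolding r by (simp add: poly_map_poly_of_real)
  then obtain g where g: "p = [:- r, 1:] * g"
    by (auto simp: poly_eq_0_iff_dvd)
  have "g \<noteq> 0" using Suc(2) g by auto
  then have "degree p = Suc (degree g)" unfolding g by (subst degree_mult_eq) auto
  then have "n = degree g" using Suc(2) by simp
  moreover have "real_rooted g"
    using Suc(3) unfolding g real_rooted_def poly_map_poly_of_real_mult by auto
  ultimately have IH: "poly g x * poly (pderiv (pderiv g)) x \<le> (poly (pderiv g) x)\<^sup>2"
    by (rule Suc(1))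
  define u v w t where "u = poly g x" "v = poly (pderiv g) x" "w = poly (pderiv (pderiv g)) x" "t = x - r"
  note defs = u_v_w_t_def
  have p1: "poly p x = t * u" unfolding g defs by (simp add: algebra_simps)
  have d1: "pderiv p = [:- r, 1:] * pderiv g + g"
    unfolding g pderiv_mult by (simp add: pderiv_pCons)
  have d2: "pderiv (pderiv p) = [:- r, 1:] * pderiv (pderiv g) + pderiv g + pderiv g"
    unfolding d1 pderiv_add pderiv_mult by (simp add: pderiv_pCons)
  have p2: "poly (pderiv p) x = u + t * v"
    unfolding d1 defs by (simp add: algebra_simps)
  have p3: "poly (pderiv (pderiv p)) x = 2 * v + t * w"
    unfolding d2 defs by (simp add: algebra_simps)
  \<comment> \<open>With \<open>p = t u\<close> and \<open>t' = 1\<close> all mixed terms cancel; a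
    square remains, plus \<open>t^2\<close> times the same expression for \<open>g\<close>.\<close>
  have "(poly (pderiv p) x)\<^sup>2 - poly p x * poly (pderiv (pderiv p)) x = u\<^sup>2 + t\<^sup>2 * (v\<^sup>2 - u * w)"
    unfolding p1 p2 p3 by (simp add: algebra_simps power2_eq_square)
  also have "\<dots> \<ge> 0" using IH unfolding defs by simp
  finally show ?case by simp
qed

text \<open>Routh's test, free of fractions, for a polynomial \<open>e (w\<^sup>2) + w * f (w\<^sup>2)\<close> to have no
  zeros with positive real part. The two lists hold the coefficients of \<open>e\<close> and \<open>f\<close>, lowest degree
  first, so the continued fraction is expanded in powers of \<open>1 / w\<close>.\<close>

function routh :: "int list \<Rightarrow> int list \<Rightarrow> bool" where
  "routh [] f = False"
| "routh (a # e) [] = (e = [] \<and> 0 < a)"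
| "routh (a # e) (b # f) = (if 0 < a \<and> 0 < b \<and> length f \<le> length e
     then routh (b # f) (add_list (smult_list b e) (smult_list (- a) f)) else False)"
  by pat_completeness auto

lemma length_add_list: "length (add_list p q) = max (length p) (length q)"
  by (induction p q rule: add_list.induct) auto

termination routh
  by (relation "Wellfounded.measure (\<lambda>(e, f). length e + length f)")
    (auto simp: length_add_list smult_list_def)

text \<open>One division step gives \<open>b E / (w F) = a / w + w G / F\<close>. The first term has
  positive real part and the second a nonnegative one by induction, so \<open>E\<close> is nonzero
  and the reciprocal \<open>w F / E\<close> has nonnegative real part. The bound is not strict
  because the process ends with \<open>F = 0\<close>.\<close>

lemma routh_correct:
  assumes "routh e f" "0 < Re w"
  shows "eval_list e (w\<^sup>2) \<noteq> 0 \<and> 0 \<le> Re (w * eval_list f (w\<^sup>2) / eval_list e (w\<^sup>2))"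
  using assms
proof (induction e f rule: routh.induct)
  case (3 a e b f)
  let ?c = "add_list (smult_list b e) (smult_list (- a) f)"
  let ?E = "eval_list (a # e) (w\<^sup>2)" and ?F = "eval_list (b # f) (w\<^sup>2)" and ?G = "eval_list ?c (w\<^sup>2)"
  have ab: "0 < a" "0 < b" "length f \<le> length e" and c: "routh (b # f) ?c"
    using 3(2) by (auto split: if_splits)
  have IH: "?F \<noteq> 0" "0 \<le> Re (w * ?G / ?F)"
    using 3(1) ab c 3(3) by blast+
  have w: "w \<noteq> 0" using 3(3) by auto
  have "of_int b * ?E = of_int a * ?F + w\<^sup>2 * ?G"
    by (simp add: algebra_simps)
  then have *: "of_int b * (?E / (w * ?F)) = of_int a * inverse w + w * ?G / ?F"
    using w IH(1) by (simp add: field_simps power2_eq_square)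
  have "0 < Re (inverse w)"
    unfolding inverse_complex.sel using 3(3) by (intro divide_pos_pos) (auto simp: sum_power2_gt_zero_iff)
  then have "0 < Re (of_int a * inverse w + w * ?G / ?F)"
    using IH(2) ab(1) by (simp add: add_pos_nonneg del: inverse_complex.sel)
  moreover have "Re (of_int b * X) = of_int b * Re X" for X :: complex
    by simp
  ultimately have pos: "0 < Re (?E / (w * ?F))"
    using ab(2) unfolding *[symmetric] by (metis zero_less_mult_pos of_int_0_less_iff)
  then have "?E \<noteq> 0" by (metis divide_eq_0_iff less_irrefl zero_complex.sel(1))
  moreover have "0 \<le> Re (inverse (?E / (w * ?F)))"
    using pos by (simp only: inverse_complex.sel) simp
  ultimately show ?case by (simp only: inverse_divide) simp
qed auto

fun evens :: "'a list \<Rightarrow> 'a list" and odds :: "'a list \<Rightarrow> 'a list" where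
  "evens [] = []"
| "evens (a # p) = a # odds p"
| "odds [] = []"
| "odds (a # p) = evens p"

lemma eval_evens_odds: "eval_list p w = eval_list (evens p) (w\<^sup>2) + w * eval_list (odds p) (w\<^sup>2)"
  by (induction p) (simp_all add: algebra_simps power2_eq_square)

text \<open>A Taylor shift by Horner's rule; it moves the line of real part \<open>c\<close> to the
  imaginary axis, where Routh's test applies.\<close>

definition shift_list :: "int \<Rightarrow> int list \<Rightarrow> int list" where
  "shift_list c p = foldr (\<lambda>a q. add_list [a] (add_list (smult_list c q) (0 # q))) p []"

lemma eval_shift_list: "eval_list (shift_list c p) w = eval_list p (of_int c + w)"
  by (induction p) (simp_all add: shift_list_def algebra_simps)

definition routh_pair :: "int list \<Rightarrow> bool" where
  "routh_pair p = routh (evens p) (odds p)"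

definition roots_left_of :: "int \<Rightarrow> int list \<Rightarrow> bool" where
  "roots_left_of c p = routh_pair (shift_list c p)"

text \<open>A zero at a point \<open>w\<close> of positive real part would make the quotient of the
  odd by the even part equal to -1, contrary to Routh's test.\<close>

lemma roots_left_of_correct:
  fixes z :: complex
  assumes "roots_left_of c p" "eval_list p z = 0"
  shows "Re z \<le> of_int c"
proof (rule ccontr)
  define w where "w = z - of_int c"
  assume "\<not> Re z \<le> of_int c"
  then have "0 < Re w" by (simp add: w_def)
  let ?s = "shift_list c p"
  have *: "eval_list (evens ?s) (w\<^sup>2) \<noteq> 0"
    "0 \<le> Re (w * eval_list (odds ?s) (w\<^sup>2) / eval_list (evens ?s) (w\<^sup>2))"
    using routh_correct[of "evens ?s" "odds ?s" w] assms(1) \<open>0 < Re w\<close>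
    by (auto simp: roots_left_of_def routh_pair_def)
  have "eval_list (evens ?s) (w\<^sup>2) + w * eval_list (odds ?s) (w\<^sup>2) = 0"
    using assms(2) by (simp add: eval_shift_list w_def flip: eval_evens_odds)
  then have "w * eval_list (odds ?s) (w\<^sup>2) / eval_list (evens ?s) (w\<^sup>2) = - 1"
    using *(1) by (simp add: divide_eq_eq add_eq_0_iff)
  with *(2) show False by simp
qed

section \<open>Edge lists and certificates for the twelve graphs\<close>

definition complete_edges :: "nat \<Rightarrow> (nat \<times> nat) list" where
  "complete_edges n = concat (map (\<lambda>j. map (\<lambda>i. (i, j)) [0..<j]) [0..<n])"

definition complement_edges :: "nat \<Rightarrow> (nat \<times> nat) list \<Rightarrow> (nat \<times> nat) list" where
  "complement_edges n es = filter (\<lambda>e. e \<notin> set es) (complete_edges n)"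

text \<open>The closing edge is written with 0 first to keep every pair increasing.\<close>

definition cycle_edges :: "nat \<Rightarrow> (nat \<times> nat) list" where
  "cycle_edges n = (0, n - 1) # map (\<lambda>i. (i, Suc i)) [0..<n - 1]"

definition two_cycles :: "nat \<Rightarrow> nat \<Rightarrow> (nat \<times> nat) list" where
  "two_cycles k l = cycle_edges k @ map (\<lambda>(i, j). (i + k, j + k)) (cycle_edges l)"

text \<open>Proper edges list the smaller index first, so the neighbours of vertex 0 are all second
  components. In a regular graph this one vertex determines the degree.\<close>

definition degree_zero :: "(nat \<times> nat) list \<Rightarrow> nat" where
  "degree_zero es = card (set (map snd (filter (\<lambda>e. fst e = 0) es)))"

definition Laguerre_fails :: "int list \<Rightarrow> bool" where
  "Laguerre_fails L \<longleftrightarrow> (\<exists>x :: real. (poly (pderiv (Poly (map of_int L))) x)\<^sup>2 <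
     poly (Poly (map of_int L)) x * poly (pderiv (pderiv (Poly (map of_int L)))) x)"

text \<open>The finite certificate for one graph. It does not mention the vertex type, so one
  computation serves every isomorphic copy.\<close>

definition settled :: "nat \<Rightarrow> (nat \<times> nat) list \<Rightarrow> nat \<Rightarrow> bool" where
  "settled n es d \<longleftrightarrow> 0 < n \<and> proper_edges n es \<and> degree_zero es = d \<and>
     roots_left_of (4 * (int d - 1)) (average_list n es) \<and> Laguerre_fails (average_list n es)"

lemma poly_map_poly_of_real_Poly:
  "poly (map_poly complex_of_real (Poly (map of_int L))) z = eval_list L z"
  by (induction L) (simp_all add: map_poly_pCons)

lemma degree_graph_on:
  assumes vs: "distinct vs" "set vs = UNIV" "proper_edges (length vs) es" "0 < length vs"
    and reg: "regular_graph (graph_on vs es) d"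
  shows "d = degree_zero es"
proof -
  let ?J = "set (map snd (filter (\<lambda>e. fst e = 0) es))"
  have J: "j \<in> ?J \<longleftrightarrow> edge_rel es 0 j" for j
    using vs(3) by (force simp: edge_rel_def proper_edges_def)
  have "{w. {vs ! 0, w} \<in> graph_on vs es} = (!) vs ` ?J"
  proof (intro set_eqI iffI)
    fix w assume w: "w \<in> {w. {vs ! 0, w} \<in> graph_on vs es}"
    obtain j where "j < length vs" "w = vs ! j" using vs(2) by (metis UNIV_I in_set_conv_nth)
    then show "w \<in> (!) vs ` ?J"
      using w graph_on_iff[OF vs(1,3,4)] J by blast
  next
    fix w assume "w \<in> (!) vs ` ?J"
    then obtain j where "edge_rel es 0 j" "w = vs ! j" using J by blast
    then show "w \<in> {w. {vs ! 0, w} \<in> graph_on vs es}"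
      using edge_rel_bounds[OF vs(3)] graph_on_iff[OF vs(1,3,4)] by blast
  qed
  moreover have "inj_on ((!) vs) ?J"
    using vs(1) J edge_rel_bounds[OF vs(3)] by (intro inj_on_nth) blast+
  ultimately have "card {w. {vs ! 0, w} \<in> graph_on vs es} = degree_zero es"
    unfolding degree_zero_def by (simp only: card_image)
  then show ?thesis using reg by (simp add: regular_graph_def)
qed

lemma settled_correct:
  fixes vs :: "'a::finite list"
  assumes "settled (length vs) es d" "distinct vs" "set vs = UNIV"
  shows "\<not> real_rooted (q_poly (graph_on vs es))"
    and "regular_graph (graph_on vs es) d' \<Longrightarrow>
      poly (map_poly complex_of_real (q_poly (graph_on vs es))) z = 0 \<Longrightarrow> Re z \<le> 4 * (real d' - 1)"
proof -
  have es: "proper_edges (length vs) es" using assms(1) by (simp add: settled_def)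
  note q = q_poly_graph_on[OF assms(2,3) es]
  show "\<not> real_rooted (q_poly (graph_on vs es))"
    using assms(1) real_rooted_Laguerre unfolding q settled_def Laguerre_fails_def by (meson not_le)
  assume reg: "regular_graph (graph_on vs es) d'"
    and "poly (map_poly complex_of_real (q_poly (graph_on vs es))) z = 0"
  then have "eval_list (average_list (length vs) es) z = 0"
    by (simp add: q poly_map_poly_of_real_Poly)
  moreover have "d' = d"
    using degree_graph_on[OF assms(2,3) es _ reg] assms(1) by (simp add: settled_def)
  ultimately show "Re z \<le> 4 * (real d' - 1)"
    using roots_left_of_correct assms(1) unfolding settled_def by fastforce
qed

text \<open>With \<open>L\<close> explicit, the costly expansion occurs in one premise only; the
  root tests, including Laguerre's at a chosen point \<open>x\<close>, start from numerals.\<close>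

lemma settledI:
  fixes x :: real
  assumes "average_list n es = L" "0 < n" "proper_edges n es" "degree_zero es = d"
    "roots_left_of (4 * (int d - 1)) L"
    "(poly (pderiv (Poly (map of_int L))) x)\<^sup>2 <
      poly (Poly (map of_int L)) x * poly (pderiv (pderiv (Poly (map of_int L)))) x"
  shows "settled n es d"
  using assms by (auto simp: settled_def Laguerre_fails_def)

text \<open>At \<open>x = 0\<close> Laguerre's inequality reads \<open>2 a0 a2 <= a1^2\<close> in
  the three lowest coefficients; here 320 exceeds 256. The same point serves for the hexagon,
  \<open>K_{3,3}\<close> and the cube. For the other graphs the inequality holds at 0, and the point
  is moved to the right.\<close>

lemma settled_C4: "settled 4 (cycle_edges 4) 2"
  by (rule settledI[where L = "[8, - 16, 20, - 8, 1]" and x = "0"],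
    code_simp, code_simp, code_simp, code_simp, code_simp, simp add: pderiv_pCons power2_eq_square)

lemma settled_C6: "settled 6 (cycle_edges 6) 2"
  by (rule settledI[where L = "[8, - 36, 105, - 112, 54, - 12, 1]" and x = "0"],
    code_simp, code_simp, code_simp, code_simp, code_simp, simp add: pderiv_pCons power2_eq_square)

lemma settled_K5: "settled 5 (complete_edges 5) 4"
  by (rule settledI[where L = "[- 88, 365, - 340, 130, - 20, 1]" and x = "2"],
    code_simp, code_simp, code_simp, code_simp, code_simp, simp add: pderiv_pCons power2_eq_square)

lemma settled_K6: "settled 6 (complete_edges 6) 5"
  by (rule settledI[where L = "[805, - 2718, 3135, - 1460, 315, - 30, 1]" and x = "3"],
    code_simp, code_simp, code_simp, code_simp, code_simp, simp add: pderiv_pCons power2_eq_square)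

lemma settled_K7: "settled 7 (complete_edges 7) 6"
  by (rule settledI[where L = "[- 5388, 24661, - 31458, 17535, - 4760, 651, - 42, 1]" and x = "2"],
    code_simp, code_simp, code_simp, code_simp, code_simp, simp add: pderiv_pCons power2_eq_square)

text \<open>The complement of two disjoint triangles is the form in which \<open>K_{3,3}\<close>
  turns up in the classification.\<close>

lemma settled_K33: "settled 6 (complement_edges 6 (two_cycles 3 3)) 3"
  by (rule settledI[where L = "[96, - 288, 468, - 336, 117, - 18, 1]" and x = "0"],
    code_simp, code_simp, code_simp, code_simp, code_simp, simp add: pderiv_pCons power2_eq_square)

lemma settled_prism: "settled 6 (complement_edges 6 (cycle_edges 6)) 3"
  by (rule settledI[where L = "[56, - 264, 456, - 340, 117, - 18, 1]" and x = "1 / 2"],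
    code_simp, code_simp, code_simp, code_simp, code_simp, simp add: pderiv_pCons power2_eq_square)

lemma settled_octahedron: "settled 6 (complement_edges 6 [(0, 1), (2, 3), (4, 5)]) 4"
  by (rule settledI[where L = "[240, - 960, 1344, - 768, 204, - 24, 1]" and x = "3"],
    code_simp, code_simp, code_simp, code_simp, code_simp, simp add: pderiv_pCons power2_eq_square)

lemma settled_complement_C7: "settled 7 (complement_edges 7 (cycle_edges 7)) 4"
  by (rule settledI[where L = "[- 400, 2569, - 4634, 3717, - 1470, 294, - 28, 1]" and x = "1"],
    code_simp, code_simp, code_simp, code_simp, code_simp, simp add: pderiv_pCons power2_eq_square)

lemma settled_complement_C3_C4: "settled 7 (complement_edges 7 (two_cycles 3 4)) 4"
  by (rule settledI[where L = "[- 384, 2616, - 4656, 3721, - 1468, 294, - 28, 1]" and x = "1"],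
    code_simp, code_simp, code_simp, code_simp, code_simp, simp add: pderiv_pCons power2_eq_square)

text \<open>Vertex \<open>k\<close> stands for the set of positions of the binary digits 1 of
  \<open>k\<close>; edges join numbers that differ in one digit.\<close>

lemma settled_cube: "settled 8 [(0, 1), (0, 2), (0, 4), (1, 3), (1, 5), (2, 3), (2, 6), (3, 7), (4, 5), (4, 6), (5, 7), (6, 7)] 3"
  by (rule settledI[where L = "[297, - 1272, 3236, - 4104, 2862, - 1096, 228, - 24, 1]" and x = "0"],
    code_simp, code_simp, code_simp, code_simp, code_simp, simp add: pderiv_pCons power2_eq_square)

text \<open>The ten pairs from a five-element set are numbered lexicographically; edges join
  disjoint pairs.\<close>

lemma settled_petersen: "settled 10 [(0, 7), (0, 8), (0, 9), (1, 5), (1, 6), (1, 9), (2, 4), (2, 6), (2, 8), (3, 4), (3, 5), (3, 7), (4, 9), (5, 8), (6, 7)] 3"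
  by (rule settledI[where L = "[192, - 2480, 12660, - 28920, 35225, - 24510, 10155, - 2540, 375, - 30, 1]" and x = "1"],
    code_simp, code_simp, code_simp, code_simp, code_simp, simp add: pderiv_pCons power2_eq_square)

section \<open>Switching and odd cycles\<close>

lemma map_poly_of_real_add:
  "map_poly complex_of_real (p + q) = map_poly complex_of_real p + map_poly complex_of_real q"
  by (intro poly_eqI) (simp add: coeff_map_poly)

lemma map_poly_of_real_sum:
  "map_poly complex_of_real (sum f S) = (\<Sum>i\<in>S. map_poly complex_of_real (f i))"
  by (induction S rule: infinite_finite_induct) (simp_all add: map_poly_of_real_add)

lemma map_poly_of_real_prod:
  "map_poly complex_of_real (prod f S) = (\<Prod>i\<in>S. map_poly complex_of_real (f i))"
  by (induction S rule: infinite_finite_induct) (simp_all add: map_poly_of_real_mult)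

lemma map_poly_of_real_of_int: "map_poly complex_of_real (of_int k) = of_int k"
  by (intro poly_eqI) (simp add: coeff_map_poly of_int_poly coeff_pCons split: nat.splits)

lemma poly_charpoly_complex:
  "poly (map_poly complex_of_real (charpoly M)) z = det (mat z - map_matrix complex_of_real M)"
  unfolding charpoly_def det_def map_matrix_def map_poly_of_real_sum map_poly_of_real_mult
    map_poly_of_real_prod map_poly_of_real_of_int
  by (simp add: poly_sum poly_prod mat_def)
    (auto intro!: sum.cong prod.cong arg_cong2[where f = "(*)"] simp: map_poly_pCons)

text \<open>For an eigenvector \<open>v\<close> of \<open>A^2\<close> symmetry gives
  \<open>z <v, v> = <A v, A v>\<close>, so \<open>z\<close> is a quotient of real numbers. The bound
  comes from an entry of \<open>v\<close> of largest modulus, with the row sums applied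
  twice.\<close>

lemma charpoly_square_root:
  fixes A :: "real ^ 'n ^ 'n"
  assumes sym: "\<And>i j. A $ i $ j = A $ j $ i" and row: "\<And>i. (\<Sum>j\<in>UNIV. \<bar>A $ i $ j\<bar>) \<le> r"
    and z: "poly (map_poly complex_of_real (charpoly (A ** A))) z = 0"
  shows "z \<in> \<real>" "Re z \<le> r\<^sup>2"
proof -
  let ?B = "map_matrix complex_of_real (A ** A)"
  have "\<not> invertible (mat z - ?B)"
    using z by (simp add: poly_charpoly_complex invertible_det_nz)
  then obtain v where v: "(mat z - ?B) *v v = 0" "v \<noteq> 0"
    unfolding invertible_left_inverse matrix_left_invertible_ker by blast
  define u where "u i = (\<Sum>j\<in>UNIV. A $ i $ j * v $ j)" for i
  have zv: "z * v $ i = (\<Sum>j\<in>UNIV. A $ i $ j * u j)" for i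
  proof -
    have "(\<Sum>j\<in>UNIV. ((if i = j then z else 0) - ?B $ i $ j) * v $ j) = 0"
      using v(1) by (simp add: vec_eq_iff matrix_vector_mult_def mat_def)
    then have "z * v $ i = (\<Sum>j\<in>UNIV. ?B $ i $ j * v $ j)"
      by (simp add: left_diff_distrib sum_subtractf if_distrib[of "\<lambda>x. x * _"] cong: if_cong)
    also have "\<dots> = (\<Sum>j\<in>UNIV. \<Sum>k\<in>UNIV. A $ i $ k * (A $ k $ j * v $ j))"
      by (simp add: map_matrix_def matrix_matrix_mult_def sum_distrib_right mult.assoc)
    also have "\<dots> = (\<Sum>k\<in>UNIV. A $ i $ k * u k)"
      unfolding u_def sum_distrib_left by (rule sum.swap)
    finally show ?thesis .
  qed
  have "z * (\<Sum>i\<in>UNIV. v $ i * cnj (v $ i)) = (\<Sum>i\<in>UNIV. \<Sum>j\<in>UNIV. A $ i $ j * u j * cnj (v $ i))"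
    by (simp add: sum_distrib_left sum_distrib_right mult.assoc[symmetric] zv)
  also have "\<dots> = (\<Sum>j\<in>UNIV. u j * cnj (u j))"
  proof -
    have "cnj (u j) = (\<Sum>i\<in>UNIV. A $ i $ j * cnj (v $ i))" for j
      by (simp add: u_def sym[of j])
    then show ?thesis
      by (subst sum.swap) (simp add: sum_distrib_left mult_ac)
  qed
  finally have zV: "z * (\<Sum>i\<in>UNIV. v $ i * cnj (v $ i)) = (\<Sum>j\<in>UNIV. u j * cnj (u j))" .
  define V where "V = (\<Sum>i\<in>UNIV. (cmod (v $ i))\<^sup>2)"
  define U where "U = (\<Sum>j\<in>UNIV. (cmod (u j))\<^sup>2)"
  have "z * complex_of_real V = complex_of_real U"
    using zV by (simp add: U_def V_def complex_norm_square[symmetric] del: of_real_power)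
  moreover have "V \<noteq> 0"
    unfolding V_def using v(2) by (subst sum_nonneg_eq_0_iff) (auto simp: vec_eq_iff)
  ultimately have "z = complex_of_real (U / V)"
    by (simp add: nonzero_eq_divide_eq)
  then show "z \<in> \<real>" by (metis Reals_of_real)
  obtain m where m: "\<And>i. cmod (v $ i) \<le> cmod (v $ m)"
    using Max_in[of "range (\<lambda>i. cmod (v $ i))"] Max_ge[of "range (\<lambda>i. cmod (v $ i))"] by fastforce
  have le: "cmod (\<Sum>j\<in>UNIV. A $ i $ j * f j) \<le> r * b" if "\<And>j. cmod (f j) \<le> b" "0 \<le> b" for i and f :: "'n \<Rightarrow> complex" and b
  proof -
    have "cmod (\<Sum>j\<in>UNIV. A $ i $ j * f j) \<le> (\<Sum>j\<in>UNIV. \<bar>A $ i $ j\<bar> * b)"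
      by (intro order_trans[OF norm_sum] sum_mono) (simp add: norm_mult mult_left_mono that)
    also have "\<dots> \<le> r * b"
      unfolding sum_distrib_right[symmetric] by (intro mult_right_mono row that)
    finally show ?thesis .
  qed
  have r: "0 \<le> r" using row[of m] by (meson order_trans sum_nonneg abs_ge_zero)
  have "cmod (u j) \<le> r * cmod (v $ m)" for j
    unfolding u_def by (intro le m) simp
  then have "cmod (z * v $ m) \<le> r * (r * cmod (v $ m))"
    unfolding zv by (intro le) (use r in auto)
  then have "cmod z * cmod (v $ m) \<le> r\<^sup>2 * cmod (v $ m)"
    by (simp add: norm_mult power2_eq_square mult.assoc)
  moreover have "0 < cmod (v $ m)"
  proof (rule ccontr)
    assume "\<not> 0 < cmod (v $ m)"
    then have "v $ i = 0" for i using m[of i] by simp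
    then show False using v(2) by (simp add: vec_eq_iff)
  qed
  ultimately have "cmod z \<le> r\<^sup>2" by simp
  then show "Re z \<le> r\<^sup>2" using complex_Re_le_cmod[of z] by linarith
qed

text \<open>This is conjugation by a diagonal matrix of signs. In the product along a permutation
  each sign occurs once for its row and once for its column.\<close>

lemma charpoly_gauge:
  fixes M N :: "real ^ 'n ^ 'n"
  assumes "\<And>u v. M $ u $ v = s u * N $ u $ v * s v" and s: "\<And>v. s v \<in> {1, - 1}"
  shows "charpoly M = charpoly N"
proof -
  have sq: "s v * s v = 1" for v using s[of v] by auto
  have "poly (charpoly M) x = poly (charpoly N) x" for x
  proof -
    have "(mat x - M) $ i $ j = s i * ((mat x - N) $ i $ j * s j)" for i j
      using sq by (simp add: assms(1) mat_def algebra_simps)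
    moreover have "(\<Prod>i\<in>UNIV. s i * ((mat x - N) $ i $ p i * s (p i))) = (\<Prod>i\<in>UNIV. (mat x - N) $ i $ p i)"
      if "p permutes UNIV" for p
    proof -
      have "(\<Prod>i\<in>UNIV. s (p i)) = (\<Prod>i\<in>UNIV. s i)"
        using prod.permute[OF that, of s] by (simp add: o_def)
      moreover have "(\<Prod>i\<in>UNIV. s i) * (\<Prod>i\<in>UNIV. s i) = 1"
        by (simp add: prod.distrib[symmetric] sq)
      ultimately show ?thesis
        by (simp add: prod.distrib mult_ac)
    qed
    ultimately show ?thesis
      unfolding poly_charpoly det_def by (auto intro!: sum.cong)
  qed
  then show ?thesis by (simp add: poly_eq_poly_eq_iff[symmetric] fun_eq_iff)
qed

text \<open>The inner signs meet in pairs, and squaring removes the global sign \<open>c\<close>.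
  This makes odd cycles of opposite cycle signs comparable.\<close>

lemma square_gauge:
  fixes A B :: "real ^ 'n ^ 'n"
  assumes "\<And>u v. A $ u $ v = c * (s u * B $ u $ v * s v)" "c * c = 1" and s: "\<And>v. s v \<in> {1, - 1}"
  shows "(A ** A) $ u $ v = s u * (B ** B) $ u $ v * s v"
proof -
  have sq: "s k * (s k * x) = x" for k x using s[of k] by auto
  have cc: "c * (c * x) = x" for x using assms(2) by (simp flip: mult.assoc)
  show ?thesis
    by (simp add: matrix_matrix_mult_def assms(1) sum_distrib_left sum_distrib_right mult_ac sq cc)
qed

definition cycle_edge :: "'a list \<Rightarrow> nat \<Rightarrow> 'a set" where
  "cycle_edge vs i = {vs ! i, vs ! (Suc i mod length vs)}"

definition cycle_sign :: "'a list \<Rightarrow> ('a set \<Rightarrow> real) \<Rightarrow> real" where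
  "cycle_sign vs \<sigma> = (\<Prod>i<length vs. \<sigma> (cycle_edge vs i))"

lemma signings_values: "\<sigma> \<in> signings E \<Longrightarrow> e \<in> E \<Longrightarrow> \<sigma> e \<in> {1, - 1}"
  by (auto simp: signings_def)

lemma signings_abs: "\<sigma> \<in> signings E \<Longrightarrow> e \<in> E \<Longrightarrow> \<bar>\<sigma> e\<bar> = 1"
  using signings_values by fastforce

lemma cycle_on_alt: "cycle_on vs F \<longleftrightarrow> 3 \<le> length vs \<and> distinct vs \<and> F = cycle_edge vs ` {..<length vs}"
  by (auto simp: cycle_on_def cycle_edge_def)

text \<open>A sign is transported around the cycle and changed whenever \<open>\<sigma>\<close> and
  \<open>\<tau>\<close> differ on the edge passed. It returns to its starting value because the two
  cycle signs agree.\<close>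

lemma cycle_gauge:
  assumes cyc: "cycle_on vs E" and UNIV: "set vs = UNIV"
    and \<sigma>: "\<And>e. e \<in> E \<Longrightarrow> \<sigma> e \<in> {1, - 1 :: real}" and \<tau>: "\<And>e. e \<in> E \<Longrightarrow> \<tau> e \<in> {1, - 1 :: real}"
    and sgn: "cycle_sign vs \<sigma> = cycle_sign vs \<tau>"
  obtains s where "\<And>v. s v \<in> {1, - 1 :: real}"
    "\<And>u v. {u, v} \<in> E \<Longrightarrow> \<sigma> {u, v} = s u * \<tau> {u, v} * s v"
proof -
  let ?n = "length vs" and ?e = "cycle_edge vs"
  have n: "3 \<le> ?n" "distinct vs" and E: "E = ?e ` {..<?n}"
    using cyc by (auto simp: cycle_on_alt)
  define g where "g k = (\<Prod>j<k. \<sigma> (?e j) * \<tau> (?e j))" for k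
  have pm: "\<sigma> (?e j) * \<sigma> (?e j) = 1" "\<tau> (?e j) * \<tau> (?e j) = 1" if "j < ?n" for j
    using \<sigma>[of "?e j"] \<tau>[of "?e j"] that E by auto
  have g1: "g k \<in> {1, - 1}" if "k \<le> ?n" for k
    using that
  proof (induction k)
    case (Suc k)
    moreover have "\<sigma> (?e k) \<in> {1, - 1}" "\<tau> (?e k) \<in> {1, - 1}" using Suc.prems \<sigma> \<tau> E by auto
    ultimately show ?case by (auto simp: g_def)
  qed (simp add: g_def)
  have "g ?n = cycle_sign vs \<sigma> * cycle_sign vs \<tau>"
    by (simp add: g_def cycle_sign_def prod.distrib)
  also have "\<dots> = (\<Prod>j<?n. \<tau> (?e j) * \<tau> (?e j))"
    unfolding sgn by (simp add: cycle_sign_def prod.distrib)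
  also have "\<dots> = 1" using pm by simp
  finally have gn: "g ?n = 1" .
  define s where "s v = g (inv_into {..<?n} ((!) vs) v)" for v
  have inj: "inj_on ((!) vs) {..<?n}" using n by (simp add: inj_on_nth)
  have s: "s (vs ! i) = g i" if "i < ?n" for i
    unfolding s_def using inv_into_f_f[OF inj] that by simp
  have s1: "s v \<in> {1, - 1}" for v
  proof -
    obtain i where "i < ?n" "v = vs ! i" using UNIV by (metis UNIV_I in_set_conv_nth)
    then show ?thesis using s g1[of i] by simp
  qed
  have step: "\<sigma> (?e i) = s (vs ! i) * \<tau> (?e i) * s (vs ! (Suc i mod ?n))" if i: "i < ?n" for i
  proof -
    have "s (vs ! (Suc i mod ?n)) = g (Suc i)"
    proof (cases "Suc i < ?n")
      case True
      then show ?thesis using s by simp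
    next
      case False
      \<comment> \<open>The closing edge leads back to index 0, where \<open>g\<close> is the empty
        product 1; \<open>gn\<close> gives the same value at the far end.\<close>
      then have "Suc i = ?n" using i by simp
      moreover have "s (vs ! 0) = g 0" using n by (intro s) auto
      ultimately show ?thesis using gn by (simp add: g_def)
    qed
    also have "\<dots> = g i * (\<sigma> (?e i) * \<tau> (?e i))" by (simp add: g_def)
    finally have "s (vs ! i) * \<tau> (?e i) * s (vs ! (Suc i mod ?n)) =
        (g i * g i) * (\<tau> (?e i) * \<tau> (?e i)) * \<sigma> (?e i)"
      using s[OF i] by (simp add: mult_ac)
    also have "g i * g i = 1" using g1[of i] i by auto
    finally show ?thesis using pm(2)[OF i] by simp
  qed
  have "\<sigma> {u, v} = s u * \<tau> {u, v} * s v" if uv: "{u, v} \<in> E" for u v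
  proof -
    obtain i where i: "i < ?n" "{u, v} = ?e i" using uv E by auto
    then consider "u = vs ! i" "v = vs ! (Suc i mod ?n)" | "v = vs ! i" "u = vs ! (Suc i mod ?n)"
      by (auto simp: cycle_edge_def doubleton_eq_iff)
    then show ?thesis
      using step[OF i(1)] unfolding i(2) by cases (simp_all add: mult_ac)
  qed
  with s1 show thesis by (rule that)
qed

lemma signed_adj_gauge:
  assumes "\<And>u v. {u, v} \<in> E \<Longrightarrow> \<sigma> {u, v} = c * (s u * \<tau> {u, v} * s v)"
  shows "signed_adj E \<sigma> $ u $ v = c * (s u * signed_adj E \<tau> $ u $ v * s v)"
  using assms by (simp add: signed_adj_def)

text \<open>Let \<open>c\<close> be the product of the two cycle signs. Passing from
  \<open>\<tau>\<close> to \<open>c * \<tau>\<close> multiplies the cycle sign by \<open>c\<close>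
  to the number of edges, which is \<open>c\<close> itself as that number is odd. The cycle signs
  then agree, and \<open>c\<close> disappears in the square.\<close>

lemma odd_cycle_gauge:
  fixes E :: "'a::finite set set"
  assumes "is_odd_cycle_graph E" "\<sigma> \<in> signings E" "\<tau> \<in> signings E"
  obtains s where "\<And>v. s v \<in> {1, - 1 :: real}"
    "\<And>u v. signed_adj_sq E \<sigma> $ u $ v = s u * signed_adj_sq E \<tau> $ u $ v * s v"
proof -
  obtain vs where vs: "odd (length vs)" "set vs = UNIV" "cycle_on vs E"
    using assms(1) by (auto simp: is_odd_cycle_graph_def is_cycle_graph_def)
  have E: "cycle_edge vs i \<in> E" if "i < length vs" for i
    using vs(3) that by (auto simp: cycle_on_alt)
  have pm: "cycle_sign vs \<rho> \<in> {1, - 1}" if "\<rho> \<in> signings E" for \<rho>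
  proof -
    have "\<bar>cycle_sign vs \<rho>\<bar> = (\<Prod>i<length vs. \<bar>\<rho> (cycle_edge vs i)\<bar>)"
      by (simp add: cycle_sign_def abs_prod)
    also have "\<dots> = 1"
      using signings_abs[OF that E] by (intro prod.neutral) auto
    finally show ?thesis by (auto simp: abs_if split: if_splits)
  qed
  define c :: real where "c = cycle_sign vs \<sigma> * cycle_sign vs \<tau>"
  have c: "c \<in> {1, - 1}" using pm[OF assms(2)] pm[OF assms(3)] by (auto simp: c_def)
  have "cycle_sign vs (\<lambda>e. c * \<tau> e) = c ^ length vs * cycle_sign vs \<tau>"
    by (simp add: cycle_sign_def prod.distrib)
  also have "c ^ length vs = c" using c vs(1) by auto
  finally have "cycle_sign vs \<sigma> = cycle_sign vs (\<lambda>e. c * \<tau> e)"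
    using pm[OF assms(3)] by (auto simp: c_def)
  moreover have "c * \<tau> e \<in> {1, - 1}" if "e \<in> E" for e
    using signings_values[OF assms(3) that] c by auto
  ultimately obtain s where s: "\<And>v. s v \<in> {1, - 1 :: real}"
    "\<And>u v. {u, v} \<in> E \<Longrightarrow> \<sigma> {u, v} = s u * (c * \<tau> {u, v}) * s v"
    using cycle_gauge[OF vs(3,2), of \<sigma> "\<lambda>e. c * \<tau> e"] signings_values[OF assms(2)] by blast
  have cc: "c * c = 1" using c by auto
  have "signed_adj E \<sigma> $ u $ v = c * (s u * signed_adj E \<tau> $ u $ v * s v)" for u v
    using s(2) by (intro signed_adj_gauge) (simp add: mult_ac)
  then have "signed_adj_sq E \<sigma> $ u $ v = s u * signed_adj_sq E \<tau> $ u $ v * s v" for u v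
    unfolding signed_adj_sq_def by (rule square_gauge[OF _ cc s(1)])
  then show thesis using that s(1) by blast
qed

lemma odd_cycle_charpoly:
  fixes E :: "'a::finite set set"
  assumes "is_odd_cycle_graph E" "\<sigma> \<in> signings E" "\<tau> \<in> signings E"
  shows "charpoly (signed_adj_sq E \<sigma>) = charpoly (signed_adj_sq E \<tau>)"
  using odd_cycle_gauge[OF assms] charpoly_gauge by metis

lemma odd_cycle_q_poly:
  fixes E :: "'a::finite set set"
  assumes "is_odd_cycle_graph E" "\<sigma> \<in> signings E"
  shows "q_poly E = charpoly (signed_adj_sq E \<sigma>)"
proof -
  have "card (signings E) \<noteq> 0" using assms(2) by (auto simp: card_eq_0_iff)
  moreover have "(\<Sum>\<tau>\<in>signings E. charpoly (signed_adj_sq E \<tau>)) =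
      smult (real (card (signings E))) (charpoly (signed_adj_sq E \<sigma>))"
    using odd_cycle_charpoly[OF assms(1) _ assms(2)] by (simp add: of_nat_poly)
  ultimately show ?thesis by (simp add: q_poly_def)
qed

lemma signed_adj_sym: "signed_adj E \<sigma> $ i $ j = signed_adj E \<sigma> $ j $ i"
  by (simp add: signed_adj_def insert_commute)

lemma regular_row_sum:
  assumes "regular_graph E d" "\<sigma> \<in> signings E"
  shows "(\<Sum>j\<in>UNIV. \<bar>signed_adj E \<sigma> $ i $ j\<bar>) = real d"
proof -
  have "(\<Sum>j\<in>UNIV. \<bar>signed_adj E \<sigma> $ i $ j\<bar>) = (\<Sum>j\<in>UNIV. if {i, j} \<in> E then 1 else 0)"
    using signings_abs[OF assms(2)] by (intro sum.cong) (auto simp: signed_adj_def)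
  also have "\<dots> = real (card {j. {i, j} \<in> E})"
    by (simp add: sum.If_cases)
  finally show ?thesis using assms(1) by (simp add: regular_graph_def)
qed

lemma odd_cycle_roots:
  fixes E :: "'a::finite set set"
  assumes "is_odd_cycle_graph E" "regular_graph E d"
    and "poly (map_poly complex_of_real (q_poly E)) z = 0"
  shows "z \<in> \<real>" "Re z \<le> (real d)\<^sup>2"
proof -
  obtain \<sigma> where \<sigma>: "\<sigma> \<in> signings E" using signings_nonempty by blast
  have "poly (map_poly complex_of_real (charpoly (signed_adj E \<sigma> ** signed_adj E \<sigma>))) z = 0"
    using assms(3) odd_cycle_q_poly[OF assms(1) \<sigma>] by (simp add: signed_adj_sq_def)
  then show "z \<in> \<real>" "Re z \<le> (real d)\<^sup>2"
    using charpoly_square_root[of "signed_adj E \<sigma>" "real d" z] signed_adj_sym[of E \<sigma>]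
      regular_row_sum[OF assms(2) \<sigma>] by auto
qed

section \<open>Small regular graphs\<close>

abbreviation neighbours :: "'a set set \<Rightarrow> 'a \<Rightarrow> 'a set" where
  "neighbours E u \<equiv> {w. {u, w} \<in> E}"

lemma graph_on_cycle_edges:
  assumes "2 \<le> length vs"
  shows "graph_on vs (cycle_edges (length vs)) = cycle_edge vs ` {..<length vs}"
proof -
  obtain m where m: "length vs = Suc m" "0 < m" using assms by (cases "length vs") auto
  have "cycle_edge vs i = {vs ! i, vs ! Suc i}" if "i < m" for i
    using that m by (simp add: cycle_edge_def)
  moreover have "cycle_edge vs m = {vs ! 0, vs ! m}"
    using m by (simp add: cycle_edge_def insert_commute)
  moreover have "{..<length vs} = insert m {..<m}" using m by auto
  ultimately have "cycle_edge vs ` {..<length vs} = insert {vs ! 0, vs ! m} ((\<lambda>i. {vs ! i, vs ! Suc i}) ` {..<m})"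
    by simp
  then show ?thesis
    using m by (simp add: graph_on_def cycle_edges_def image_image atLeast0LessThan)
qed

lemma graph_on_append:
  assumes "proper_edges (length vs) es"
  shows "graph_on (vs @ ws) (es @ map (\<lambda>(i, j). (i + length vs, j + length vs)) fs) = graph_on vs es \<union> graph_on ws fs"
proof -
  have "(\<lambda>(i, j). {(vs @ ws) ! i, (vs @ ws) ! j}) ` set es = (\<lambda>(i, j). {vs ! i, vs ! j}) ` set es"
    using assms by (intro image_cong) (auto simp: proper_edges_def nth_append)
  then show ?thesis
    by (simp add: graph_on_def image_Un image_image case_prod_beta nth_append)
qed

lemma proper_cycle_edges: "2 \<le> n \<Longrightarrow> proper_edges n (cycle_edges n)"
  by (auto simp: proper_edges_def cycle_edges_def)

lemma graph_on_two_cycles: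
  assumes "3 \<le> length p" "3 \<le> length q"
  shows "graph_on (p @ q) (two_cycles (length p) (length q)) =
    cycle_edge p ` {..<length p} \<union> cycle_edge q ` {..<length q}"
  using assms by (simp add: two_cycles_def graph_on_append proper_cycle_edges graph_on_cycle_edges)

text \<open>Predecessor and successor on a cycle of length at least three are different
  neighbours.\<close>

lemma cycle_degree_ge:
  fixes p :: "'a::finite list"
  assumes "cycle_on p C" "u \<in> set p"
  shows "2 \<le> card (neighbours C u)"
proof -
  let ?n = "length p"
  have n: "3 \<le> ?n" "distinct p" and C: "C = cycle_edge p ` {..<?n}"
    using assms(1) by (auto simp: cycle_on_alt)
  obtain i where i: "i < ?n" "u = p ! i" using assms(2) by (metis in_set_conv_nth)
  define j where "j = (if i = 0 then ?n - 1 else i - 1)"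
  have j: "j < ?n" "Suc j mod ?n = i" "j \<noteq> Suc i mod ?n"
    using i n by (auto simp: j_def mod_Suc)
  have "p ! (Suc i mod ?n) \<in> neighbours C u"
    unfolding C i(2) using i(1) by (auto simp: cycle_edge_def)
  moreover have "p ! j \<in> neighbours C u"
    unfolding C i(2) using j(1,2) by (auto simp: cycle_edge_def insert_commute intro!: image_eqI[of _ _ j])
  moreover have "p ! j \<noteq> p ! (Suc i mod ?n)"
    using nth_eq_iff_index_eq[OF n(2) j(1) mod_less_divisor] j(1,3) by fastforce
  ultimately have "card {p ! j, p ! (Suc i mod ?n)} \<le> card (neighbours C u)"
    by (intro card_mono) auto
  then show ?thesis using \<open>p ! j \<noteq> p ! (Suc i mod ?n)\<close> by simp
qed

text \<open>A longest path in a 2-regular graph closes up to a cycle, because the second neighbour of its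
  last vertex can only be its first vertex.\<close>

lemma two_regular_cycle_through:
  fixes E :: "'a::finite set set"
  assumes simple: "simple_graph E" and reg: "regular_graph E 2"
  obtains p C where "hd p = v" "cycle_on p C" "C \<subseteq> E" "\<And>u w. u \<in> set p \<Longrightarrow> {u, w} \<in> E \<Longrightarrow> {u, w} \<in> C"
proof -
  define path where "path p \<longleftrightarrow> p \<noteq> [] \<and> distinct p \<and> hd p = v \<and>
    (\<forall>i. Suc i < length p \<longrightarrow> {p ! i, p ! Suc i} \<in> E)" for p
  have N: "card (neighbours E u) = 2" for u using reg by (simp add: regular_graph_def)
  have irr: "{u, u} \<notin> E" for u using simple by (auto simp: simple_graph_def)
  have "path [v]" by (simp add: path_def)
  moreover have "length p \<le> CARD('a)" if "path p" for p
    using that distinct_card[of p] card_mono[OF finite, of "set p" UNIV] by (auto simp: path_def)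
  ultimately obtain p where p: "path p" and max: "\<And>q. path q \<Longrightarrow> length q \<le> length p"
    using ex_has_greatest_nat[of path "[v]" length "Suc (CARD('a))"] by (auto simp: less_Suc_eq_le)
  define n where "n = length p"
  have p': "p \<noteq> []" "distinct p" "hd p = v" "\<And>i. Suc i < n \<Longrightarrow> {p ! i, p ! Suc i} \<in> E"
    using p by (auto simp: path_def n_def)
  have n: "0 < n" using p' by (simp add: n_def)
  have step: "w \<in> set p" if "{p ! (n - 1), w} \<in> E" for w
  proof (rule ccontr)
    assume w: "w \<notin> set p"
    have "path (p @ [w])"
      unfolding path_def
    proof (intro conjI allI impI)
      fix i assume "Suc i < length (p @ [w])"
      then consider "Suc i < n" | "i = n - 1" using n by (auto simp: n_def less_Suc_eq)
      then show "{(p @ [w]) ! i, (p @ [w]) ! Suc i} \<in> E"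
        using p'(4)[of i] that n by cases (auto simp: nth_append n_def)
    qed (use p' w in auto)
    then show False using max[of "p @ [w]"] by simp
  qed
  \<comment> \<open>A neighbour of the last vertex other than its predecessor. A one-vertex path has
    no predecessor, hence the condition \<open>2 \<le> n\<close>; there \<open>n - 2\<close> is
    truncated to 0.\<close>
  obtain y where y: "{p ! (n - 1), y} \<in> E" "2 \<le> n \<Longrightarrow> y \<noteq> p ! (n - 2)"
  proof -
    have "\<not> neighbours E (p ! (n - 1)) \<subseteq> {p ! (n - 2)}"
      using N[of "p ! (n - 1)"] card_mono[of "{p ! (n - 2)}" "neighbours E (p ! (n - 1))"] by auto
    then show thesis using that by blast
  qed
  obtain j where j: "j < n" "y = p ! j" using step[OF y(1)] by (metis in_set_conv_nth n_def)
  have "j \<noteq> n - 1" using y(1) j irr by auto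
  moreover have "j \<noteq> n - 2" if "2 \<le> n" using y(2)[OF that] j by auto
  ultimately have jn: "j + 2 < n" using j(1) by linarith
  \<comment> \<open>Otherwise \<open>p ! j\<close> has three neighbours: the vertices before and
    after it and the last one, all different because \<open>j + 2 < n\<close>.\<close>
  have "j = 0"
  proof (rule ccontr)
    assume "j \<noteq> 0"
    then obtain i where i: "j = Suc i" by (cases j) auto
    have "{p ! i, p ! Suc j, p ! (n - 1)} \<subseteq> neighbours E (p ! j)"
      using p'(4)[of i] p'(4)[of j] y(1) j jn i by (auto simp: insert_commute)
    moreover have "card {p ! i, p ! Suc j, p ! (n - 1)} = 3"
      using jn i p'(2) by (simp add: nth_eq_iff_index_eq n_def)
    ultimately have "3 \<le> card (neighbours E (p ! j))"
      by (metis card_mono finite)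
    then show False using N by simp
  qed
  define C where "C = cycle_edge p ` {..<n}"
  have cyc: "cycle_on p C"
    using jn p'(2) by (simp add: cycle_on_alt C_def n_def)
  have "cycle_edge p i \<in> E" if "i < n" for i
  proof (cases "Suc i < n")
    case True
    then show ?thesis using p'(4) by (simp add: cycle_edge_def n_def)
  next
    case False
    then have "i = n - 1" "Suc i = n" using that by auto
    then show ?thesis using y(1) j \<open>j = 0\<close> by (simp add: cycle_edge_def n_def)
  qed
  then have CE: "C \<subseteq> E" by (auto simp: C_def)
  \<comment> \<open>The cycle already supplies two neighbours at each of its vertices, so
    \<open>E\<close> has no further edge there.\<close>
  have "neighbours C u = neighbours E u" if "u \<in> set p" for u
    using CE cycle_degree_ge[OF cyc that] N[of u] by (intro card_seteq) auto
  then have "{u, w} \<in> C" if "u \<in> set p" "{u, w} \<in> E" for u w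
    using that by blast
  then show thesis using that[OF p'(3) cyc CE] by blast
qed

lemma cycle_on_subset: "cycle_on p C \<Longrightarrow> e \<in> C \<Longrightarrow> e \<subseteq> set p"
  by (auto simp: cycle_on_alt cycle_edge_def intro!: nth_mem mod_less_divisor)

lemma cycle_on_closed:
  assumes "cycle_on p C" "C \<subseteq> E" "hd p \<in> X" and X: "\<And>u w. u \<in> X \<Longrightarrow> {u, w} \<in> E \<Longrightarrow> w \<in> X"
  shows "set p \<subseteq> X"
proof -
  have "p ! i \<in> X" if "i < length p" for i
    using that
  proof (induction i)
    case 0
    then show ?case using assms(3) by (metis hd_conv_nth length_greater_0_conv)
  next
    case (Suc i)
    have "cycle_edge p i \<in> C" using assms(1) Suc.prems by (auto simp: cycle_on_alt)
    then have "{p ! i, p ! Suc i} \<in> E" using assms(2) Suc.prems by (auto simp: cycle_edge_def)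
    then show ?case using X[of "p ! i"] Suc by simp
  qed
  then show ?thesis by (auto simp: in_set_conv_nth)
qed

text \<open>The cycle through one vertex contains every edge at its vertices, so nothing outside it
  can be reached.\<close>

lemma connected_two_regular:
  fixes E :: "'a::finite set set"
  assumes "simple_graph E" "regular_graph E 2" "connected_graph E"
  obtains p where "cycle_on p E" "set p = UNIV"
proof -
  obtain p C where p: "hd p = undefined" "cycle_on p C" "C \<subseteq> E"
    "\<And>u w. u \<in> set p \<Longrightarrow> {u, w} \<in> E \<Longrightarrow> {u, w} \<in> C"
    using two_regular_cycle_through[OF assms(1,2)] by blast
  have "p \<noteq> []" using p(2) by (auto simp: cycle_on_def)
  have "w \<in> set p" for w
  proof -
    have "(hd p, w) \<in> {(a, b). {a, b} \<in> E}\<^sup>*" using assms(3) by (simp add: connected_graph_def)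
    then show ?thesis
    proof (induction rule: rtrancl_induct)
      case base
      show ?case using \<open>p \<noteq> []\<close> by simp
    next
      case (step a b)
      then show ?case using p(4)[of a b] cycle_on_subset[OF p(2), of "{a, b}"] by auto
    qed
  qed
  then have "set p = UNIV" by blast
  moreover have "E \<subseteq> C"
  proof
    fix e assume e: "e \<in> E"
    then obtain u w where "e = {u, w}" using assms(1) by (auto simp: simple_graph_def card_2_iff)
    then show "e \<in> C" using p(4)[of u w] e \<open>set p = UNIV\<close> by simp
  qed
  ultimately show thesis using that p(2,3) by auto
qed

text \<open>Components are cycles on at least three vertices, so three of them would need nine. The
  lemma is applied to complements, which may be disconnected.\<close>

lemma two_regular_small:
  fixes E :: "'a::finite set set"
  assumes E: "simple_graph E" "regular_graph E 2" and card: "CARD('a) \<le> 7"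
  obtains p where "distinct p" "set p = UNIV" "E = graph_on p (cycle_edges (length p))"
  | p where "distinct p" "set p = UNIV" "length p = 6" "E = graph_on p (two_cycles 3 3)"
  | p where "distinct p" "set p = UNIV" "length p = 7" "E = graph_on p (two_cycles 3 4)"
proof -
  define closed where "closed p C \<longleftrightarrow> cycle_on p C \<and> C \<subseteq> E \<and> (\<forall>u w. u \<in> set p \<longrightarrow> {u, w} \<in> E \<longrightarrow> {u, w} \<in> C)" for p C
  have ex: "\<exists>p C. hd p = v \<and> closed p C" for v
    using two_regular_cycle_through[OF E, of v] unfolding closed_def by metis
  have len: "3 \<le> length p" "distinct p" "C = graph_on p (cycle_edges (length p))" if "closed p C" for p C
    using that graph_on_cycle_edges[of p] by (auto simp: closed_def cycle_on_alt)
  have disj: "set q \<inter> set p = {}" if "closed p C" "closed q D" "hd q \<notin> set p" for p C q D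
  proof -
    have "w \<notin> set p" if "u \<notin> set p" "{u, w} \<in> E" for u w
    proof
      assume "w \<in> set p"
      moreover have "{w, u} \<in> E" using that(2) by (simp add: insert_commute)
      ultimately have "{w, u} \<in> C" using \<open>closed p C\<close> by (simp add: closed_def)
      then show False using cycle_on_subset \<open>closed p C\<close> that(1) unfolding closed_def by blast
    qed
    then have "set q \<subseteq> - set p"
      using that by (intro cycle_on_closed[of q D E]) (auto simp: closed_def)
    then show ?thesis by blast
  qed
  have hd: "hd q \<in> set q" if "closed q D" for q D
    using len(1)[OF that] by (intro hd_in_set) auto
  have edges: "E = C \<union> D" if "closed p C" "closed q D" "set p \<union> set q = UNIV" for p C q D
  proof
    show "E \<subseteq> C \<union> D"
    proof
      fix e assume e: "e \<in> E"
      then obtain u w where uw: "e = {u, w}" using E(1) by (auto simp: simple_graph_def card_2_iff)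
      have "u \<in> set p \<union> set q" using that(3) by simp
      then show "e \<in> C \<union> D" using that(1,2) e uw unfolding closed_def by blast
    qed
  qed (use that in \<open>auto simp: closed_def\<close>)
  obtain p C where p: "closed p C" using ex by blast
  show thesis
  proof (cases "set p = UNIV")
    case True
    then have "E = C" using edges[OF p p] by simp
    then show thesis using that(1)[of p] True len[OF p] by simp
  next
    case False
    then obtain v where "v \<notin> set p" by blast
    then obtain q D where q: "closed q D" "hd q \<notin> set p" using ex by metis
    have pq: "set p \<inter> set q = {}" using disj[OF p q] by blast
    have cpq: "card (set p \<union> set q) = length p + length q"
      using pq len(2)[OF p] len(2)[OF q(1)] by (simp add: card_Un_disjoint distinct_card)
    have full: "set p \<union> set q = UNIV"
    proof (rule ccontr)
      assume "set p \<union> set q \<noteq> UNIV"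
      then obtain v where v: "v \<notin> set p \<union> set q" by blast
      obtain r F where r: "closed r F" "hd r = v" using ex by metis
      have "set r \<inter> (set p \<union> set q) = {}"
        using disj[OF p r(1)] disj[OF q(1) r(1)] v r(2) by auto
      then have "card (set p \<union> set q \<union> set r) = length p + length q + length r"
        using cpq len(2)[OF r(1)] by (subst card_Un_disjoint) (auto simp: distinct_card)
      moreover have "card (set p \<union> set q \<union> set r) \<le> CARD('a)" by (intro card_mono) auto
      ultimately show False using card len(1)[OF p] len(1)[OF q(1)] len(1)[OF r(1)] by simp
    qed
    then have tot: "length p + length q = CARD('a)" using cpq by simp
    have dist: "distinct (p @ q)" "distinct (q @ p)" using pq len(2)[OF p] len(2)[OF q(1)] by auto
    have EE: "E = graph_on (p @ q) (two_cycles (length p) (length q))"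
      "E = graph_on (q @ p) (two_cycles (length q) (length p))"
      using edges[OF p q(1) full] p q(1) len(1)[OF p] len(1)[OF q(1)]
      by (auto simp: graph_on_two_cycles closed_def cycle_on_alt)
    consider "length p = 3" "length q = 3" | "length p = 3" "length q = 4" | "length p = 4" "length q = 3"
      using tot card len(1)[OF p] len(1)[OF q(1)] by linarith
    then show thesis
    proof cases
      case 1
      then show thesis using that(2)[of "p @ q"] dist full EE by auto
    next
      case 2
      then show thesis using that(3)[of "p @ q"] dist full EE by auto
    next
      case 3
      then show thesis using that(3)[of "q @ p"] dist full EE by auto
    qed
  qed
qed

section \<open>Complements, degree counting and perfect matchings\<close>

definition complement_graph :: "'a set set \<Rightarrow> 'a set set" where
  "complement_graph E = {e. card e = 2} - E"

lemma simple_complement: "simple_graph (complement_graph E)"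
  by (auto simp: simple_graph_def complement_graph_def)

lemma regular_complement:
  fixes E :: "'a::finite set set"
  assumes "simple_graph E" "regular_graph E d"
  shows "d < CARD('a)" "regular_graph (complement_graph E) (CARD('a) - 1 - d)"
proof -
  have sub: "neighbours E u \<subseteq> UNIV - {u}" for u
    using assms(1) by (auto simp: simple_graph_def)
  have N: "card (neighbours E u) = d" for u using assms(2) by (simp add: regular_graph_def)
  have "d \<le> CARD('a) - 1"
    using card_mono[OF _ sub, of undefined] N[of undefined] by simp
  moreover have "0 < CARD('a)" by simp
  ultimately show "d < CARD('a)" by linarith
  have "neighbours (complement_graph E) u = (UNIV - {u}) - neighbours E u" for u
    by (auto simp: complement_graph_def)
  then show "regular_graph (complement_graph E) (CARD('a) - 1 - d)"
    using N sub by (simp add: regular_graph_def card_Diff_subset)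
qed

lemma edge_index:
  assumes "distinct vs" "set vs = UNIV" "card e = 2"
  obtains i j where "i < j" "j < length vs" "e = {vs ! i, vs ! j}"
proof -
  obtain u w where uw: "e = {u, w}" "u \<noteq> w" using assms(3) by (meson card_2_iff)
  obtain i j where "i < length vs" "u = vs ! i" "j < length vs" "w = vs ! j"
    using assms(2) by (metis UNIV_I in_set_conv_nth)
  then show thesis
    using uw that[of i j] that[of j i] by (cases i j rule: linorder_cases) (auto simp: insert_commute)
qed

lemma in_complete_edges: "(i, j) \<in> set (complete_edges n) \<longleftrightarrow> i < j \<and> j < n"
  by (auto simp: complete_edges_def image_iff)

lemma graph_on_complement:
  assumes vs: "distinct vs" "set vs = UNIV" and E: "simple_graph E"
    and es: "proper_edges (length vs) es" "complement_graph E = graph_on vs es"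
  shows "E = graph_on vs (complement_edges (length vs) es)"
proof (intro set_eqI iffI)
  let ?cs = "complement_edges (length vs) es"
  have cs: "(i, j) \<in> set ?cs \<longleftrightarrow> i < j \<and> j < length vs \<and> (i, j) \<notin> set es" for i j
    by (auto simp: complement_edges_def in_complete_edges)
  have rel: "edge_rel es i j \<longleftrightarrow> (i, j) \<in> set es" if "i < j" for i j
    using es(1) that by (auto simp: edge_rel_def proper_edges_def)
  have compl: "{vs ! i, vs ! j} \<in> complement_graph E \<longleftrightarrow> (i, j) \<in> set es" if "i < j" "j < length vs" for i j
    using graph_on_iff[OF vs(1) es(1), of i j] that rel by (simp add: es(2))
  fix e
  {
    assume e: "e \<in> E"
    then have "card e = 2" using E by (simp add: simple_graph_def)
    then obtain i j where ij: "i < j" "j < length vs" "e = {vs ! i, vs ! j}" using edge_index[OF vs] by blast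
    then have "(i, j) \<in> set ?cs" using compl cs e by (auto simp: complement_graph_def)
    then show "e \<in> graph_on vs ?cs" using ij(3) by (force simp: graph_on_def)
  next
    assume "e \<in> graph_on vs ?cs"
    then obtain i j where ij: "(i, j) \<in> set ?cs" "e = {vs ! i, vs ! j}" by (auto simp: graph_on_def)
    then have "i < j" "j < length vs" "(i, j) \<notin> set es" using cs by auto
    then have "{vs ! i, vs ! j} \<notin> complement_graph E" "card {vs ! i, vs ! j} = 2"
      using compl vs(1) by (auto simp: nth_eq_iff_index_eq)
    then show "e \<in> E" by (simp add: ij(2) complement_graph_def)
  }
qed

lemma graph_on_complete:
  assumes vs: "distinct vs" "set vs = UNIV" and "complement_graph E = {}" "simple_graph E"
  shows "E = graph_on vs (complete_edges (length vs))"
proof -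
  have "complement_edges (length vs) [] = complete_edges (length vs)"
    by (simp add: complement_edges_def)
  then show ?thesis
    using graph_on_complement[OF vs assms(4), of "[]"] assms(3) by (simp add: proper_edges_def graph_on_def)
qed

lemma degree_sum:
  fixes E :: "'a::finite set set"
  assumes "simple_graph E"
  shows "(\<Sum>u\<in>UNIV. card (neighbours E u)) = 2 * card E"
proof -
  have "card (neighbours E u) = card {e \<in> E. u \<in> e}" for u
  proof -
    have "{e \<in> E. u \<in> e} = (\<lambda>w. {u, w}) ` neighbours E u"
    proof (intro set_eqI iffI)
      fix e assume e: "e \<in> {e \<in> E. u \<in> e}"
      then obtain x y where "e = {x, y}" using assms by (auto simp: simple_graph_def card_2_iff)
      then show "e \<in> (\<lambda>w. {u, w}) ` neighbours E u" using e by (auto simp: insert_commute)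
    qed auto
    moreover have "inj_on (\<lambda>w. {u, w}) (neighbours E u)" by (auto simp: inj_on_def doubleton_eq_iff)
    ultimately show ?thesis by (simp add: card_image)
  qed
  then have "(\<Sum>u\<in>UNIV. card (neighbours E u)) = (\<Sum>u\<in>UNIV. \<Sum>e\<in>E. if u \<in> e then 1 else 0)"
    by (simp add: sum.If_cases Int_def)
  also have "\<dots> = (\<Sum>e\<in>E. card e)"
    by (subst sum.swap) (simp add: sum.If_cases)
  also have "\<dots> = 2 * card E"
    using assms by (simp add: simple_graph_def)
  finally show ?thesis .
qed

lemma even_degree_sum:
  fixes E :: "'a::finite set set"
  assumes "simple_graph E" "regular_graph E d"
  shows "even (d * CARD('a))"
proof -
  have "d * CARD('a) = 2 * card E"
    using degree_sum[OF assms(1)] assms(2) by (simp add: regular_graph_def mult.commute)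
  then show ?thesis by simp
qed

text \<open>The unique neighbour defines an involution \<open>m\<close> without fixed points.
  Choosing \<open>a\<close>, then \<open>b\<close> and \<open>c\<close> outside the pairs found so
  far, uses up all six vertices.\<close>

lemma perfect_matching_six:
  fixes E :: "'a::finite set set"
  assumes "simple_graph E" "regular_graph E 1" "CARD('a) = 6"
  obtains vs where "distinct vs" "set vs = UNIV" "length vs = 6" "E = graph_on vs [(0, 1), (2, 3), (4, 5)]"
proof -
  have "\<exists>w. neighbours E u = {w}" for u
    using assms(2) by (simp add: regular_graph_def card_1_singleton_iff)
  then obtain m where m: "\<And>u. neighbours E u = {m u}" by metis
  have e: "{u, w} \<in> E \<longleftrightarrow> w = m u" for u w using m[of u] by auto
  have mm: "m (m u) = u" for u using e[of u "m u"] e[of "m u" u] by (simp add: insert_commute)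
  have mu: "m u \<noteq> u" for u using e[of u u] assms(1) by (auto simp: simple_graph_def)
  obtain a where "a \<in> (UNIV :: 'a set)" by blast
  have "\<not> UNIV \<subseteq> {a, m a}"
    using card_mono[of "{a, m a}" UNIV] assms(3) card_insert_le_m1[of 2 "{m a}" a] by auto
  then obtain b where b: "b \<notin> {a, m a}" by blast
  have "\<not> UNIV \<subseteq> set [a, m a, b, m b]"
    using card_mono[of "set [a, m a, b, m b]" UNIV] assms(3) card_length[of "[a, m a, b, m b]"] by auto
  then obtain c where c: "c \<notin> {a, m a, b, m b}" by auto
  let ?vs = "[a, m a, b, m b, c, m c]"
  have d: "distinct ?vs"
    using b c mu mm by (simp, metis)
  then have U: "set ?vs = UNIV"
    using assms(3) distinct_card[OF d] by (intro card_subset_eq) auto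
  have "E = {{a, m a}, {b, m b}, {c, m c}}"
  proof (intro set_eqI iffI)
    fix x assume x: "x \<in> E"
    then obtain u w where "x = {u, w}" using assms(1) by (auto simp: simple_graph_def card_2_iff)
    then have "x = {u, m u}" using x e by simp
    moreover have "u \<in> set ?vs" using U by simp
    ultimately show "x \<in> {{a, m a}, {b, m b}, {c, m c}}" using mm by (auto simp: insert_commute)
  qed (use e in auto)
  also have "\<dots> = graph_on ?vs [(0, 1), (2, 3), (4, 5)]" by (simp add: graph_on_def numeral_eq_Suc)
  finally show thesis using that[OF d U] by simp
qed

section \<open>The four-cycle and the complete graph on four vertices\<close>

abbreviation switch_rel :: "'a set set \<Rightarrow> (('a set \<Rightarrow> real) \<times> ('a set \<Rightarrow> real)) set" where
  "switch_rel E \<equiv> {(\<sigma>, switch_at E v \<sigma>) | \<sigma> v. \<sigma> \<in> signings E}"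

text \<open>The combined effect of one switch at each vertex of \<open>W\<close>, in any
  order.\<close>

definition switch_set :: "'a set set \<Rightarrow> 'a set \<Rightarrow> ('a set \<Rightarrow> real) \<Rightarrow> 'a set \<Rightarrow> real" where
  "switch_set E W \<sigma> = (\<lambda>e\<in>E. (-1) ^ card (e \<inter> W) * \<sigma> e)"

lemma switch_set_in_signings:
  assumes "\<sigma> \<in> signings E"
  shows "switch_set E W \<sigma> \<in> signings E"
proof -
  have "(-1) ^ n * x \<in> {1, - 1 :: real}" if "x \<in> {1, - 1}" for n x
    using that by (cases "even n") auto
  then show ?thesis
    using signings_values[OF assms] by (simp add: signings_def switch_set_def)
qed

lemma switch_set_reachable:
  fixes E :: "'a::finite set set"
  assumes "\<sigma> \<in> signings E"
  shows "(\<sigma>, switch_set E W \<sigma>) \<in> (switch_rel E)\<^sup>*"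
  using finite[of W]
proof (induction W rule: finite_induct)
  case empty
  have "switch_set E {} \<sigma> = \<sigma>"
    using assms by (auto simp: switch_set_def signings_def PiE_iff extensional_def fun_eq_iff)
  then show ?case by simp
next
  case (insert v W)
  have "card (e \<inter> insert v W) = (if v \<in> e then Suc (card (e \<inter> W)) else card (e \<inter> W))" for e
    using insert.hyps by (simp add: Int_insert_right)
  then have "switch_set E (insert v W) \<sigma> = switch_at E v (switch_set E W \<sigma>)"
    by (auto simp: switch_set_def switch_at_def fun_eq_iff)
  then have "(switch_set E W \<sigma>, switch_set E (insert v W) \<sigma>) \<in> switch_rel E"
    using switch_set_in_signings[OF assms] by blast
  with insert.IH show ?case by (rule rtrancl_into_rtrancl)
qed

text \<open>Switching at the vertices with \<open>s v = - 1\<close> suffices: an edge changes sign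
  exactly when one of its two ends is among them.\<close>

lemma gauge_reachable:
  fixes E :: "'a::finite set set"
  assumes "simple_graph E" "\<sigma> \<in> signings E" "\<tau> \<in> signings E"
    and s: "\<And>v. s v \<in> {1, - 1 :: real}" "\<And>u v. {u, v} \<in> E \<Longrightarrow> \<tau> {u, v} = s u * \<sigma> {u, v} * s v"
  shows "(\<sigma>, \<tau>) \<in> (switch_rel E)\<^sup>*"
proof -
  have "\<tau> e = switch_set E {v. s v = - 1} \<sigma> e" for e
  proof (cases "e \<in> E")
    case True
    then obtain u v where e: "e = {u, v}" "u \<noteq> v"
      using assms(1) by (auto simp: simple_graph_def card_2_iff)
    have "(-1) ^ card (e \<inter> {v. s v = - 1}) = s u * s v"
      using s(1)[of u] s(1)[of v] e(2) by (auto simp: e(1) Int_insert_left)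
    then show ?thesis
      using True s(2)[of u v] by (simp add: switch_set_def e(1))
  next
    case False
    then show ?thesis
      using assms(3) by (auto simp: switch_set_def signings_def PiE_iff extensional_def)
  qed
  then have "\<tau> = switch_set E {v. s v = - 1} \<sigma>" by blast
  then show ?thesis using switch_set_reachable[OF assms(2)] by simp
qed

lemma cycle_simple:
  assumes "cycle_on vs E"
  shows "simple_graph E"
proof -
  have "card (cycle_edge vs i) = 2" if "i < length vs" for i
  proof -
    have n: "3 \<le> length vs" "distinct vs" using assms by (auto simp: cycle_on_def)
    have "Suc i mod length vs \<noteq> i" "Suc i mod length vs < length vs"
      using that n by (auto simp: mod_Suc)
    then show ?thesis
      using that n by (simp add: cycle_edge_def nth_eq_iff_index_eq)
  qed
  then show ?thesis using assms by (auto simp: cycle_on_alt simple_graph_def)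
qed

lemma cycle_edge_list4:
  "cycle_edge [a, b, c, d] ` {..<4} = {{a, b}, {b, c}, {c, d}, {d, a}}"
  "cycle_sign [a, b, c, d] \<sigma> = \<sigma> {a, b} * \<sigma> {b, c} * \<sigma> {c, d} * \<sigma> {d, a}"
proof -
  have I: "{..<4::nat} = {0, Suc 0, Suc (Suc 0), Suc (Suc (Suc 0))}" by auto
  have e: "cycle_edge [a, b, c, d] 0 = {a, b}" "cycle_edge [a, b, c, d] (Suc 0) = {b, c}"
      "cycle_edge [a, b, c, d] (Suc (Suc 0)) = {c, d}" "cycle_edge [a, b, c, d] (Suc (Suc (Suc 0))) = {d, a}"
    by (simp_all add: cycle_edge_def)
  show "cycle_edge [a, b, c, d] ` {..<4} = {{a, b}, {b, c}, {c, d}, {d, a}}"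
    by (simp add: I e)
  have "length [a, b, c, d] = 4" by simp
  then show "cycle_sign [a, b, c, d] \<sigma> = \<sigma> {a, b} * \<sigma> {b, c} * \<sigma> {c, d} * \<sigma> {d, a}"
    unfolding cycle_sign_def by (simp only: I) (simp add: e mult_ac)
qed

lemma length4E:
  assumes "length vs = 4"
  obtains a b c d where "vs = [a, b, c, d]"
proof -
  have "length vs = Suc (Suc (Suc (Suc 0)))" using assms by simp
  then show thesis using that by (simp only: length_Suc_conv length_0_conv) blast
qed

lemma is_cycle4E:
  assumes "is_cycle_graph E 4"
  obtains a b c d where "distinct [a, b, c, d]" "UNIV = {a, b, c, d}"
    "E = {{a, b}, {b, c}, {c, d}, {d, a}}" "cycle_on [a, b, c, d] E"
    "\<And>\<sigma>. cycle_sign [a, b, c, d] \<sigma> = \<sigma> {a, b} * \<sigma> {b, c} * \<sigma> {c, d} * \<sigma> {d, a}"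
proof -
  obtain vs where vs: "length vs = 4" "set vs = UNIV" "cycle_on vs E"
    using assms by (auto simp: is_cycle_graph_def)
  from length4E[OF vs(1)] obtain a b c d where abcd: "vs = [a, b, c, d]" .
  show thesis
  proof (rule that)
    show "distinct [a, b, c, d]" "UNIV = {a, b, c, d}" "cycle_on [a, b, c, d] E"
      using vs abcd by (auto simp: cycle_on_def)
    show "E = {{a, b}, {b, c}, {c, d}, {d, a}}"
      using vs(1,3) abcd by (simp only: cycle_on_alt cycle_edge_list4)
    show "cycle_sign [a, b, c, d] \<sigma> = \<sigma> {a, b} * \<sigma> {b, c} * \<sigma> {c, d} * \<sigma> {d, a}" for \<sigma>
      by (rule cycle_edge_list4)
  qed
qed

text \<open>The zero pattern comes from squaring a bipartite adjacency matrix with parts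
  \<open>{a, c}\<close> and \<open>{b, d}\<close>, so the determinant splits into two
  blocks.\<close>

lemma pdet4:
  assumes "distinct [a, b, c, d]" "M a b = 0" "M a d = 0" "M b a = 0" "M b c = 0" "M c b = 0"
    "M c d = 0" "M d a = 0" "M d c = 0"
  shows "pdet {a, b, c, d} M = (M a a * M c c - M a c * M c a) * (M b b * M d d - M b d * M d b)"
proof -
  have "a \<noteq> b" "a \<noteq> c" "a \<noteq> d" "b \<noteq> c" "b \<noteq> d" "c \<noteq> d" "b \<noteq> a" "c \<noteq> a" "d \<noteq> a" "c \<noteq> b" "d \<noteq> b" "d \<noteq> c"
    using assms(1) by auto
  then show ?thesis
    using assms(2-) by (simp add: pdet_insert replace_col_def algebra_simps)
qed

text \<open>Opposite vertices are joined by two walks of length two, with signs \<open>p * q\<close>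
  and \<open>r * t\<close>, or \<open>p * t\<close> and \<open>q * r\<close>. They agree when the
  cycle sign is 1, giving an entry of absolute value 2, and cancel when it is -1.\<close>

lemma cycle4_charpoly:
  fixes E :: "'a::finite set set"
  assumes d: "distinct [a, b, c, d]" and U: "UNIV = {a, b, c, d}"
    and E: "E = {{a, b}, {b, c}, {c, d}, {d, a}}" and \<sigma>: "\<sigma> \<in> signings E"
  shows "\<sigma> {a, b} * \<sigma> {b, c} * \<sigma> {c, d} * \<sigma> {d, a} = 1 \<Longrightarrow>
      charpoly (signed_adj_sq E \<sigma>) = [:0, 1:] ^ 2 * [:- 4, 1:] ^ 2"
    and "\<sigma> {a, b} * \<sigma> {b, c} * \<sigma> {c, d} * \<sigma> {d, a} = - 1 \<Longrightarrow>
      charpoly (signed_adj_sq E \<sigma>) = [:- 2, 1:] ^ 4"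
proof -
  define p q r t where "p = \<sigma> {a, b}" "q = \<sigma> {b, c}" "r = \<sigma> {c, d}" "t = \<sigma> {d, a}"
  note defs = p_q_r_t_def
  have pm: "p \<in> {1, - 1}" "q \<in> {1, - 1}" "r \<in> {1, - 1}" "t \<in> {1, - 1}"
    using signings_values[OF \<sigma>] E unfolding defs by auto
  have ne: "a \<noteq> b" "a \<noteq> c" "a \<noteq> d" "b \<noteq> c" "b \<noteq> d" "c \<noteq> d" "b \<noteq> a" "c \<noteq> a" "d \<noteq> a" "c \<noteq> b" "d \<noteq> b" "d \<noteq> c"
    using d by auto
  let ?M = "signed_adj_sq E \<sigma>"
  have sum: "(\<Sum>k\<in>UNIV. f k) = f a + f b + f c + f d" for f :: "'a \<Rightarrow> real"
    using d by (simp add: U)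
  have A: "signed_adj E \<sigma> $ u $ v = (if {u, v} \<in> E then \<sigma> {u, v} else 0)" for u v
    by (simp add: signed_adj_def)
  have M: "?M $ u $ v = signed_adj E \<sigma> $ u $ a * signed_adj E \<sigma> $ a $ v + signed_adj E \<sigma> $ u $ b * signed_adj E \<sigma> $ b $ v
      + signed_adj E \<sigma> $ u $ c * signed_adj E \<sigma> $ c $ v + signed_adj E \<sigma> $ u $ d * signed_adj E \<sigma> $ d $ v" for u v
    unfolding signed_adj_sq_def matrix_matrix_mult_def by (simp only: vec_lambda_beta sum)
  have comm: "\<sigma> {b, a} = p" "\<sigma> {c, b} = q" "\<sigma> {d, c} = r" "\<sigma> {a, d} = t"
    "\<sigma> {a, b} = p" "\<sigma> {b, c} = q" "\<sigma> {c, d} = r" "\<sigma> {d, a} = t"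
    unfolding defs by (simp_all add: insert_commute)
  have Ent: "signed_adj E \<sigma> $ a $ a = 0" "signed_adj E \<sigma> $ a $ b = p" "signed_adj E \<sigma> $ a $ c = 0" "signed_adj E \<sigma> $ a $ d = t"
    "signed_adj E \<sigma> $ b $ a = p" "signed_adj E \<sigma> $ b $ b = 0" "signed_adj E \<sigma> $ b $ c = q" "signed_adj E \<sigma> $ b $ d = 0"
    "signed_adj E \<sigma> $ c $ a = 0" "signed_adj E \<sigma> $ c $ b = q" "signed_adj E \<sigma> $ c $ c = 0" "signed_adj E \<sigma> $ c $ d = r"
    "signed_adj E \<sigma> $ d $ a = t" "signed_adj E \<sigma> $ d $ b = 0" "signed_adj E \<sigma> $ d $ c = r" "signed_adj E \<sigma> $ d $ d = 0"
    using ne by (simp_all add: signed_adj_def E doubleton_eq_iff comm)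
  have sq: "p * p = 1" "q * q = 1" "r * r = 1" "t * t = 1" using pm by auto
  have Ment: "?M $ a $ a = 2" "?M $ b $ b = 2" "?M $ c $ c = 2" "?M $ d $ d = 2"
    "?M $ a $ b = 0" "?M $ b $ a = 0" "?M $ b $ c = 0" "?M $ c $ b = 0"
    "?M $ c $ d = 0" "?M $ d $ c = 0" "?M $ a $ d = 0" "?M $ d $ a = 0"
    "?M $ a $ c = p * q + r * t" "?M $ c $ a = p * q + r * t"
    "?M $ b $ d = p * t + q * r" "?M $ d $ b = p * t + q * r"
    by (simp_all only: M Ent sq mult_zero_left mult_zero_right) (simp_all add: mult.commute)
  have det: "poly (charpoly ?M) x = ((x - 2) * (x - 2) - (p * q + r * t)\<^sup>2) * ((x - 2) * (x - 2) - (p * t + q * r)\<^sup>2)" for x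
  proof -
    have "pdet UNIV (\<lambda>i j. (mat x - ?M) $ i $ j) =
        ((x - 2) * (x - 2) - (p * q + r * t)\<^sup>2) * ((x - 2) * (x - 2) - (p * t + q * r)\<^sup>2)"
      unfolding U by (subst pdet4[OF d]) (simp_all add: mat_def Ment ne power2_eq_square, simp add: algebra_simps)
    then show ?thesis by (simp add: poly_charpoly det_eq_pdet)
  qed
  show "charpoly ?M = [:0, 1:] ^ 2 * [:- 4, 1:] ^ 2" if "\<sigma> {a, b} * \<sigma> {b, c} * \<sigma> {c, d} * \<sigma> {d, a} = 1"
  proof -
    have "(p * q + r * t)\<^sup>2 = 4" "(p * t + q * r)\<^sup>2 = 4"
      using that pm unfolding comm by auto
    then have "poly (charpoly ?M) x = poly ([:0, 1:] ^ 2 * [:- 4, 1:] ^ 2) x" for x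
      unfolding det by (simp add: algebra_simps power2_eq_square)
    then show ?thesis by (simp add: poly_eq_poly_eq_iff[symmetric] fun_eq_iff)
  qed
  show "charpoly ?M = [:- 2, 1:] ^ 4" if "\<sigma> {a, b} * \<sigma> {b, c} * \<sigma> {c, d} * \<sigma> {d, a} = - 1"
  proof -
    have "(p * q + r * t)\<^sup>2 = 0" "(p * t + q * r)\<^sup>2 = 0"
      using that pm unfolding comm by auto
    then have "poly (charpoly ?M) x = poly ([:- 2, 1:] ^ 4) x" for x
      unfolding det by (simp add: algebra_simps power4_eq_xxxx)
    then show ?thesis by (simp add: poly_eq_poly_eq_iff[symmetric] fun_eq_iff)
  qed
qed

lemma map_poly_of_real_linear_power:
  "map_poly complex_of_real ([:r, 1:] ^ n) = [:complex_of_real r, 1:] ^ n"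
  by (induction n) (simp_all add: map_poly_of_real_mult map_poly_pCons del: mult_pCons_left)

text \<open>The product of the four signs is a complete invariant: a switch negates two edges of the
  cycle and preserves it, and \<open>cycle_gauge\<close> links any two signings with equal
  products.\<close>

lemma cycle4_switching:
  fixes E :: "'a::finite set set"
  assumes "is_cycle_graph E 4"
  shows "\<exists>S1 S2. switching_classes E = {S1, S2} \<and> S1 \<noteq> S2 \<and>
    (\<forall>\<sigma>\<in>S1. spectrum (signed_adj_sq E \<sigma>) = {#4, 4, 0, 0#}) \<and>
    (\<forall>\<sigma>\<in>S2. spectrum (signed_adj_sq E \<sigma>) = {#2, 2, 2, 2#})"
proof -
  obtain a b c d where d: "distinct [a, b, c, d]" and U: "UNIV = {a, b, c, d}"
    and E: "E = {{a, b}, {b, c}, {c, d}, {d, a}}" and cyc: "cycle_on [a, b, c, d] E"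
    and sgn: "\<And>\<sigma>. cycle_sign [a, b, c, d] \<sigma> = \<sigma> {a, b} * \<sigma> {b, c} * \<sigma> {c, d} * \<sigma> {d, a}"
    using is_cycle4E[OF assms] by blast
  define P where "P \<sigma> = \<sigma> {a, b} * \<sigma> {b, c} * \<sigma> {c, d} * \<sigma> {d, a}" for \<sigma> :: "'a set \<Rightarrow> real"
  have step: "switch_at E v \<sigma> \<in> signings E \<and> P (switch_at E v \<sigma>) = P \<sigma>" if "\<sigma> \<in> signings E" for v \<sigma>
  proof
    show "switch_at E v \<sigma> \<in> signings E"
      using that by (auto simp: signings_def switch_at_def PiE_iff)
    have "v \<in> {a, b, c, d}" using U by blast
    then show "P (switch_at E v \<sigma>) = P \<sigma>"
      using d by (auto simp: P_def switch_at_def E)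
  qed
  have class_eq: "(switch_rel E)\<^sup>* `` {\<sigma>} = {\<tau> \<in> signings E. P \<tau> = P \<sigma>}" if \<sigma>: "\<sigma> \<in> signings E" for \<sigma>
  proof (intro set_eqI iffI)
    fix \<tau> assume "\<tau> \<in> (switch_rel E)\<^sup>* `` {\<sigma>}"
    then have "(\<sigma>, \<tau>) \<in> (switch_rel E)\<^sup>*" by simp
    then show "\<tau> \<in> {\<tau> \<in> signings E. P \<tau> = P \<sigma>}"
      by (induction rule: rtrancl_induct) (use \<sigma> step in auto)
  next
    fix \<tau> assume \<tau>: "\<tau> \<in> {\<tau> \<in> signings E. P \<tau> = P \<sigma>}"
    have univ: "set [a, b, c, d] = UNIV" using U by simp
    have \<tau>': "\<tau> \<in> signings E" and sg: "cycle_sign [a, b, c, d] \<tau> = cycle_sign [a, b, c, d] \<sigma>"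
      using \<tau> by (simp_all add: sgn P_def)
    obtain s where "\<And>v. s v \<in> {1, - 1 :: real}" "\<And>u v. {u, v} \<in> E \<Longrightarrow> \<tau> {u, v} = s u * \<sigma> {u, v} * s v"
      using cycle_gauge[OF cyc univ signings_values[OF \<tau>'] signings_values[OF \<sigma>] sg] by blast
    then show "\<tau> \<in> (switch_rel E)\<^sup>* `` {\<sigma>}"
      using gauge_reachable[OF cycle_simple[OF cyc] \<sigma>, of \<tau> s] \<tau> by auto
  qed
  define S where "S c = {\<sigma> \<in> signings E. P \<sigma> = c}" for c
  have pm: "P \<sigma> \<in> {1, - 1}" if "\<sigma> \<in> signings E" for \<sigma>
    using signings_values[OF that, of "{a, b}"] signings_values[OF that, of "{b, c}"]
      signings_values[OF that, of "{c, d}"] signings_values[OF that, of "{d, a}"]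
    unfolding P_def E by auto
  define \<sigma>1 :: "'a set \<Rightarrow> real" where "\<sigma>1 = (\<lambda>e\<in>E. 1)"
  define \<sigma>2 :: "'a set \<Rightarrow> real" where "\<sigma>2 = (\<lambda>e\<in>E. if e = {a, b} then - 1 else 1)"
  have \<sigma>1: "\<sigma>1 \<in> signings E" "P \<sigma>1 = 1"
    by (auto simp: \<sigma>1_def signings_def P_def E)
  have \<sigma>2: "\<sigma>2 \<in> signings E" "P \<sigma>2 = - 1"
    using d by (auto simp: \<sigma>2_def signings_def P_def E doubleton_eq_iff)
  have "switching_classes E = (\<lambda>\<sigma>. (switch_rel E)\<^sup>* `` {\<sigma>}) ` signings E"
    by (auto simp: switching_classes_def quotient_def)
  also have "\<dots> = (\<lambda>\<sigma>. S (P \<sigma>)) ` signings E"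
    using class_eq by (intro image_cong) (auto simp: S_def)
  also have "\<dots> = {S 1, S (- 1)}"
    using pm \<sigma>1 \<sigma>2 by (auto simp: image_iff) (metis)+
  finally have "switching_classes E = {S 1, S (- 1)}" .
  moreover have "S 1 \<noteq> S (- 1)" using \<sigma>1 by (auto simp: S_def)
  moreover have "spectrum (signed_adj_sq E \<sigma>) = {#4, 4, 0, 0#}" if "\<sigma> \<in> S 1" for \<sigma>
  proof -
    have "charpoly (signed_adj_sq E \<sigma>) = [:0, 1:] ^ 2 * [:- 4, 1:] ^ 2"
      using cycle4_charpoly(1)[OF d U E, of \<sigma>] that by (simp add: S_def P_def)
    then have "spectrum (signed_adj_sq E \<sigma>) = proots ([:0, 1:] ^ 2 * [:- 4, 1:] ^ 2)"
      unfolding spectrum_def by (simp only: map_poly_of_real_mult map_poly_of_real_linear_power) simp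
    also have "\<dots> = repeat_mset 2 {#0#} + repeat_mset 2 {#4#}"
      by (subst proots_mult) (simp_all only: proots_power proots_linear_factor, simp_all)
    finally show ?thesis by (simp add: numeral_2_eq_2)
  qed
  moreover have "spectrum (signed_adj_sq E \<sigma>) = {#2, 2, 2, 2#}" if "\<sigma> \<in> S (- 1)" for \<sigma>
  proof -
    have "charpoly (signed_adj_sq E \<sigma>) = [:- 2, 1:] ^ 4"
      using cycle4_charpoly(2)[OF d U E, of \<sigma>] that by (simp add: S_def P_def)
    then have "spectrum (signed_adj_sq E \<sigma>) = proots ([:- 2, 1:] ^ 4)"
      unfolding spectrum_def by (simp only: map_poly_of_real_linear_power) simp
    also have "\<dots> = repeat_mset 4 {#2#}"
      by (simp only: proots_power proots_linear_factor) simp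
    also have "\<dots> = {#2, 2, 2, 2#}"
      by (rule multiset_eqI) simp
    finally show ?thesis .
  qed
  ultimately show ?thesis by blast
qed

section \<open>Quadrilaterals of the complete graph on four vertices\<close>

lemma is_K4E:
  fixes E :: "'a::finite set set"
  assumes "is_K4 E"
  obtains a b c d where "distinct [a, b, c, d]" "UNIV = {a, b, c, d}"
    "E = {{a, b}, {a, c}, {a, d}, {b, c}, {b, d}, {c, d}}"
proof -
  obtain vs where vs: "set vs = (UNIV :: 'a set)" "distinct vs"
    using finite_distinct_list[OF finite] by blast
  then have "length vs = 4" using assms distinct_card[OF vs(2)] by (simp add: is_K4_def)
  from length4E[OF this] obtain a b c d where abcd: "vs = [a, b, c, d]" .
  have U: "UNIV = {a, b, c, d}" using vs abcd by simp
  have "e \<in> E \<longleftrightarrow> e \<in> {{a, b}, {a, c}, {a, d}, {b, c}, {b, d}, {c, d}}" for e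
  proof
    assume "e \<in> E"
    then have "card e = 2" using assms by (simp add: is_K4_def)
    then obtain u v where e: "e = {u, v}" "u \<noteq> v" by (meson card_2_iff)
    have "u \<in> {a, b, c, d}" "v \<in> {a, b, c, d}" using U by blast+
    then show "e \<in> {{a, b}, {a, c}, {a, d}, {b, c}, {b, d}, {c, d}}"
      using e by (auto simp: doubleton_eq_iff)
  next
    assume "e \<in> {{a, b}, {a, c}, {a, d}, {b, c}, {b, d}, {c, d}}"
    then show "e \<in> E" using assms vs(2) abcd by (auto simp: is_K4_def)
  qed
  then have E: "E = {{a, b}, {a, c}, {a, d}, {b, c}, {b, d}, {c, d}}" by (rule set_eqI)
  have "distinct [a, b, c, d]" using vs(2) unfolding abcd .
  from that[OF this U E] show thesis .
qed

lemma four_cycle_reverse: "{{p, q}, {q, r}, {r, s}, {s, p}} = {{p, s}, {s, r}, {r, q}, {q, p}}"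
  by (auto simp: doubleton_eq_iff)

text \<open>A 4-cycle can be listed starting from \<open>a\<close>, which leaves six orders of
  \<open>b\<close>, \<open>c\<close>, \<open>d\<close>; reversal identifies them in pairs.\<close>

lemma K4_four_cycles:
  fixes E :: "'a::finite set set"
  assumes "is_K4 E"
  shows "card (cycle_subgraphs E 4) = 3"
proof -
  obtain a b c d where d: "distinct [a, b, c, d]" and U: "UNIV = {a, b, c, d}"
    and E: "E = {{a, b}, {a, c}, {a, d}, {b, c}, {b, d}, {c, d}}"
    by (rule is_K4E[OF assms])
  have cyc: "cycle_on [p, q, r, s] F \<longleftrightarrow> distinct [p, q, r, s] \<and> F = {{p, q}, {q, r}, {r, s}, {s, p}}"
    for p q r s :: 'a and F
  proof -
    have "length [p, q, r, s] = 4" by simp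
    then show ?thesis unfolding cycle_on_alt by (simp only: cycle_edge_list4) simp
  qed
  let ?F1 = "{{a, b}, {b, c}, {c, d}, {d, a}}"
  let ?F2 = "{{a, b}, {b, d}, {d, c}, {c, a}}"
  let ?F3 = "{{a, c}, {c, b}, {b, d}, {d, a}}"
  have "cycle_subgraphs E 4 = {F. \<exists>p q r s. distinct [p, q, r, s] \<and> F = {{p, q}, {q, r}, {r, s}, {s, p}}}"
  proof -
    have all: "e \<in> E" if "card e = 2" for e using assms that by (simp add: is_K4_def)
    have "F \<subseteq> E" if "distinct [p, q, r, s]" "F = {{p, q}, {q, r}, {r, s}, {s, p}}" for F p q r s
      using that by (auto intro!: all)
    then have sub: "F \<in> cycle_subgraphs E 4" if "distinct [p, q, r, s]" "F = {{p, q}, {q, r}, {r, s}, {s, p}}" for F p q r s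
      unfolding cycle_subgraphs_def using that cyc by (intro CollectI conjI exI[of _ "[p, q, r, s]"]) auto
    have sup: "\<exists>p q r s. distinct [p, q, r, s] \<and> F = {{p, q}, {q, r}, {r, s}, {s, p}}"
      if F: "F \<in> cycle_subgraphs E 4" for F
    proof -
      obtain vs where vs: "length vs = 4" "cycle_on vs F" using F by (auto simp: cycle_subgraphs_def)
      obtain p q r s where pqrs: "vs = [p, q, r, s]" using length4E[OF vs(1)] .
      have "distinct [p, q, r, s] \<and> F = {{p, q}, {q, r}, {r, s}, {s, p}}"
        using vs(2) unfolding pqrs cyc .
      then show ?thesis by (intro exI)
    qed
    show ?thesis
      by (intro set_eqI iffI CollectI sup) (assumption, elim CollectE exE conjE, rule sub)
  qed
  also have "\<dots> = {?F1, ?F2, ?F3}"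
  proof (intro set_eqI iffI)
    fix F :: "'a set set" assume "F \<in> {F. \<exists>p q r s. distinct [p, q, r, s] \<and> F = {{p, q}, {q, r}, {r, s}, {s, p}}}"
    then obtain p q r s where F: "distinct [p, q, r, s]" "F = {{p, q}, {q, r}, {r, s}, {s, p}}" by blast
    have "card (set [p, q, r, s]) = CARD('a)"
      using F(1) assms distinct_card[OF F(1)] by (simp add: is_K4_def)
    then have "set [p, q, r, s] = UNIV" by (intro card_subset_eq) auto
    then have "a \<in> {p, q, r, s}" by auto
    then obtain q' r' s' where F': "distinct [a, q', r', s']" "F = {{a, q'}, {q', r'}, {r', s'}, {s', a}}"
    proof (elim insertE emptyE)
      assume "a = p"
      then show thesis using F by (intro that) auto
    next
      assume "a = q"
      then show thesis using F by (intro that[of r s p]) auto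
    next
      assume "a = r"
      then show thesis using F by (intro that[of s p q]) auto
    next
      assume "a = s"
      then show thesis using F by (intro that[of p q r]) auto
    qed
    have "q' \<in> {b, c, d}" "r' \<in> {b, c, d}" "s' \<in> {b, c, d}" using U F'(1) by auto
    then consider "q' = b" "r' = c" "s' = d" | "q' = d" "r' = c" "s' = b" | "q' = b" "r' = d" "s' = c" |
      "q' = c" "r' = d" "s' = b" | "q' = c" "r' = b" "s' = d" | "q' = d" "r' = b" "s' = c"
      using F'(1) by auto
    then have "F = ?F1 \<or> F = ?F2 \<or> F = ?F3"
      unfolding F'(2)
      using four_cycle_reverse[of a b c d] four_cycle_reverse[of a b d c] four_cycle_reverse[of a c b d]
      by cases simp_all
    then show "F \<in> {?F1, ?F2, ?F3}" by simp
  next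
    fix F :: "'a set set" assume "F \<in> {?F1, ?F2, ?F3}"
    then show "F \<in> {F. \<exists>p q r s. distinct [p, q, r, s] \<and> F = {{p, q}, {q, r}, {r, s}, {s, p}}}"
    proof (elim insertE emptyE)
      assume "F = ?F1"
      then show ?thesis using d by blast
    next
      assume "F = ?F2"
      moreover have "distinct [a, b, d, c]" using d by auto
      ultimately show ?thesis by blast
    next
      assume "F = ?F3"
      moreover have "distinct [a, c, b, d]" using d by auto
      ultimately show ?thesis by blast
    qed
  qed
  also have "card {?F1, ?F2, ?F3} = 3"
  proof -
    \<comment> \<open>The edge \<open>{c, d}\<close> separates the third cycle from the first two,
      and \<open>{b, c}\<close> separates those from each other.\<close>
    have m: "{c, d} \<in> ?F1" "{c, d} \<in> ?F2" "{c, d} \<notin> ?F3" "{b, c} \<in> ?F1" "{b, c} \<notin> ?F2"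
      using d by (auto simp: doubleton_eq_iff)
    have ne: "A \<noteq> B" if "x \<in> A" "x \<notin> B" for x :: "'a set" and A B using that by blast
    have "card {A, B, C} = 3" if "A \<noteq> B" "A \<noteq> C" "B \<noteq> C" for A B C :: "'a set set"
      using that by simp
    then show ?thesis using ne[OF m(4,5)] ne[OF m(1,3)] ne[OF m(2,3)] .
  qed
  finally show ?thesis .
qed

section \<open>The computed cases\<close>

text \<open>Pulling the list \<open>L\<close> back along the isomorphism keeps the positions, so the
  same index pairs describe \<open>E\<close>.\<close>

lemma graph_iso_graph_on:
  fixes E :: "'a::finite set set"
  assumes iso: "graph_iso E V F" and L: "distinct L" "set L = V" "proper_edges (length L) es" "graph_on L es = F"
  obtains vs where "distinct vs" "set vs = UNIV" "length vs = length L" "E = graph_on vs es"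
proof -
  obtain f where f: "bij_betw f UNIV V" "(\<lambda>e. f ` e) ` E = F" using iso by (auto simp: graph_iso_def)
  define g where "g = inv_into UNIV f"
  have gf: "g (f x) = x" for x using f(1) by (simp add: g_def bij_betw_def)
  have g: "bij_betw g V UNIV" unfolding g_def by (rule bij_betw_inv_into[OF f(1)])
  show thesis
  proof (rule that)
    show "distinct (map g L)" using g L(1,2) by (auto simp: distinct_map bij_betw_def)
    show "set (map g L) = UNIV" using g L(2) by (simp add: bij_betw_def)
    have "E = (\<lambda>e. g ` e) ` F"
      unfolding f(2)[symmetric] image_image by (simp add: gf)
    also have "\<dots> = graph_on (map g L) es"
      using L(3) unfolding L(4)[symmetric] graph_on_def image_image
      by (intro image_cong) (auto simp: proper_edges_def)
    finally show "E = graph_on (map g L) es" .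
  qed simp
qed

definition settled_graph :: "'a::finite set set \<Rightarrow> bool" where
  "settled_graph E \<longleftrightarrow> (\<exists>vs es d. distinct vs \<and> set vs = UNIV \<and> E = graph_on vs es \<and> settled (length vs) es d)"

lemma settled_graphI:
  "distinct vs \<Longrightarrow> set vs = UNIV \<Longrightarrow> E = graph_on vs es \<Longrightarrow> settled (length vs) es d \<Longrightarrow> settled_graph E"
  unfolding settled_graph_def by blast

lemma settled_iso:
  fixes E :: "'a::finite set set"
  assumes "graph_iso E V F" "distinct L" "set L = V" "graph_on L es = F" "settled (length L) es d"
  shows "settled_graph E"
proof -
  have "proper_edges (length L) es" using assms(5) by (simp add: settled_def)
  then obtain vs where "distinct vs" "set vs = UNIV" "length vs = length L" "E = graph_on vs es"
    using graph_iso_graph_on[OF assms(1-3) _ assms(4)] by blast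
  then show ?thesis using assms(5) by (intro settled_graphI) auto
qed

lemma settled_K33_graph:
  assumes "is_K33 (E :: 'a::finite set set)"
  shows "settled_graph E"
proof (rule settled_iso[where L = "[0, 1, 2, 3, 4, 5]"])
  show "graph_iso E {..<6::nat} {{i, j} | i j. i < 3 \<and> 3 \<le> j \<and> j < 6}" using assms by (simp add: is_K33_def)
  show "set [0, 1, 2, 3, 4, 5 :: nat] = {..<6}" by auto
  have "{{i, j} | i j. i < 3 \<and> 3 \<le> j \<and> j < (6::nat)} = (\<lambda>(i, j). {i, j}) ` ({..<3} \<times> {3..<6})"
    by (auto simp: image_iff) blast+
  also have "\<dots> = graph_on [0, 1, 2, 3, 4, 5] (complement_edges 6 (two_cycles 3 3))" by code_simp
  finally show "graph_on [0, 1, 2, 3, 4, 5] (complement_edges 6 (two_cycles 3 3)) = {{i, j} | i j. i < 3 \<and> 3 \<le> j \<and> j < (6::nat)}" ..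
  have "length [0, 1, 2, 3, 4, 5 :: nat] = 6" by simp
  then show "settled (length [0, 1, 2, 3, 4, 5 :: nat]) (complement_edges 6 (two_cycles 3 3)) 3"
    using settled_K33 by (simp only:)
qed simp

lemma settled_cube_graph:
  assumes "is_cube (E :: 'a::finite set set)"
  shows "settled_graph E"
proof -
  let ?L = "[{}, {0}, {1}, {0, 1}, {2}, {0, 2}, {1, 2}, {0, 1, 2 :: nat}]"
  let ?es = "[(0, 1), (0, 2), (0, 4), (1, 3), (1, 5), (2, 3), (2, 6), (3, 7), (4, 5), (4, 6), (5, 7), (6, 7)]"
  have V: "set ?L = Pow {..<3}" by code_simp
  have "{{A, B} | A B. A \<subseteq> {..<3} \<and> B \<subseteq> {..<3::nat} \<and> card ((A - B) \<union> (B - A)) = 1} =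
      (\<lambda>(A, B). {A, B}) ` Set.filter (\<lambda>(A, B). card ((A - B) \<union> (B - A)) = 1) (set ?L \<times> set ?L)"
    unfolding V by (auto simp: image_iff)
  also have "\<dots> = graph_on ?L ?es" by code_simp
  finally have F: "graph_on ?L ?es = {{A, B} | A B. A \<subseteq> {..<3} \<and> B \<subseteq> {..<3::nat} \<and> card ((A - B) \<union> (B - A)) = 1}" ..
  have "distinct ?L" by code_simp
  moreover have "length ?L = 8" by simp
  then have "settled (length ?L) ?es 3" using settled_cube by (simp only:)
  ultimately show ?thesis
    using assms settled_iso[OF _ _ V F, of E] by (simp add: is_cube_def)
qed

lemma settled_petersen_graph:
  assumes "is_petersen (E :: 'a::finite set set)"
  shows "settled_graph E"
proof -
  let ?L = "[{0, 1}, {0, 2}, {0, 3}, {0, 4}, {1, 2}, {1, 3}, {1, 4}, {2, 3}, {2, 4}, {3, 4 :: nat}]"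
  let ?es = "[(0, 7), (0, 8), (0, 9), (1, 5), (1, 6), (1, 9), (2, 4), (2, 6), (2, 8), (3, 4), (3, 5), (3, 7), (4, 9), (5, 8), (6, 7)]"
  have "{A. A \<subseteq> {..<5::nat} \<and> card A = 2} = Set.filter (\<lambda>A. card A = 2) (Pow {..<5})" by auto
  also have "\<dots> = set ?L" by code_simp
  finally have V: "set ?L = {A. A \<subseteq> {..<5} \<and> card A = 2}" ..
  have "{{A, B} | A B. A \<subseteq> {..<5} \<and> card A = 2 \<and> B \<subseteq> {..<5::nat} \<and> card B = 2 \<and> A \<inter> B = {}} =
      (\<lambda>(A, B). {A, B}) ` Set.filter (\<lambda>(A, B). A \<inter> B = {}) (set ?L \<times> set ?L)"
    unfolding V by (auto simp: image_iff)
  also have "\<dots> = graph_on ?L ?es" by code_simp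
  finally have F: "graph_on ?L ?es =
    {{A, B} | A B. A \<subseteq> {..<5} \<and> card A = 2 \<and> B \<subseteq> {..<5::nat} \<and> card B = 2 \<and> A \<inter> B = {}}" ..
  have "distinct ?L" by code_simp
  moreover have "length ?L = 10" by simp
  then have "settled (length ?L) ?es 3" using settled_petersen by (simp only:)
  ultimately show ?thesis
    using assms settled_iso[OF _ _ V F, of E] by (simp add: is_petersen_def)
qed

text \<open>Parity excludes \<open>(d, N)\<close> equal to \<open>(3, 5)\<close>,
  \<open>(3, 7)\<close> and \<open>(5, 7)\<close>. Every surviving degree is 2 or has complementary
  degree \<open>N - 1 - d\<close> at most 2.\<close>

lemma small_regular_degrees:
  fixes N d :: nat
  assumes "2 \<le> d" "d < N" "N \<le> 7" "even (d * N)"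
  shows "d = 2 \<or> d = N - 1 \<and> 4 \<le> N \<or> N = 6 \<and> d = 4 \<or> N = 6 \<and> d = 3 \<or> N = 7 \<and> d = 4"
proof -
  have "d \<in> {2, 3, 4, 5, 6}" "N \<in> {3, 4, 5, 6, 7}" using assms by auto
  then show ?thesis using assms by auto
qed

lemma small_regular_classification:
  fixes E :: "'a::finite set set"
  assumes E: "simple_graph E" "connected_graph E" "regular_graph E d" "2 \<le> d" "CARD('a) \<le> 7"
  shows "is_odd_cycle_graph E \<or> is_K4 E \<or> settled_graph E"
proof -
  let ?C = "complement_graph E"
  obtain vs where vs: "distinct vs" "set vs = (UNIV :: 'a set)"
    using finite_distinct_list[OF finite] by metis
  have len: "length vs = CARD('a)" if "distinct vs" "set vs = (UNIV :: 'a set)" for vs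
    using distinct_card[OF that(1)] that(2) by simp
  have compl: "d < CARD('a)" "regular_graph ?C (CARD('a) - 1 - d)" using regular_complement E by blast+
  consider "d = 2" | "d = CARD('a) - 1" "4 \<le> CARD('a)" | "CARD('a) = 6" "d = 4" | "CARD('a) = 6" "d = 3" | "CARD('a) = 7" "d = 4"
    using small_regular_degrees[OF E(4) compl(1) E(5) even_degree_sum[OF E(1,3)]] by blast
  then show ?thesis
  proof cases
    case 1
    \<comment> \<open>Connectivity leaves a single cycle.\<close>
    then obtain p where p: "cycle_on p E" "set p = UNIV" using connected_two_regular E by blast
    have p': "3 \<le> length p" "distinct p" "E = graph_on p (cycle_edges (length p))"
      using p(1) graph_on_cycle_edges[of p] by (auto simp: cycle_on_alt)
    have "length p \<le> 7" using len[OF p'(2) p(2)] E(5) by simp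
    then consider "odd (length p)" | "length p = 4" | "length p = 6" using p'(1) by fastforce
    then show ?thesis
    proof cases
      case 1
      then show ?thesis using p by (auto simp: is_odd_cycle_graph_def is_cycle_graph_def)
    next
      case 2
      then show ?thesis using settled_graphI[OF p'(2) p(2) p'(3)] settled_C4 by simp
    next
      case 3
      then show ?thesis using settled_graphI[OF p'(2) p(2) p'(3)] settled_C6 by simp
    qed
  next
    case 2
    have "neighbours ?C u = {}" for u
      using compl(2) 2 by (simp add: regular_graph_def)
    then have C: "?C = {}"
      using simple_complement[of E] by (fastforce simp: simple_graph_def card_2_iff)
    have g: "E = graph_on vs (complete_edges (length vs))" using graph_on_complete[OF vs C E(1)] .
    consider "CARD('a) = 4" | "CARD('a) = 5" | "CARD('a) = 6" | "CARD('a) = 7" using 2 E(5) by linarith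
    then show ?thesis
    proof cases
      case 1
      have "E = {e. card e = 2}" using C E(1) by (auto simp: complement_graph_def simple_graph_def)
      then show ?thesis using 1 by (simp add: is_K4_def)
    qed (use settled_graphI[OF vs g] settled_K5 settled_K6 settled_K7 len[OF vs] in auto)
  next
    case 3
    then have "regular_graph ?C 1" using compl(2) by simp
    from perfect_matching_six[OF simple_complement this 3(1)] obtain ws where
      ws: "distinct ws" "set ws = UNIV" "length ws = 6" "?C = graph_on ws [(0, 1), (2, 3), (4, 5)]" .
    have "proper_edges 6 [(0, 1), (2, 3), (4, 5)]" by code_simp
    then show ?thesis
      using graph_on_complement[OF ws(1,2) E(1) _ ws(4)] settled_graphI[OF ws(1,2) _, of E _ 4] settled_octahedron ws(3) by simp
  next
    case 4
    \<comment> \<open>The complement is a hexagon, giving the prism, or two triangles, giving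
      \<open>K_{3,3}\<close>.\<close>
    then have "regular_graph ?C 2" using compl(2) by (simp add: numeral_2_eq_2)
    from two_regular_small[OF simple_complement this E(5)] show ?thesis
    proof cases
      case (1 p)
      have "length p = 6" using len[OF 1(1,2)] 4 by simp
      then show ?thesis
        using graph_on_complement[OF 1(1,2) E(1) proper_cycle_edges 1(3)] settled_graphI[OF 1(1,2) _, of E _ 3] settled_prism by simp
    next
      case (2 p)
      have "proper_edges 6 (two_cycles 3 3)" by code_simp
      then show ?thesis
        using graph_on_complement[OF 2(1,2) E(1) _ 2(4)] settled_graphI[OF 2(1,2) _, of E _ 3] settled_K33 2(3) by simp
    next
      case (3 p)
      then show ?thesis using len[OF 3(1,2)] 4 by simp
    qed
  next
    case 5
    then have "regular_graph ?C 2" using compl(2) by simp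
    from two_regular_small[OF simple_complement this E(5)] show ?thesis
    proof cases
      case (1 p)
      have "length p = 7" using len[OF 1(1,2)] 5 by simp
      then show ?thesis
        using graph_on_complement[OF 1(1,2) E(1) proper_cycle_edges 1(3)] settled_graphI[OF 1(1,2) _, of E _ 4] settled_complement_C7 by simp
    next
      case (2 p)
      then show ?thesis using len[OF 2(1,2)] 5 by simp
    next
      case (3 p)
      have "proper_edges 7 (two_cycles 3 4)" by code_simp
      then show ?thesis
        using graph_on_complement[OF 3(1,2) E(1) _ 3(4)] settled_graphI[OF 3(1,2) _, of E _ 4] settled_complement_C3_C4 3(3) by simp
    qed
  qed
qed

lemma computed_case_classification:
  fixes E :: "'a::finite set set"
  assumes "computed_case E"
  shows "is_odd_cycle_graph E \<or> is_K4 E \<or> settled_graph E"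
  using assms small_regular_classification settled_K33_graph settled_cube_graph settled_petersen_graph
  unfolding computed_case_def by metis

lemma settled_graph_correct:
  fixes E :: "'a::finite set set"
  assumes "settled_graph E"
  shows "\<not> real_rooted (q_poly E)"
    and "regular_graph E d \<Longrightarrow> poly (map_poly complex_of_real (q_poly E)) z = 0 \<Longrightarrow> Re z \<le> 4 * (real d - 1)"
  using assms settled_correct unfolding settled_graph_def by blast+

lemma is_cycle_graph_on:
  assumes "is_cycle_graph E n"
  obtains vs where "length vs = n" "3 \<le> n" "distinct vs" "set vs = UNIV" "E = graph_on vs (cycle_edges n)"
proof -
  obtain vs where "length vs = n" "set vs = UNIV" "cycle_on vs E"
    using assms by (auto simp: is_cycle_graph_def)
  then show thesis using that[of vs] graph_on_cycle_edges[of vs] by (auto simp: cycle_on_alt)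
qed

text \<open>Every degree is at least 2, and the degrees sum to twice the number of edges. There are
  at most as many edges as vertices, so no degree exceeds 2.\<close>

lemma cycle_graph_regular:
  fixes E :: "'a::finite set set"
  assumes "is_cycle_graph E n"
  shows "regular_graph E 2"
proof -
  obtain vs where vs: "length vs = n" "set vs = UNIV" "cycle_on vs E"
    using assms by (auto simp: is_cycle_graph_def)
  have n: "3 \<le> length vs" "distinct vs" and E: "E = cycle_edge vs ` {..<length vs}"
    using vs(3) by (auto simp: cycle_on_alt)
  have deg: "2 \<le> card (neighbours E v)" for v
    using cycle_degree_ge[OF vs(3), of v] vs(2) by simp
  have "(\<Sum>v\<in>UNIV. card (neighbours E v)) = 2 * card E"
    by (rule degree_sum[OF cycle_simple[OF vs(3)]])
  also have "card E \<le> length vs"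
    unfolding E using card_image_le[of "{..<length vs}" "cycle_edge vs"] by simp
  also have "length vs = CARD('a)" using distinct_card[OF n(2)] vs(2) by simp
  finally have le: "(\<Sum>v\<in>UNIV. card (neighbours E v)) \<le> (\<Sum>v\<in>(UNIV :: 'a set). 2)" by simp
  have "card (neighbours E v) = 2" for v
  proof (rule ccontr)
    assume "card (neighbours E v) \<noteq> 2"
    then have "2 < card (neighbours E v)" using deg[of v] by simp
    then have "(\<Sum>v\<in>(UNIV :: 'a set). 2) < (\<Sum>v\<in>UNIV. card (neighbours E v))"
      by (intro sum_strict_mono_ex1) (use deg in auto)
    then show False using le by simp
  qed
  then show ?thesis by (simp add: regular_graph_def)
qed

text \<open>For \<open>d = 2\<close> the row-sum bound \<open>d^2\<close> is exactly
  \<open>4 * (d - 1)\<close>.\<close>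

lemma odd_cycle_correct:
  fixes E :: "'a::finite set set"
  assumes "is_odd_cycle_graph E"
  shows "real_rooted (q_poly E)"
    and "regular_graph E d \<Longrightarrow> poly (map_poly complex_of_real (q_poly E)) z = 0 \<Longrightarrow> Re z \<le> 4 * (real d - 1)"
proof -
  have reg: "regular_graph E 2"
    using assms cycle_graph_regular by (auto simp: is_odd_cycle_graph_def)
  show "real_rooted (q_poly E)"
    using odd_cycle_roots(1)[OF assms reg] by (simp add: real_rooted_def)
  assume "regular_graph E d" "poly (map_poly complex_of_real (q_poly E)) z = 0"
  moreover from this have "d = 2" using reg by (simp add: regular_graph_def)
  ultimately show "Re z \<le> 4 * (real d - 1)"
    using odd_cycle_roots(2)[OF assms reg, of z] by simp
qed

lemma K4_q_poly:
  fixes E :: "'a::finite set set"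
  assumes "is_K4 E"
  shows "q_poly E = [:21, - 52, 42, - 12, 1:]" and "regular_graph E d \<Longrightarrow> d = 3"
proof -
  obtain vs where vs: "distinct vs" "set vs = (UNIV :: 'a set)"
    using finite_distinct_list[OF finite] by metis
  then have len: "length vs = 4" using distinct_card[OF vs(1)] assms by (simp add: is_K4_def)
  have K: "E = {e. card e = 2}" using assms unfolding is_K4_def ..
  have "complement_graph E = {}" "simple_graph E"
    unfolding K by (simp_all add: complement_graph_def simple_graph_def)
  then have E: "E = graph_on vs (complete_edges 4)"
    using graph_on_complete[OF vs] unfolding len by blast
  have es: "proper_edges (length vs) (complete_edges 4)" unfolding len by code_simp
  have "average_list 4 (complete_edges 4) = [21, - 52, 42, - 12, 1]" by code_simp
  then show "q_poly E = [:21, - 52, 42, - 12, 1:]"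
    using q_poly_graph_on[OF vs es] by (simp add: E len)
  have "degree_zero (complete_edges 4) = 3" by code_simp
  then show "d = 3" if "regular_graph E d"
    using degree_graph_on[OF vs es, of d] that len unfolding E by simp
qed

text \<open>The quartic factors as \<open>(z - 1)^2 (z - 3) (z - 7)\<close>; its largest root 7
  stays below the bound 8 for degree 3.\<close>

lemma K4_roots:
  assumes "is_K4 (E :: 'a::finite set set)" "poly (map_poly complex_of_real (q_poly E)) z = 0"
  shows "z \<in> {1, 3, 7}"
proof -
  have "poly (map_poly complex_of_real (q_poly E)) z = (z - 1)\<^sup>2 * (z - 3) * (z - 7)"
    unfolding K4_q_poly[OF assms(1)] by (simp add: map_poly_pCons algebra_simps power2_eq_square)
  then show ?thesis using assms(2) by auto
qed

lemma K4_correct: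
  fixes E :: "'a::finite set set"
  assumes "is_K4 E"
  shows "real_rooted (q_poly E)"
    and "regular_graph E d \<Longrightarrow> poly (map_poly complex_of_real (q_poly E)) z = 0 \<Longrightarrow> Re z \<le> 4 * (real d - 1)"
proof -
  show "real_rooted (q_poly E)"
    using K4_roots[OF assms] unfolding real_rooted_def by fastforce
  show "Re z \<le> 4 * (real d - 1)" if "regular_graph E d" "poly (map_poly complex_of_real (q_poly E)) z = 0"
    using K4_roots[OF assms that(2)] K4_q_poly(2)[OF assms that(1)] by auto
qed

lemma cycle4_q_poly:
  fixes E :: "'a::finite set set"
  assumes "is_cycle_graph E 4"
  shows "q_poly E = [:8, - 16, 20, - 8, 1:]" and "\<not> real_rooted (q_poly E)"
proof -
  obtain vs where vs: "length vs = 4" "distinct vs" "set vs = UNIV" and E: "E = graph_on vs (cycle_edges 4)"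
    using is_cycle_graph_on[OF assms] by metis
  have es: "proper_edges (length vs) (cycle_edges 4)" unfolding vs(1) by code_simp
  have "average_list 4 (cycle_edges 4) = [8, - 16, 20, - 8, 1]" by code_simp
  then show "q_poly E = [:8, - 16, 20, - 8, 1:]"
    using q_poly_graph_on[OF vs(2,3) es] by (simp add: E vs(1))
  show "\<not> real_rooted (q_poly E)"
    using settled_correct(1)[of vs "cycle_edges 4" 2] settled_C4 vs unfolding E by simp
qed

lemma exists_cycle4: "\<exists>E :: 4 set set. simple_graph E \<and> is_cycle_graph E 4"
proof -
  obtain vs where vs: "distinct vs" "set vs = (UNIV :: 4 set)"
    using finite_distinct_list[OF finite] by metis
  have "length vs = 4" using distinct_card[OF vs(1)] vs(2) by simp
  then have "cycle_on vs (cycle_edge vs ` {..<length vs})"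
    using vs(1) by (simp add: cycle_on_alt)
  then show ?thesis
    using cycle_simple \<open>length vs = 4\<close> vs(2) unfolding is_cycle_graph_def by blast
qed

theorem mainTheorem13:
  defines "X \<equiv> ([:0, 1:] :: real poly)"
  shows
    "(\<exists>E :: 4 set set. simple_graph E \<and> \<not> real_rooted (q_poly E)) \<and>
     (\<forall>E :: 'a::finite set set. is_cycle_graph E 4 \<longrightarrow>
        (\<exists>S1 S2. switching_classes E = {S1, S2} \<and> S1 \<noteq> S2 \<and>
           (\<forall>\<sigma>\<in>S1. spectrum (signed_adj_sq E \<sigma>) = {#4, 4, 0, 0#}) \<and>
           (\<forall>\<sigma>\<in>S2. spectrum (signed_adj_sq E \<sigma>) = {#2, 2, 2, 2#})) \<and>
        q_poly E = smult (1 / 2) (X ^ 2 * (X - 4) ^ 2 + (X - 2) ^ 4) \<and>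
        q_poly E = X ^ 4 - 8 * X ^ 3 + 20 * X ^ 2 - 16 * X + 8 \<and>
        q_poly E = (X ^ 2 - 4 * X + 2) ^ 2 + 4 \<and>
        (\<forall>x :: real. poly (q_poly E) x \<noteq> 0)) \<and>
     (\<forall>E :: 'a set set. computed_case E \<longrightarrow>
        (real_rooted (q_poly E) \<longleftrightarrow> is_odd_cycle_graph E \<or> is_K4 E)) \<and>
     (\<forall>E :: 'a set set. is_odd_cycle_graph E \<longrightarrow>
        (\<forall>\<sigma>\<in>signings E. \<forall>\<tau>\<in>signings E.
           (\<exists>s :: 'a \<Rightarrow> real. (\<forall>v. s v \<in> {1, - 1}) \<and>
              (\<forall>u v. signed_adj_sq E \<sigma> $ u $ v = s u * signed_adj_sq E \<tau> $ u $ v * s v)) \<and>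
           charpoly (signed_adj_sq E \<sigma>) = charpoly (signed_adj_sq E \<tau>))) \<and>
     (\<forall>E :: 'a set set. is_K4 E \<longrightarrow>
        q_poly E = X ^ 4 - 12 * X ^ 3 + 42 * X ^ 2 - 52 * X + 21 \<and>
        real_rooted (q_poly E) \<and>
        card (cycle_subgraphs E 4) = 3) \<and>
     \<not> (\<forall>E :: 4 set set. simple_graph E \<longrightarrow>
          (real_rooted (q_poly E) \<longleftrightarrow> \<not> contains_even_cycle E)) \<and>
     (\<forall>(E :: 'a set set) d. computed_case E \<and> regular_graph E d \<longrightarrow>
        (\<forall>z :: complex. poly (map_poly complex_of_real (q_poly E)) z = 0 \<longrightarrow>
           Re z \<le> 4 * (real d - 1)))"
proof (intro conjI)
  note poly_eq = poly_eq_poly_eq_iff[symmetric] fun_eq_iff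
  have pX: "poly X x = x" for x by (simp add: X_def)
  show "\<exists>E :: 4 set set. simple_graph E \<and> \<not> real_rooted (q_poly E)"
    using exists_cycle4 cycle4_q_poly(2) by blast
  show "\<forall>E :: 'a set set. is_cycle_graph E 4 \<longrightarrow>
        (\<exists>S1 S2. switching_classes E = {S1, S2} \<and> S1 \<noteq> S2 \<and>
           (\<forall>\<sigma>\<in>S1. spectrum (signed_adj_sq E \<sigma>) = {#4, 4, 0, 0#}) \<and>
           (\<forall>\<sigma>\<in>S2. spectrum (signed_adj_sq E \<sigma>) = {#2, 2, 2, 2#})) \<and>
        q_poly E = smult (1 / 2) (X ^ 2 * (X - 4) ^ 2 + (X - 2) ^ 4) \<and>
        q_poly E = X ^ 4 - 8 * X ^ 3 + 20 * X ^ 2 - 16 * X + 8 \<and>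
        q_poly E = (X ^ 2 - 4 * X + 2) ^ 2 + 4 \<and>
        (\<forall>x :: real. poly (q_poly E) x \<noteq> 0)"
  proof (intro allI impI, goal_cases)
    case (1 E)
    have q: "poly (q_poly E) x = 8 - 16 * x + 20 * x ^ 2 - 8 * x ^ 3 + x ^ 4" for x
      by (simp add: cycle4_q_poly(1)[OF 1] power2_eq_square power3_eq_cube power4_eq_xxxx algebra_simps)
    have sq: "poly (q_poly E) x = (x\<^sup>2 - 4 * x + 2)\<^sup>2 + 4" for x
      by (simp add: q power2_eq_square power3_eq_cube power4_eq_xxxx algebra_simps)
    show ?case
    proof (intro conjI allI)
      show "q_poly E = smult (1 / 2) (X ^ 2 * (X - 4) ^ 2 + (X - 2) ^ 4)"
        by (simp add: poly_eq pX q power2_eq_square power3_eq_cube power4_eq_xxxx algebra_simps)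
      show "q_poly E = X ^ 4 - 8 * X ^ 3 + 20 * X ^ 2 - 16 * X + 8"
        by (simp add: poly_eq pX q)
      show "q_poly E = (X ^ 2 - 4 * X + 2) ^ 2 + 4"
        by (simp add: poly_eq pX sq)
      show "poly (q_poly E) x \<noteq> 0" for x
        unfolding sq using zero_le_power2[of "x\<^sup>2 - 4 * x + 2"] by linarith
    qed (rule cycle4_switching[OF 1])
  qed
  show "\<forall>E :: 'a set set. computed_case E \<longrightarrow>
      (real_rooted (q_poly E) \<longleftrightarrow> is_odd_cycle_graph E \<or> is_K4 E)"
    using computed_case_classification settled_graph_correct(1) odd_cycle_correct(1) K4_correct(1) by blast
  show "\<forall>E :: 'a set set. is_odd_cycle_graph E \<longrightarrow>
        (\<forall>\<sigma>\<in>signings E. \<forall>\<tau>\<in>signings E.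
           (\<exists>s :: 'a \<Rightarrow> real. (\<forall>v. s v \<in> {1, - 1}) \<and>
              (\<forall>u v. signed_adj_sq E \<sigma> $ u $ v = s u * signed_adj_sq E \<tau> $ u $ v * s v)) \<and>
           charpoly (signed_adj_sq E \<sigma>) = charpoly (signed_adj_sq E \<tau>))"
    using odd_cycle_gauge odd_cycle_charpoly by metis
  show "\<forall>E :: 'a set set. is_K4 E \<longrightarrow>
        q_poly E = X ^ 4 - 12 * X ^ 3 + 42 * X ^ 2 - 52 * X + 21 \<and>
        real_rooted (q_poly E) \<and> card (cycle_subgraphs E 4) = 3"
  proof (intro allI impI conjI K4_correct K4_four_cycles)
    fix E :: "'a set set" assume "is_K4 E"
    then show "q_poly E = X ^ 4 - 12 * X ^ 3 + 42 * X ^ 2 - 52 * X + 21"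
      by (simp add: K4_q_poly(1) poly_eq pX power2_eq_square power3_eq_cube power4_eq_xxxx algebra_simps)
  qed
  show "\<not> (\<forall>E :: 4 set set. simple_graph E \<longrightarrow> (real_rooted (q_poly E) \<longleftrightarrow> \<not> contains_even_cycle E))"
  proof -
    define K :: "4 set set" where "K = {e. card e = 2}"
    have K: "is_K4 K" "simple_graph K" by (simp_all add: K_def is_K4_def simple_graph_def)
    have "cycle_subgraphs K 4 \<noteq> {}" using K4_four_cycles[OF K(1)] by auto
    then have "contains_even_cycle K" unfolding contains_even_cycle_def by (intro exI[of _ 4]) simp
    then show ?thesis using K K4_correct(1) by blast
  qed
  show "\<forall>(E :: 'a set set) d. computed_case E \<and> regular_graph E d \<longrightarrow>
        (\<forall>z :: complex. poly (map_poly complex_of_real (q_poly E)) z = 0 \<longrightarrow> Re z \<le> 4 * (real d - 1))"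
    using computed_case_classification settled_graph_correct(2) odd_cycle_correct(2) K4_correct(2) by blast
qed

end
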